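(* Let $\Gamma\subset\mathbb Q^*$ be a non-trivial finitely generated subgroup and let $m\in\mathbb N$. Then $\rho(\Gamma,m)=0$ whenever one of the following three conditions is satisfied: A. $2\nmid m$ and for all $g\in\Gamma$, $\operatorname{disc}(\mathbb Q(\sqrt g))\mid m$; B. $2\mid m$, $3\nmid m$, $\Gamma(3)$ is trivial, and there exists $\gamma_1\in\tilde\Gamma(m)$ with $3\mid\delta(\gamma_1)\mid 6m$; C. $2\| m$, $|\Gamma(2)|=2$, $\tilde\Gamma(2m)=\Gamma(4)$, and for all $\gamma\in\tilde\Gamma(2m)$, $\delta(\gamma)\mid 4m$.
   Context: $\ell$ denotes primes, $v_2$ the $2$-adic valuation, $m_2=2^{v_2(m)}$, $\mu$ the Möbius function, $\zeta_d=e^{2\pi i/d}$. For $d\in\mathbb N$, $\Gamma(d)=\Gamma\cdot{\mathbb Q^*}^d/{\mathbb Q^*}^d$ and $\Gamma^{1/d}=\{\alpha\in\mathbb R:\alpha^d\in\Gamma\}$; $$\rho(\Gamma,m)=\sum_{k\ge1}\frac{\mu(k)}{[\mathbb Q(\zeta_{mk},\Gamma^{1/mk}):\mathbb Q]}.$$ For $\gamma\in\Gamma(d)$, $\gamma'\in\mathbb Z$ is the unique (up to sign) $d$-th-power-free integer with $\gamma=\gamma'{\mathbb Q^*}^d$, taken positive if $d$ is odd or $\gamma\subset\mathbb Q^+$ and negative otherwise. If $\alpha\ge1$ and $\gamma\ne1$ lies in the $2$-torsion $\Gamma(2^\alpha)[2]$, then $\gamma'=\pm\gamma_0^{2^{\alpha-1}}$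 with $\gamma_0>1$ squarefree, and $\delta(\gamma)=\operatorname{disc}\mathbb Q(\sqrt{\gamma_0})$; for the trivial element $\delta=1$. Define $$\tilde\Gamma(m)=\left\{\gamma\in\Gamma(m_2)[2]:\ \text{if }\gamma\subset\mathbb Q^+\text{ then }v_2(\delta(\gamma))\le v_2(m);\ \text{if }\gamma\not\subseteq\mathbb Q^+\text{ then }v_2(\delta(\gamma))=v_2(m)+1\right\}.$$
   Formalization: The set Γ^{1/d} is taken to consist of all complex α with α^d in Γ, not only real α; with real roots the claim fails when Γ has negative elements (e.g. Γ=⟨−4⟩, m=2 satisfies C, yet ρ≠0). For the class of −1, γ₀=1 and δ=1. *)

theory Defs
  imports
    Complex_Main
    "HOL-Computational_Algebra.Computational_Algebra"
    "HOL-Algebra.Algebra"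
    "HOL-Algebra.Algebraic_Closure_Type"
    "Jordan_Normal_Form.Determinant"
begin

abbreviation complex_ring :: "complex ring"
  where "complex_ring \<equiv> ring_of_type_algebra"

abbreviation rat_star :: "rat monoid"
  where "rat_star \<equiv> units_of (ring_of_type_algebra :: rat ring)"

abbreviation rat_pos :: "rat set"
  where "rat_pos \<equiv> {0<..}"

definition finitely_generated_subgroup :: "rat set \<Rightarrow> bool"
  where "finitely_generated_subgroup G \<longleftrightarrow>
    subgroup G rat_star \<and>
    (\<exists>S. finite S \<and> S \<subseteq> carrier rat_star \<and> G = generate rat_star S)"


text \<open>Number fields are subfields of the complex numbers.\<close>

definition adjoin_rat :: "complex set \<Rightarrow> complex set"
  where "adjoin_rat S = generate_field complex_ring S"

definition field_degree :: "complex set \<Rightarrow> nat"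
  where "field_degree K = ring.dim complex_ring \<rat> K"

definition ring_of_integers :: "complex set \<Rightarrow> complex set"
  where "ring_of_integers K = {x \<in> K. algebraic_int x}"

definition is_integral_basis :: "complex set \<Rightarrow> complex list \<Rightarrow> bool"
  where "is_integral_basis K ws \<longleftrightarrow>
    set ws \<subseteq> ring_of_integers K \<and>
    (\<forall>x \<in> ring_of_integers K. \<exists>!cs :: int list.
       length cs = length ws \<and> x = (\<Sum>i<length ws. of_int (cs ! i) * ws ! i))"

text \<open>Embeddings are extensional, so that each one is counted once in the trace.\<close>

definition field_embeddings :: "complex set \<Rightarrow> (complex \<Rightarrow> complex) set"
  where "field_embeddings K =
    {\<sigma> \<in> extensional K. \<sigma> \<in> Ring.ring_hom (complex_ring\<lparr>carrier := K\<rparr>) complex_ring}"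

definition field_trace :: "complex set \<Rightarrow> complex \<Rightarrow> complex"
  where "field_trace K x = (\<Sum>\<sigma> \<in> field_embeddings K. \<sigma> x)"

definition field_disc :: "complex set \<Rightarrow> int"
  where "field_disc K = (THE D. \<exists>ws. is_integral_basis K ws \<and>
    of_int D = det (mat (length ws) (length ws) (\<lambda>(i, j). field_trace K (ws ! i * ws ! j))))"

definition disc_sqrt :: "rat \<Rightarrow> int"
  where "disc_sqrt g = field_disc (adjoin_rat {csqrt (of_rat g)})"


definition moebius_mu :: "nat \<Rightarrow> int"
  where "moebius_mu n = (if squarefree n then (-1) ^ card (prime_factors n) else 0)"

definition unity_root :: "nat \<Rightarrow> complex"
  where "unity_root d = exp (2 * of_real pi * \<i> / of_nat d)"

text \<open>
  All complex \<open>d\<close>-th roots are taken, not only the real ones. Adjoining only real roots would lose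
  the square roots of the negative elements of \<open>G\<close>: for \<open>G\<close> generated by \<open>-4\<close> and \<open>d = 2\<close> one
  would get the rationals instead of \<open>\<rat>(\<i>)\<close>.
\<close>

definition group_roots :: "rat set \<Rightarrow> nat \<Rightarrow> complex set"
  where "group_roots G d = {\<alpha>. \<alpha> ^ d \<in> of_rat ` G}"

definition kummer_field :: "rat set \<Rightarrow> nat \<Rightarrow> complex set"
  where "kummer_field G d = adjoin_rat (insert (unity_root d) (group_roots G d))"

definition rho :: "rat set \<Rightarrow> nat \<Rightarrow> real"
  where "rho G m =
    suminf (\<lambda>i. of_int (moebius_mu (Suc i)) / of_nat (field_degree (kummer_field G (m * Suc i))))"


definition rat_powers :: "nat \<Rightarrow> rat set"
  where "rat_powers d = (\<lambda>x. x ^ d) ` carrier rat_star"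

text \<open>The elements of this group are cosets of \<^term>\<open>rat_powers d\<close>, i.e. sets of rationals.\<close>

definition mod_powers :: "rat set \<Rightarrow> nat \<Rightarrow> rat set monoid"
  where "mod_powers G d =
    rat_star\<lparr>carrier := G <#>\<^bsub>rat_star\<^esub> rat_powers d\<rparr> Mod rat_powers d"

definition two_torsion :: "('a, 'b) monoid_scheme \<Rightarrow> 'a set"
  where "two_torsion H = {x \<in> carrier H. x \<otimes>\<^bsub>H\<^esub> x = \<one>\<^bsub>H\<^esub>}"

definition power_free :: "nat \<Rightarrow> int \<Rightarrow> bool"
  where "power_free d n \<longleftrightarrow> (\<forall>p. Factorial_Ring.prime p \<longrightarrow> \<not> p ^ d dvd n)"

definition coset_rep :: "nat \<Rightarrow> rat set \<Rightarrow> int"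
  where "coset_rep d \<gamma> = (THE n. power_free d n \<and>
    \<gamma> = rat_powers d #>\<^bsub>rat_star\<^esub> of_int n \<and>
    (if odd d \<or> \<gamma> \<subseteq> rat_pos then n > 0 else n < 0))"

text \<open>
  The functions \<open>coset_root\<close> and \<open>coset_delta\<close> are meant for \<open>d = 2 ^ a\<close> and 2-torsion cosets;
  for \<open>a \<ge> 1\<close> the exponent \<open>d div 2\<close> is \<open>2 ^ (a - 1)\<close>. The coset of \<open>-1\<close> has root \<open>1\<close>, so its
  discriminant is that of the rationals.
\<close>

definition coset_root :: "nat \<Rightarrow> rat set \<Rightarrow> nat"
  where "coset_root d \<gamma> =
    (THE n. squarefree n \<and> \<bar>coset_rep d \<gamma>\<bar> = int n ^ (d div 2))"

definition coset_delta :: "nat \<Rightarrow> rat set \<Rightarrow> int"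
  where "coset_delta d \<gamma> =
    (if \<gamma> = rat_powers d then 1 else disc_sqrt (of_nat (coset_root d \<gamma>)))"

definition two_part :: "nat \<Rightarrow> nat"
  where "two_part m = 2 ^ multiplicity 2 m"

definition Gamma_tilde :: "rat set \<Rightarrow> nat \<Rightarrow> rat set set"
  where "Gamma_tilde G m =
    {\<gamma> \<in> two_torsion (mod_powers G (two_part m)).
       (\<gamma> \<subseteq> rat_pos \<longrightarrow>
          multiplicity 2 (coset_delta (two_part m) \<gamma>) \<le> multiplicity 2 m) \<and>
       (\<not> \<gamma> \<subseteq> rat_pos \<longrightarrow>
          multiplicity 2 (coset_delta (two_part m) \<gamma>) = multiplicity 2 m + 1)}"

end

theory Submission
  imports
    Defs
    "Berlekamp_Zassenhaus.Factor_Bound"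
    "HOL-Number_Theory.Totient"
    "HOL-Analysis.Summation_Tests"
begin

text \<open>
  Put \<open>p = 2\<close> in cases A and C and \<open>p = 3\<close> in case B. For \<open>p\<close> not dividing \<open>k\<close>, the fields
  \<open>\<rat>(\<zeta>\<^bsub>mk\<^esub>, \<Gamma>\<^bsup>1/mk\<^esup>)\<close> and \<open>\<rat>(\<zeta>\<^bsub>pmk\<^esub>, \<Gamma>\<^bsup>1/pmk\<^esup>)\<close> coincide: the conditions force the
  additional roots (square roots in A, cube roots in B, fourth roots in C) into the smaller field,
  since \<open>\<surd>u\<close> lies in the cyclotomic field whose order is the discriminant of \<open>\<rat>(\<surd>u)\<close>. As
  \<open>\<mu>(pk) = - \<mu>(k)\<close>, and \<open>\<mu>(pk) = 0\<close> when \<open>p\<close> divides \<open>k\<close>, the terms of the series cancel in pairs.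

  Rearranging requires absolute convergence. The conditions exclude \<open>\<Gamma> \<subseteq> {1, -1}\<close>, so \<open>\<Gamma>\<close> contains
  some \<open>g > 1\<close>. A real root \<open>g\<^bsup>1/n\<^esup>\<close> has degree at least \<open>n / e\<close> over every cyclotomic field, where \<open>e\<close>
  depends on \<open>g\<close> only, because a real radical in a cyclotomic field is at most quadratic over \<open>\<rat>\<close>.
  Hence the \<open>k\<close>-th degree is at least \<open>mk \<phi>(k) / e\<close>, which is at least of order \<open>k\<^bsup>3/2\<^esup>\<close> for squarefree \<open>k\<close>.
\<close>

hide_const (open) Divisibility.prime

section \<open>Subfields of the complex numbers and roots of unity\<close>

text \<open>No formula for the degree of a Kummer field is used; a crude lower bound is enough for
  convergence. The obstacle to it is that X^n - g can be reducible over a cyclotomic field, since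
  such fields contain many square roots, so the loss must stay bounded while n and the cyclotomic
  field grow together. Valuations achieve this: if a real n-th root t of g has degree d, then t^(4d)
  is a rational number c with c^n = g^(4d), so n divides 4d times the valuation of g at any prime of
  its numerator. Equality of fields is checked root by root. If x^(pN) = g, then x^p is an N-th root
  of g, and by Bezout only x^N, a root of small order, has to be found in the smaller field; in case
  C, where N is even, its odd part takes over. Divisibility by discriminants acts through explicit
  square roots: products of 1 - zeta^a for odd numbers, i for the sign, and zeta_8 + 1/zeta_8 for
  2.\<close>

lemma ring_of_type_algebra_simps [simp]:
  "carrier (ring_of_type_algebra :: 'a::Fields.field ring) = UNIV"
  "(x :: 'a) \<otimes>\<^bsub>ring_of_type_algebra\<^esub> y = x * y"
  "x \<oplus>\<^bsub>ring_of_type_algebra\<^esub> y = x + y"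
  "\<one>\<^bsub>ring_of_type_algebra\<^esub> = (1 :: 'a)"
  "\<zero>\<^bsub>ring_of_type_algebra\<^esub> = (0 :: 'a)"
  by (simp_all add: ring_of_type_algebra_def)

interpretation CR: Ring.domain "complex_ring"
  using Ring.field.axioms(1)[OF field_from_type_algebra] .

lemma a_inv_complex_ring [simp]: "\<ominus>\<^bsub>complex_ring\<^esub> x = - x"
  by (rule CR.minus_equality) auto

lemma m_inv_complex_ring [simp]: "x \<noteq> 0 \<Longrightarrow> inv\<^bsub>complex_ring\<^esub> x = inverse x"
  by (rule CR.inv_unique'[symmetric]) auto

lemma nat_pow_complex_ring [simp]: "x [^]\<^bsub>complex_ring\<^esub> (n::nat) = x ^ n"
  by (induction n) (auto simp: mult.commute)

lemma subfield_complexI: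
  assumes "1 \<in> K" "\<And>x y. x \<in> K \<Longrightarrow> y \<in> K \<Longrightarrow> x + y \<in> K" "\<And>x. x \<in> K \<Longrightarrow> - x \<in> K"
    "\<And>x y. x \<in> K \<Longrightarrow> y \<in> K \<Longrightarrow> x * y \<in> K" "\<And>x. x \<in> K \<Longrightarrow> x \<noteq> 0 \<Longrightarrow> inverse x \<in> K"
  shows "subfield K complex_ring"
proof (rule Subrings.field.subfieldI'[OF field_from_type_algebra CR.subringI])
  fix k assume "k \<in> K - {\<zero>\<^bsub>complex_ring\<^esub>}"
  thus "inv\<^bsub>complex_ring\<^esub> k \<in> K" using assms by auto
qed (use assms in auto)

context
  fixes K assumes K: "subfield K complex_ring"
begin

lemma csubfield_one: "1 \<in> K" and csubfield_zero: "0 \<in> K"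
  and csubfield_add: "x \<in> K \<Longrightarrow> y \<in> K \<Longrightarrow> x + y \<in> K"
  and csubfield_mult: "x \<in> K \<Longrightarrow> y \<in> K \<Longrightarrow> x * y \<in> K"
  and csubfield_uminus: "x \<in> K \<Longrightarrow> - x \<in> K"
  using subringE(2,3,5,6,7)[OF subfieldE(1)[OF K]] by auto

lemma csubfield_inverse: "x \<in> K \<Longrightarrow> inverse x \<in> K"
  using CR.subfield_m_inv(1)[OF K, of x] csubfield_zero by (cases "x = 0") auto

lemma csubfield_diff: "x \<in> K \<Longrightarrow> y \<in> K \<Longrightarrow> x - y \<in> K"
  using csubfield_add[of x "- y"] csubfield_uminus by simp

lemma csubfield_divide: "x \<in> K \<Longrightarrow> y \<in> K \<Longrightarrow> x / y \<in> K"
  by (simp add: divide_inverse csubfield_inverse csubfield_mult)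

lemma csubfield_power: "x \<in> K \<Longrightarrow> x ^ n \<in> K"
  by (induction n) (auto intro: csubfield_one csubfield_mult)

lemma csubfield_sum: "(\<And>i. i \<in> I \<Longrightarrow> f i \<in> K) \<Longrightarrow> sum f I \<in> K"
  by (induction I rule: infinite_finite_induct) (auto intro: csubfield_zero csubfield_add)

lemma csubfield_prod: "(\<And>i. i \<in> I \<Longrightarrow> f i \<in> K) \<Longrightarrow> prod f I \<in> K"
  by (induction I rule: infinite_finite_induct) (auto intro: csubfield_one csubfield_mult)

lemma csubfield_of_nat: "of_nat n \<in> K"
  by (induction n) (auto intro: csubfield_zero csubfield_one csubfield_add)

lemma csubfield_of_int: "of_int n \<in> K"
  by (cases n) (auto intro!: csubfield_of_nat csubfield_uminus simp flip: of_nat_Suc simp del: of_nat_Suc)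

lemma csubfield_of_rat: "of_rat q \<in> K"
  by (cases q) (auto simp: of_rat_rat intro!: csubfield_divide csubfield_of_int)

lemma csubfield_numeral: "numeral n \<in> K"
  using csubfield_of_nat[of "numeral n"] by simp

lemma csubfield_Rats: "\<rat> \<subseteq> K"
  by (auto elim!: Rats_cases intro: csubfield_of_rat)

text \<open>The equation leaves only y = x or y = -x, so finding one square root in K settles the
  membership of whichever root is at hand, for example a value of \<open>csqrt\<close>.\<close>

lemma csubfield_sqrt_unique: "x \<in> K \<Longrightarrow> y ^ 2 = x ^ 2 \<Longrightarrow> y \<in> K"
  by (auto simp: power2_eq_iff intro: csubfield_uminus)

lemmas csubfield_intros = csubfield_one csubfield_zero csubfield_add csubfield_mult csubfield_uminus csubfield_inverse csubfield_diff csubfield_divide csubfield_power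
  csubfield_sum csubfield_prod csubfield_of_nat csubfield_of_int csubfield_of_rat csubfield_numeral

end

lemma subfield_Rats: "subfield \<rat> complex_ring"
  by (rule subfield_complexI) auto

lemma subfield_adjoin_rat: "subfield (adjoin_rat S) complex_ring"
  unfolding adjoin_rat_def by (rule Generated_Fields.field.generate_field_is_subfield[OF field_from_type_algebra]) simp

lemma adjoin_rat_incl: "S \<subseteq> adjoin_rat S"
  unfolding adjoin_rat_def by (auto intro: generate_field.incl)

lemma adjoin_rat_minimal:
  assumes "subfield E complex_ring" "S \<subseteq> E" shows "adjoin_rat S \<subseteq> E"
  unfolding adjoin_rat_def by (rule Generated_Fields.field.generate_field_min_subfield1[OF field_from_type_algebra]) (use assms in auto)

section \<open>Roots of unity and cyclotomic square roots\<close>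

lemma unity_root_conv_cis: "unity_root n = cis (2 * pi / n)"
  by (simp add: unity_root_def cis_conv_exp mult_ac)

lemma unity_root_power: "unity_root n ^ k = cis (2 * pi * k / n)"
  by (simp add: unity_root_conv_cis DeMoivre mult_ac)

lemma unity_root_power_self [simp]: "n > 0 \<Longrightarrow> unity_root n ^ n = 1"
  by (simp add: unity_root_power)

lemma unity_root_nonzero [simp]: "unity_root n \<noteq> 0"
  by (simp add: unity_root_conv_cis)

lemma bij_betw_unity_root:
  "n > 0 \<Longrightarrow> bij_betw (\<lambda>k. unity_root n ^ k) {..<n} {z. z ^ n = 1}"
  using bij_betw_roots_unity[of n] by (simp add: unity_root_power)

lemma unity_root_dvd:
  assumes "d dvd n" "n > 0" shows "unity_root n ^ (n div d) = unity_root d"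
  using assms by (cases "d = 0") (auto simp: unity_root_conv_cis DeMoivre dvd_def)

lemma unity_root_power_eq_1_iff:
  assumes "n > 0" shows "unity_root n ^ k = 1 \<longleftrightarrow> n dvd k"
proof
  assume *: "unity_root n ^ k = 1"
  have "unity_root n ^ k = unity_root n ^ (n * (k div n) + k mod n)" by simp
  also have "\<dots> = unity_root n ^ (k mod n)"
    using assms by (simp only: power_add power_mult unity_root_power_self power_one) simp
  finally have "unity_root n ^ (k mod n) = unity_root n ^ 0" using * by simp
  with bij_betw_imp_inj_on[OF bij_betw_unity_root[OF assms]] assms
  have "k mod n = 0" by (auto simp: inj_on_def)
  thus "n dvd k" by auto
qed (use assms in \<open>auto elim!: dvdE simp: power_mult\<close>)

lemma power_unity_roots:
  assumes "x ^ n = y ^ n" "n > 0" "y \<noteq> 0"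
  obtains i where "x = y * unity_root n ^ i"
proof -
  have "(x / y) ^ n = 1" using assms by (simp add: power_divide)
  then obtain i where "x / y = unity_root n ^ i"
    using bij_betw_imp_surj_on[OF bij_betw_unity_root[OF assms(2)]] by blast
  thus ?thesis using that[of i] assms by (auto simp: field_simps)
qed

text \<open>X^n - 1 is factored once over its roots and once by the geometric series; cancelling X -
  1 and evaluating at 1 gives the value.\<close>

lemma prod_one_minus_unity_root:
  assumes "n > 0" shows "(\<Prod>a\<in>{1..<n}. 1 - unity_root n ^ a) = of_nat n"
proof -
  define p :: "complex poly" where "p = monom 1 n - 1"
  define q :: "complex poly" where "q = (\<Prod>a\<in>{1..<n}. [:- (unity_root n ^ a), 1:])"
  have rt: "poly p z = 0 \<longleftrightarrow> z ^ n = 1" for z by (simp add: p_def poly_monom)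
  have lc: "Polynomial.lead_coeff p = 1"
  proof -
    have "degree (- 1 + monom 1 n :: complex poly) = n" using assms
      by (subst degree_add_eq_right) (auto simp: degree_monom_eq)
    thus ?thesis using assms by (simp add: p_def)
  qed
  \<comment> \<open>The derivative n X^(n-1) vanishes at most at 0, which is not a root.\<close>
  have "rsquarefree p"
    unfolding rsquarefree_roots
    using assms by (auto simp: p_def pderiv_diff pderiv_monom poly_monom power_0_left)
  from complex_poly_decompose_rsquarefree[OF this]
  have "p = (\<Prod>z | z ^ n = 1. [:- z, 1:])" by (simp add: lc rt)
  also have "\<dots> = (\<Prod>a<n. [:- (unity_root n ^ a), 1:])"
    by (rule prod.reindex_bij_betw[OF bij_betw_unity_root[OF assms], symmetric])
  also have "\<dots> = [:-1, 1:] * q"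
  proof -
    have "{..<n} = insert 0 {1..<n}" using assms by auto
    thus ?thesis by (simp add: q_def del: mult_pCons_left mult_pCons_right)
  qed
  finally have 1: "p = [:-1, 1:] * q" .
  have "p = [:-1, 1:] * (\<Sum>i<n. monom 1 i)"
    by (rule poly_eq_poly_eq_iff[THEN iffD1], rule ext)
      (simp add: p_def poly_sum poly_monom power_diff_1_eq left_diff_distrib)
  with 1 have "[:-1, 1:] * q = [:-1, 1:] * (\<Sum>i<n. monom 1 i)" by (rule trans[OF sym])
  hence "q = (\<Sum>i<n. monom 1 i)" by (subst (asm) mult_left_cancel) auto
  hence "poly q 1 = of_nat n" by (simp add: poly_sum poly_monom)
  thus ?thesis by (simp add: q_def poly_prod)
qed

lemma sqrt_signed_odd_in_cyclotomic:
  assumes n: "odd n" and K: "subfield K complex_ring" and \<omega>: "unity_root n \<in> K"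
  obtains x where "x \<in> K" "x ^ 2 = (-1) ^ (n div 2) * of_nat n"
proof -
  \<comment> \<open>In \<open>n = \<Prod>\<^bsub>0<a<n\<^esub> (1 - \<zeta>\<^bsup>a\<^esup>)\<close> the factors for \<open>a\<close> and \<open>n - a\<close> multiply to minus a square,
    as \<open>\<zeta>\<close> has a square root \<open>c\<close> among its powers.\<close>
  define h where "h = n div 2"
  have nh: "n = 2 * h + 1" using n by (auto simp: h_def)
  define c where "c = unity_root n ^ Suc h"
  have c0: "c \<noteq> 0" by (simp add: c_def)
  have "c ^ 2 = unity_root n ^ n * unity_root n"
    by (simp add: c_def nh power2_eq_square flip: power_add) (simp add: mult_2)
  hence c2: "c ^ 2 = unity_root n" using n by (simp add: odd_pos)
  define x where "x = (\<Prod>a\<in>{1..h}. c ^ a - inverse (c ^ a))"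
  have "of_nat n = (\<Prod>a\<in>{1..<n}. 1 - unity_root n ^ a)"
    using prod_one_minus_unity_root[of n] n by (simp add: odd_pos)
  also have "{1..<n} = {1..h} \<union> {h+1..2*h}" using nh by auto
  also have "(\<Prod>a\<in>{1..h} \<union> {h+1..2*h}. 1 - unity_root n ^ a)
     = (\<Prod>a\<in>{1..h}. 1 - unity_root n ^ a) * (\<Prod>a\<in>{h+1..2*h}. 1 - unity_root n ^ a)"
    by (rule prod.union_disjoint) auto
  also have "(\<Prod>a\<in>{h+1..2*h}. 1 - unity_root n ^ a) = (\<Prod>a\<in>{1..h}. 1 - unity_root n ^ (n - a))"
    by (rule prod.reindex_bij_witness[of _ "\<lambda>a. n - a" "\<lambda>a. n - a"]) (auto simp: nh)
  also have "(\<Prod>a\<in>{1..h}. 1 - unity_root n ^ a) * (\<Prod>a\<in>{1..h}. 1 - unity_root n ^ (n - a))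
    = (\<Prod>a\<in>{1..h}. (-1) * (c ^ a - inverse (c ^ a)) ^ 2)"
    unfolding prod.distrib[symmetric]
  proof (rule prod.cong[OF refl])
    fix a assume a: "a \<in> {1..h}"
    have "unity_root n ^ (n - a) * unity_root n ^ a = 1"
      using a n nh by (metis atLeastAtMost_iff le_add_diff_inverse2 le_add1 mult_2 odd_pos order_trans
        power_add unity_root_power_self)
    hence i: "unity_root n ^ (n - a) = inverse (unity_root n ^ a)"
      by (metis inverse_unique mult.commute)
    have "unity_root n ^ a = (c ^ a) ^ 2" by (simp add: c2[symmetric] mult.commute flip: power_mult)
    thus "(1 - unity_root n ^ a) * (1 - unity_root n ^ (n - a)) = (-1) * (c ^ a - inverse (c ^ a))\<^sup>2"
      unfolding i using c0 by (simp add: field_simps power2_eq_square)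
  qed
  also have "\<dots> = (-1) ^ h * x ^ 2"
    unfolding prod.distrib x_def prod_power_distrib[symmetric] by simp
  finally have "of_nat n = (-1) ^ h * x ^ 2" .
  hence "x ^ 2 = (-1) ^ h * of_nat n" by (cases "even h") auto
  moreover have "x \<in> K" unfolding x_def c_def using \<omega> by (intro csubfield_intros[OF K])
  ultimately show ?thesis using that h_def by blast
qed

lemma unity_root_dvd_in:
  assumes "subfield K complex_ring" "unity_root n \<in> K" "d dvd n" "n > 0"
  shows "unity_root d \<in> K"
  unfolding unity_root_dvd[OF assms(3,4), symmetric] using assms by (auto intro: csubfield_power)

text \<open>With d = |u|, the congruence says u = (-1)^(d div 2) * d, so the product construction
  applies to d as a whole, without passing through its prime factors.\<close>

lemma sqrt_mod4_in:
  assumes K: "subfield K complex_ring" "unity_root n \<in> K" and n: "n > 0"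
    and u: "u dvd int n" "u mod 4 = 1" and x: "x ^ 2 = of_int u"
  shows "x \<in> K"
proof -
  define d where "d = nat \<bar>u\<bar>"
  have "odd u" using u(2) by presburger
  hence d: "odd d" "d dvd n" using u(1) unfolding d_def by (auto simp: nat_dvd_iff even_nat_iff)
  obtain y where y: "y \<in> K" "y ^ 2 = (-1) ^ (d div 2) * of_nat d"
    using sqrt_signed_odd_in_cyclotomic[OF d(1) K(1) unity_root_dvd_in[OF K d(2) n]] .
  have "int (d div 2) = \<bar>u\<bar> div 2" by (simp add: d_def zdiv_int)
  moreover have "even (\<bar>u\<bar> div 2) \<longleftrightarrow> u > 0" using u(2) by presburger
  ultimately have "even (d div 2) \<longleftrightarrow> u > 0" by (metis even_of_nat)
  hence "(-1) ^ (d div 2) * of_nat d = (of_int u :: complex)"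
    by (cases "u > 0") (auto simp: d_def minus_one_power_iff)
  thus ?thesis using csubfield_sqrt_unique[OF K(1) y(1)] x y by simp
qed

section \<open>Lower bounds for degrees of field extensions\<close>

text \<open>The powers are listed from the highest down because spans and independent lists grow at
  the head: passing from n to n + 1 prepends x^n. \<open>Poly\<close> expects the constant
  coefficient first, hence the \<open>rev\<close>.\<close>

lemma combine_powers:
  "length Ks = n \<Longrightarrow> CR.combine Ks (map (\<lambda>i. x ^ i) (rev [0..<n])) = poly (Poly (rev Ks)) x"
proof (induction n arbitrary: Ks)
  case (Suc n)
  then obtain k Ks' where Ks: "Ks = k # Ks'" "length Ks' = n" by (cases Ks) auto
  thus ?case using Suc.IH[OF Ks(2)] by (simp add: Poly_snoc poly_monom)
qed auto

lemma powers_independent: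
  assumes K: "subfield K complex_ring"
    and indep: "\<And>p. (\<forall>i. coeff p i \<in> K) \<Longrightarrow> degree p < n \<Longrightarrow> poly p x = 0 \<Longrightarrow> p = 0"
  shows "CR.independent K (map (\<lambda>i. x ^ i) (rev [0..<n]))"
  using indep
proof (induction n)
  case (Suc n)
  have "x ^ n \<notin> CR.Span K (map (\<lambda>i. x ^ i) (rev [0..<n]))"
  proof
    assume "x ^ n \<in> CR.Span K (map (\<lambda>i. x ^ i) (rev [0..<n]))"
    then obtain Ks where Ks: "set Ks \<subseteq> K" "length Ks = n" "x ^ n = poly (Poly (rev Ks)) x"
      using CR.Span_mem_iff_length_version[OF K, of "map (\<lambda>i. x ^ i) (rev [0..<n])"]
      by (auto simp del: CR.Span.simps simp: combine_powers)
    \<comment> \<open>A dependence would give a monic annihilator of degree n, which the hypothesis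
      excludes.\<close>
    define p where "p = monom 1 n - Poly (rev Ks)"
    have c: "coeff (Poly (rev Ks)) i \<in> K" for i
      using Ks(1) csubfield_zero[OF K] by (auto simp: coeff_Poly_eq nth_default_def rev_nth)
    have "coeff p n = 1" by (simp add: p_def coeff_Poly_eq nth_default_def Ks(2))
    moreover have "p = 0"
    proof (rule Suc.prems)
      show "\<forall>i. coeff p i \<in> K" using c by (auto simp: p_def intro!: csubfield_intros[OF K])
      show "degree p < Suc n" unfolding less_Suc_eq_le
        by (rule degree_le) (auto simp: p_def coeff_Poly_eq nth_default_def Ks(2))
      show "poly p x = 0" by (simp add: p_def poly_monom Ks(3))
    qed
    ultimately show False by simp
  qed
  thus ?case using Suc by (auto intro!: CR.independent.li_Cons simp del: CR.Span.simps)
qed auto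

lemma dim_ge_powers:
  assumes K: "subfield K complex_ring" and E: "CR.finite_dimension K E"
    and x: "\<And>i. i < n \<Longrightarrow> x ^ i \<in> E"
    and indep: "\<And>p. (\<forall>i. coeff p i \<in> K) \<Longrightarrow> degree p < n \<Longrightarrow> poly p x = 0 \<Longrightarrow> p = 0"
  shows "n \<le> CR.dim K E"
proof -
  have "length (map (\<lambda>i. x ^ i) (rev [0..<n])) \<le> CR.dim K E"
    by (rule CR.independent_length_le_dimension[OF K _ powers_independent[OF K indep]])
      (use CR.finite_dimensionE[OF K E] x in \<open>auto simp: over_def\<close>)
  thus ?thesis by simp
qed

text \<open>The list is X^(n+1) - c in the dense coefficient lists of \<open>univ_poly\<close>,
  leading coefficient first.\<close>

lemma eval_radical_list:
  "CR.eval (1 # replicate n 0 @ [- c]) x = x ^ Suc n - c"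
proof -
  have "CR.eval (replicate k 0 @ [- c]) x = - c" for k by (induction k) auto
  thus ?thesis by simp
qed

lemma algebraic_radical:
  assumes K: "subfield K complex_ring" and x: "x ^ n \<in> K" "n > 0"
  shows "(CR.algebraic over K) x"
proof (rule CR.algebraicI)
  let ?p = "1 # replicate (n - 1) 0 @ [- (x ^ n)]"
  show "?p \<in> carrier (univ_poly complex_ring K)"
    using csubfield_one[OF K] csubfield_zero[OF K] csubfield_uminus[OF K x(1)]
    by (simp add: univ_poly_def polynomial_def set_replicate_conv_if)
  show "CR.eval ?p x = \<zero>\<^bsub>complex_ring\<^esub>" using x(2) unfolding eval_radical_list by simp
qed auto

lemma finite_dimension_radicals:
  assumes K: "subfield K complex_ring" and V: "finite V" "\<And>x. x \<in> V \<Longrightarrow> x ^ n \<in> K" "n > 0"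
  obtains E where "subfield E complex_ring" "K \<subseteq> E" "V \<subseteq> E" "CR.finite_dimension K E"
proof -
  obtain xs where xs: "set xs = V" using V(1) finite_list by blast
  have alg: "\<And>x. x \<in> set xs \<Longrightarrow> (CR.algebraic over K) x"
    using algebraic_radical[OF K] V xs by blast
  show ?thesis
  proof
    show "subfield (CR.finite_extension K xs) complex_ring"
      by (rule CR.finite_extension_is_subfield[OF K _ alg]) auto
    show "K \<subseteq> CR.finite_extension K xs" by (rule CR.finite_extension_incl) auto
    show "V \<subseteq> CR.finite_extension K xs"
      unfolding xs[symmetric] by (rule CR.finite_extension_mem[OF subfieldE(1)[OF K]]) auto
    show "CR.finite_dimension K (CR.finite_extension K xs)"
      by (rule CR.finite_extension_finite_dimension(1)[OF K _ alg]) auto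
  qed
qed

lemma subfield_subalgebra:
  assumes "subfield K complex_ring" "subfield E complex_ring" "K \<subseteq> E"
  shows "subalgebra K E complex_ring"
proof -
  have "subgroup E (add_monoid complex_ring)"
    using subring.axioms(1)[OF subfieldE(1)[OF assms(2)]] .
  thus ?thesis using assms csubfield_mult[OF assms(2)]
    by (auto simp: subalgebra_def subalgebra_axioms_def)
qed

lemma finite_dimension_subfield:
  assumes "subfield K complex_ring" "subfield F complex_ring" "subfield E complex_ring"
    "K \<subseteq> F" "F \<subseteq> E" "CR.finite_dimension K E"
  shows "CR.finite_dimension K F" "CR.finite_dimension F E"
proof -
  show "CR.finite_dimension K F"
    by (rule CR.subalbegra_incl_imp_finite_dimension[OF assms(1,6) subfield_subalgebra])
      (use assms in auto)
  obtain Us where Us: "CR.Span K Us = E"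
    using CR.exists_base[OF assms(1)] CR.finite_dimensionE[OF assms(1,6)] by (metis over_def)
  \<comment> \<open>A list spanning E over K spans it over F as well: its F-span is closed under
    scalars from K and contains the list.\<close>
  have "subalgebra K (CR.Span F Us) complex_ring"
    using CR.Span_is_subalgebra[OF assms(2), of Us] assms(4)
    by (auto simp: subalgebra_def subalgebra_axioms_def simp del: CR.Span.simps)
  hence "E \<subseteq> CR.Span F Us"
    unfolding Us[symmetric]
    by (intro CR.subalgebra_Span_incl[OF assms(1)] CR.Span_base_incl[OF assms(2)])
      (auto simp del: CR.Span.simps)
  thus "CR.finite_dimension F E"
    by (intro CR.subalbegra_incl_imp_finite_dimension[OF assms(2) CR.Span_finite_dimension[OF assms(2), of Us] subfield_subalgebra[OF assms(2,3,5)]]) auto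
qed

lemma dim_tower_ge:
  assumes "subfield K complex_ring" "subfield F complex_ring" "subfield E complex_ring"
    "K \<subseteq> F" "F \<subseteq> E" "CR.finite_dimension K E"
    "a \<le> CR.dim K F" "b \<le> CR.dim F E"
  shows "a * b \<le> CR.dim K E"
  using CR.telescopic_base_dim(2)[OF assms(1,2) finite_dimension_subfield[OF assms(1-6)]] assms(7,8)
  by (auto simp: over_def intro: mult_mono)

text \<open>\<open>simple_extension\<close> is generated by Horner steps k1 * x + k2, so the
  induction builds the polynomial one coefficient at a time.\<close>

lemma simple_extension_poly:
  assumes "z \<in> CR.simple_extension \<rat> x"
  obtains p :: "rat poly" where "z = poly (map_poly of_rat p) x"
  using assms
proof (induction arbitrary: thesis rule: CR.simple_extension.induct)
  case zero
  show ?case by (rule zero[of 0]) auto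
next
  case (lin k1 k2)
  obtain p where p: "k1 = poly (map_poly of_rat p) x" using lin(3) .
  obtain q where q: "k2 = of_rat q" using lin(2) by (auto elim: Rats_cases)
  show ?case by (rule lin(4)[of "pCons q p"]) (use p q in \<open>auto simp: of_rat_hom.map_poly_pCons_hom mult.commute\<close>)
qed

lemma simple_extension_root_of_unity:
  assumes "x ^ n = 1" "n > 0"
  shows "subfield (CR.simple_extension \<rat> x) complex_ring" "x \<in> CR.simple_extension \<rat> x"
proof -
  have a: "(CR.algebraic over \<rat>) x" by (rule algebraic_radical[OF subfield_Rats _ assms(2)]) (simp add: assms)
  thus "subfield (CR.simple_extension \<rat> x) complex_ring"
    using CR.simple_extension_is_subfield[OF subfield_Rats, of x] by simp
  show "x \<in> CR.simple_extension \<rat> x"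
    by (rule CR.simple_extension_mem[OF subfieldE(1)[OF subfield_Rats]]) simp
qed

section \<open>Conjugates of roots of unity\<close>

abbreviation ratp :: "rat poly \<Rightarrow> complex poly" where "ratp \<equiv> map_poly of_rat"
abbreviation intp :: "int poly \<Rightarrow> complex poly" where "intp \<equiv> map_poly of_int"

lemma ratp_of_int_poly [simp]: "ratp (of_int_poly f) = intp f"
  by (simp add: map_poly_map_poly o_def)

lemma ratp_hom:
  "ratp (p + q) = ratp p + ratp q" "ratp (p * q) = ratp p * ratp q" "ratp (p - q) = ratp p - ratp q"
  by (rule poly_eqI; simp add: coeff_mult of_rat_add of_rat_diff of_rat_mult of_rat_sum)+

lemma poly_intp_mult [simp]:
  "poly (intp (f * g)) x = poly (intp f) x * poly (intp g) x"
  by (simp add: of_int_poly_hom.hom_mult)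

lemma poly_intp_pcompose_monom:
  "poly (intp (pcompose f (monom 1 p))) x = poly (intp f) (x ^ p)"
  by (simp add: of_int_hom.map_poly_pcompose poly_pcompose poly_monom)

text \<open>Gauss's lemma: the primitive integer polynomial g proportional to q divides f over the
  integers, so its leading coefficient is a unit, and positivity of the scaling factor c forces c =
  1.\<close>

lemma monic_rat_factor_of_monic_int_poly:
  assumes f: "lead_coeff f = 1" and q: "of_int_poly f = q * (r :: rat poly)" "lead_coeff q = 1"
  obtains q' where "q = of_int_poly q'" "lead_coeff q' = 1"
proof -
  obtain c g where cg: "rat_to_normalized_int_poly q = (c, g)" by (metis surj_pair)
  note g = rat_to_normalized_int_poly[OF cg]
  obtain h where h: "f = g * h"
    using rat_to_int_factor_explicit[OF q(1) cg] by blast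
  have "lead_coeff g * lead_coeff h = 1" using f h by (simp add: lead_coeff_mult)
  hence lg: "lead_coeff g = 1 \<or> lead_coeff g = -1" using zmult_eq_1_iff by blast
  have "c * of_int (lead_coeff g) = 1"
    using q(2) g(4) by (subst (asm) (1) g(1)) simp
  with lg \<open>c > 0\<close> have "c = 1" "lead_coeff g = 1" by auto
  with g(1) that show ?thesis by auto
qed

text \<open>A rational annihilator of least degree, made monic, divides the monic integer polynomial
  of x and is therefore integral itself. The integer coefficients later permit reasoning modulo
  primes.\<close>

lemma algebraic_int_minpoly:
  assumes "algebraic_int (x :: complex)"
  obtains f where "lead_coeff f = 1" "poly (intp f) x = 0"
    "\<And>g. poly (ratp g) x = 0 \<Longrightarrow> of_int_poly f dvd g"
proof -
  obtain p where p: "poly (intp p) x = 0" "lead_coeff p = 1"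
    using assms unfolding algebraic_int_altdef_ipoly by blast
  define P where "P = (\<lambda>g :: rat poly. g \<noteq> 0 \<and> poly (ratp g) x = 0)"
  have "P (of_int_poly p)" using p by (auto simp: P_def)
  then obtain g0 where g0: "P g0" "\<And>g. P g \<Longrightarrow> degree g0 \<le> degree g"
    using ex_has_least_nat[of P "of_int_poly p" degree] by blast
  define g1 where "g1 = smult (inverse (lead_coeff g0)) g0"
  have g1: "lead_coeff g1 = 1" "degree g1 = degree g0" "poly (ratp g1) x = 0"
    using g0(1) by (auto simp: g1_def P_def of_rat_hom.map_poly_hom_smult)
  have dvd: "g1 dvd g" if "poly (ratp g) x = 0" for g
  proof (rule ccontr)
    assume "\<not> g1 dvd g"
    hence r0: "g mod g1 \<noteq> 0" by auto
    have "ratp g = ratp g1 * ratp (g div g1) + ratp (g mod g1)"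
      by (metis mult_div_mod_eq ratp_hom(1,2))
    hence "P (g mod g1)" using that g1(3) r0 by (simp add: P_def)
    hence "degree g0 \<le> degree (g mod g1)" by (rule g0(2))
    moreover have "g1 \<noteq> 0" using g1(1) by auto
    ultimately show False using degree_mod_less[of g1 g] r0 g1(2) by auto
  qed
  have "g1 dvd of_int_poly p" by (rule dvd) (use p in simp)
  then obtain r where "of_int_poly p = g1 * r" by blast
  then obtain f where f: "g1 = of_int_poly f" "lead_coeff f = 1"
    by (rule monic_rat_factor_of_monic_int_poly[OF p(2) _ g1(1)])
  show ?thesis by (rule that[OF f(2)]) (use g1(3) dvd in \<open>auto simp: f(1)\<close>)
qed

text \<open>The inner binomial coefficients are divisible by p. A general commutative ring is taken
  because both integers and integer polynomials are plugged in.\<close>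

lemma prime_dvd_binomial_defect:
  fixes u v :: "'a :: comm_ring_1"
  assumes p: "prime p" shows "of_nat p dvd (u + v) ^ p - u ^ p - v ^ p"
proof -
  have p1: "p > 1" using p by (rule prime_gt_1_nat)
  have "{..p} = insert 0 (insert p {1..<p})" using p1 by auto
  hence "(u + v) ^ p - u ^ p - v ^ p = (\<Sum>k\<in>{1..<p}. of_nat (p choose k) * u ^ k * v ^ (p - k))"
    using p1 by (simp add: binomial_ring)
  moreover have "(of_nat p :: 'a) dvd (\<Sum>k\<in>{1..<p}. of_nat (p choose k) * u ^ k * v ^ (p - k))"
  proof (rule dvd_sum)
    fix k assume "k \<in> {1..<p}"
    hence "p dvd (p choose k)" using p by (intro dvd_choose_prime) auto
    hence "(of_nat p :: 'a) dvd of_nat (p choose k)" by (auto elim!: dvdE)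
    thus "(of_nat p :: 'a) dvd of_nat (p choose k) * u ^ k * v ^ (p - k)"
      by (simp add: dvd_mult2)
  qed
  ultimately show ?thesis by simp
qed

lemma prime_dvd_fermat_defect:
  assumes p: "prime p" shows "int p dvd a ^ p - a"
proof (induction a rule: int_induct[where k = 0])
  case base
  have "p > 0" using p by (rule prime_gt_0_nat)
  thus ?case by (simp add: power_0_left)
next
  case (step1 i)
  have "(i + 1) ^ p - (i + 1) = ((i + 1) ^ p - i ^ p - 1 ^ p) + (i ^ p - i)" by simp
  thus ?case using step1(2) prime_dvd_binomial_defect[OF p, of i 1] by (metis dvd_add)
next
  case (step2 i)
  have "(i - 1) ^ p - (i - 1) = (i ^ p - i) - (((i - 1) + 1) ^ p - (i - 1) ^ p - 1 ^ p)" by simp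
  thus ?case using step2(2) prime_dvd_binomial_defect[OF p, of "i - 1" 1] by (metis dvd_diff)
qed

lemma prime_dvd_pcompose_power_defect:
  fixes h :: "int poly"
  assumes p: "prime p" shows "of_nat p dvd pcompose h (monom 1 p) - h ^ p"
proof (induction h)
  case (pCons a h)
  let ?m = "monom 1 p :: int poly"
  have m: "?m = (monom 1 1) ^ p" by (simp add: monom_power)
  have e: "pCons a h = [:a:] + monom 1 1 * h" by (simp add: monom_altdef)
  \<comment> \<open>With the polynomial written as a + X h, the defect splits into Fermat's for a,
    X^p times the defect of h, and the binomial defect of the sum. The result is the Frobenius
    identity modulo p.\<close>
  have "pcompose (pCons a h) ?m - pCons a h ^ p
     = - [:a ^ p - a:] + ?m * (pcompose h ?m - h ^ p)
       - (([:a:] + monom 1 1 * h) ^ p - [:a:] ^ p - (monom 1 1 * h) ^ p)"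
    unfolding e[symmetric] power_mult_distrib m[symmetric] 
    by (simp add: pcompose_pCons algebra_simps poly_const_pow)
  moreover have "(of_nat p :: int poly) dvd [:a ^ p - a:]"
    using prime_dvd_fermat_defect[OF p, of a] by (simp add: of_nat_poly const_poly_dvd)
  ultimately show ?case using pCons.IH prime_dvd_binomial_defect[OF p, of "[:a:]" "monom 1 1 * h"]
    by (metis dvd_add dvd_diff dvd_minus_iff dvd_mult)
qed (use prime_gt_0_nat[OF p] in \<open>simp add: power_0_left\<close>)

text \<open>
  Landau's argument: reduce \<open>f(x\<^bsup>p\<^esup>)\<close> modulo the minimal polynomial \<open>f\<close> of \<open>\<zeta>\<close>. The coefficients of the
  remainder are divisible by \<open>p\<close>, but bounded independently of \<open>p\<close> since only \<open>p mod n\<close> matters.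
  So \<open>f(\<zeta>\<^bsup>p\<^esup>) = 0\<close> for all large primes \<open>p\<close>, and every residue class coprime to \<open>n\<close> contains a product
  of large primes.
\<close>

lemma cyclotomic_conjugate:
  assumes n: "n > 0" and a: "Rings.coprime a n" and g: "poly (ratp g) (unity_root n) = 0"
  shows "poly (ratp g) (unity_root n ^ a) = 0"
proof -
  define \<zeta> where "\<zeta> = unity_root n"
  have \<zeta>n: "\<zeta> ^ n = 1" using n by (simp add: \<zeta>_def)
  have "algebraic_int \<zeta>"
    by (rule algebraic_int_root[of 1 "monom 1 n"])
      (use n \<zeta>n in \<open>auto simp: poly_monom degree_monom_eq\<close>)
  then obtain f where f: "lead_coeff f = 1" "poly (intp f) \<zeta> = 0"
    "\<And>g. poly (ratp g) \<zeta> = 0 \<Longrightarrow> of_int_poly f dvd g"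
    using algebraic_int_minpoly by blast
  have f0: "f \<noteq> 0" using f(1) by auto
  have small: "r = 0" if "degree r < degree f" "poly (intp r) \<zeta> = 0" for r :: "int poly"
  proof (rule ccontr)
    assume "r \<noteq> 0"
    have "of_int_poly f dvd (of_int_poly r :: rat poly)" by (rule f(3)) (use that in simp)
    with \<open>r \<noteq> 0\<close> have "degree (of_int_poly f :: rat poly) \<le> degree (of_int_poly r :: rat poly)"
      by (intro dvd_imp_degree_le) auto
    thus False using that by simp
  qed
  have deg: "degree f > 0"
  proof (rule ccontr)
    assume "\<not> degree f > 0"
    then obtain c where c: "f = [:c:]" by (metis degree_eq_zeroE neq0_conv)
    with f(1) have "c = 1" by simp
    thus False using f(2) c by simp
  qed
  have reduce: "\<exists>r. degree r < degree f \<and> poly (intp r) \<zeta> = poly (intp h) \<zeta>" for h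
  proof -
    obtain q r where qr: "pseudo_divmod h f = (q, r)" by (metis surj_pair)
    have "h = f * q + r" using pseudo_divmod(1)[OF f0 qr] f(1) by simp
    hence "poly (intp h) \<zeta> = poly (intp r) \<zeta>" by (simp add: of_int_poly_hom.hom_add f(2))
    moreover have "degree r < degree f" using pseudo_divmod(2)[OF f0 qr] deg by auto
    ultimately show ?thesis by metis
  qed
  have "\<forall>j. \<exists>r. degree r < degree f \<and> poly (intp r) \<zeta> = poly (intp f) (\<zeta> ^ j)"
  proof
    fix j show "\<exists>r. degree r < degree f \<and> poly (intp r) \<zeta> = poly (intp f) (\<zeta> ^ j)"
      using reduce[of "pcompose f (monom 1 j)"] unfolding poly_intp_pcompose_monom .
  qed
  then obtain R where R: "\<And>j. degree (R j) < degree f"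
    "\<And>j. poly (intp (R j)) \<zeta> = poly (intp f) (\<zeta> ^ j)" by metis
  define B where "B = (\<Sum>j<n. \<Sum>i<degree f. nat \<bar>coeff (R j) i\<bar>)"
  have B: "nat \<bar>coeff (R j) i\<bar> \<le> B" if "j < n" for i j
  proof (cases "i < degree f")
    case True
    have "nat \<bar>coeff (R j) i\<bar> \<le> (\<Sum>i<degree f. nat \<bar>coeff (R j) i\<bar>)"
      using True by (intro member_le_sum) auto
    also have "\<dots> \<le> B" unfolding B_def using that
      by (intro member_le_sum[of j _ "\<lambda>j. \<Sum>i<degree f. nat \<bar>coeff (R j) i\<bar>"]) auto
    finally show ?thesis .
  next
    case False
    thus ?thesis using R(1)[of j] by (simp add: coeff_eq_0)
  qed
  \<comment> \<open>Stated for every root w of f and not just for zeta, so that it can be iterated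
    along a product of large primes.\<close>
  have step: "poly (intp f) (w ^ p) = 0" if p: "prime p" "p > B" and w: "poly (intp f) w = 0" for p w
  proof -
    obtain g where g: "pcompose f (monom 1 p) = f ^ p + of_nat p * g"
      using prime_dvd_pcompose_power_defect[OF p(1), of f] by (auto simp: dvd_def algebra_simps)
    obtain r where r: "degree r < degree f" "poly (intp r) \<zeta> = poly (intp g) \<zeta>"
      using reduce by blast
    define j where "j = p mod n"
    have j: "j < n" "\<zeta> ^ j = \<zeta> ^ p"
    proof -
      have "\<zeta> ^ p = \<zeta> ^ (n * (p div n) + p mod n)" by simp
      also have "\<dots> = \<zeta> ^ j" unfolding j_def by (simp only: power_add power_mult \<zeta>n power_one) simp
      finally show "\<zeta> ^ j = \<zeta> ^ p" ..
    qed (use n in \<open>simp add: j_def\<close>)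
    have "poly (intp f) (\<zeta> ^ p) = poly (intp (pcompose f (monom 1 p))) \<zeta>"
      unfolding poly_intp_pcompose_monom ..
    also have "\<dots> = poly (intp (smult (int p) r)) \<zeta>"
      unfolding g using r(2) f(2) prime_gt_0_nat[OF p(1)]
      by (simp add: of_int_poly_hom.hom_add of_int_poly_hom.hom_power of_nat_poly
          of_int_hom.map_poly_hom_smult poly_power)
    finally have e: "poly (intp (R j - smult (int p) r)) \<zeta> = 0"
      using R(2)[of j] j(2) by (simp add: of_int_poly_hom.hom_minus)
    have "R j - smult (int p) r = 0"
      by (rule small[OF _ e]) (use R(1)[of j] r(1) in \<open>auto intro!: degree_diff_less\<close>)
    hence Rj: "R j = smult (int p) r" by simp
    have "R j = 0"
    proof (rule poly_eqI)
      fix i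
      have "int p dvd coeff (R j) i" by (simp add: Rj)
      moreover have "\<bar>coeff (R j) i\<bar> < int p" using B[OF j(1), of i] p(2) by linarith
      ultimately show "coeff (R j) i = coeff 0 i"
        using dvd_imp_le_int[of "coeff (R j) i" "int p"] by force
    qed
    with R(2)[of j] j(2) have z: "poly (intp f) (\<zeta> ^ p) = 0" by simp
    \<comment> \<open>f(X^p) vanishes at zeta, hence is divisible by f; this carries the result from
      zeta to w.\<close>
    have "of_int_poly f dvd (of_int_poly (pcompose f (monom 1 p)) :: rat poly)"
      by (rule f(3)) (unfold ratp_of_int_poly poly_intp_pcompose_monom, rule z)
    then obtain k :: "rat poly" where k: "of_int_poly (pcompose f (monom 1 p)) = of_int_poly f * k" by blast
    have "poly (intp f) (w ^ p) = poly (ratp (of_int_poly (pcompose f (monom 1 p)))) w"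
      unfolding ratp_of_int_poly poly_intp_pcompose_monom ..
    also have "\<dots> = 0" unfolding k by (simp add: ratp_hom(2) w)
    finally show ?thesis .
  qed
  have big: "poly (intp f) (\<zeta> ^ r) = 0" if "r > 0" "\<And>p. prime p \<Longrightarrow> p dvd r \<Longrightarrow> p > B" for r
    using that
  proof (induction r rule: less_induct)
    case (less r)
    show ?case
    proof (cases "r = 1")
      case False
      then obtain p where p: "prime p" "p dvd r" using prime_factor_nat by blast
      then obtain s where s: "r = p * s" by blast
      have "poly (intp f) (\<zeta> ^ s) = 0"
        using less.prems s prime_gt_1_nat[OF p(1)] by (intro less.IH) auto
      thus ?thesis using step[OF p(1) less.prems(2)[OF p], of "\<zeta> ^ s"]
        by (simp add: s mult.commute flip: power_mult)
    qed (use f(2) in simp)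
  qed
  \<comment> \<open>N collects the small primes not dividing n. A number congruent to 1 modulo N
    avoids them, and one congruent to a modulo n avoids the primes dividing n, so all its prime
    factors exceed B.\<close>
  define N where "N = \<Prod>{p. prime p \<and> p \<le> B \<and> \<not> p dvd n}"
  have finN: "finite {p. prime p \<and> p \<le> B \<and> \<not> p dvd n}" by (rule finite_subset[of _ "{..B}"]) auto
  have "Rings.coprime n N" unfolding N_def
    by (rule prod_coprime_right[where f = "\<lambda>x. x"]) (use prime_imp_coprime[of _ n] algebraic_semidom_class.coprime_commute in blast)
  then obtain r0 where r0: "[r0 = a] (mod n)" "[r0 = 1] (mod N)"
    using binary_chinese_remainder_nat by blast
  have N0: "N > 0" unfolding N_def by (auto intro!: prod_pos dest: prime_gt_0_nat)
  \<comment> \<open>The Chinese remainder may be 0, for instance when n = N = 1; the summand n * N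
    keeps r positive.\<close>
  define r where "r = r0 + n * N"
  have r: "[r = a] (mod n)" "[r = 1] (mod N)" using r0 by (auto simp: r_def cong_def)
  have "poly (intp f) (\<zeta> ^ r) = 0"
  proof (rule big)
    show "r > 0" using n N0 by (simp add: r_def)
    fix p assume p: "prime p" "p dvd r"
    show "p > B"
    proof (rule ccontr)
      assume "\<not> p > B"
      show False
      proof (cases "p dvd n")
        case True
        have "p dvd a" using p(2) cong_dvd_iff[OF cong_dvd_modulus_nat[OF r(1) True]] by simp
        hence "is_unit p" by (rule algebraic_semidom_class.coprime_common_divisor[OF a _ True])
        thus False using p(1) not_prime_unit by blast
      next
        case False
        hence "p dvd N" unfolding N_def using p(1) \<open>\<not> p > B\<close> finN by (intro dvd_prodI[of _ p "\<lambda>x. x"]) auto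
        hence "p dvd 1" using p(2) cong_dvd_iff[OF cong_dvd_modulus_nat[OF r(2)]] by metis
        thus False using p(1) by auto
      qed
    qed
  qed
  moreover have "\<zeta> ^ r = \<zeta> ^ a"
  proof -
    have "\<zeta> ^ k = \<zeta> ^ (k mod n)" for k
    proof -
      have "\<zeta> ^ k = \<zeta> ^ (n * (k div n) + k mod n)" by simp
      also have "\<dots> = \<zeta> ^ (k mod n)" by (simp only: power_add power_mult \<zeta>n power_one) simp
      finally show ?thesis .
    qed
    thus ?thesis using r(1) by (metis cong_def)
  qed
  ultimately have z: "poly (intp f) (\<zeta> ^ a) = 0" by simp
  have "of_int_poly f dvd g" by (rule f(3)) (use g in \<open>simp add: \<zeta>_def\<close>)
  then obtain k where "g = of_int_poly f * k" by blast
  thus ?thesis using z by (simp add: ratp_hom(2) \<zeta>_def)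
qed

lemma degree_cyclotomic_ge:
  assumes n: "n > 0" and g: "poly (ratp g) (unity_root n) = 0" "degree g < totient n"
  shows "g = 0"
proof (rule ccontr)
  assume "g \<noteq> 0"
  hence g0: "ratp g \<noteq> 0" by simp
  \<comment> \<open>For n = 1 the only totative is 1, which lies outside \<open>{..<n}\<close>, so
    this case is separate.\<close>
  have inj: "inj_on (\<lambda>a. unity_root n ^ a) (totatives n)"
  proof (cases "n = 1")
    case False
    hence "totatives n \<subseteq> {..<n}" using n by (auto simp: totatives_less)
    thus ?thesis using bij_betw_imp_inj_on[OF bij_betw_unity_root[OF n]] inj_on_subset by blast
  qed simp
  have "totient n = card ((\<lambda>a. unity_root n ^ a) ` totatives n)"
    by (simp add: totient_def card_image[OF inj])
  also have "\<dots> \<le> card {z. poly (ratp g) z = 0}"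
    using cyclotomic_conjugate[OF n _ g(1)] poly_roots_finite[OF g0]
    by (intro card_mono) (auto simp: totatives_def)
  also have "\<dots> \<le> degree (ratp g)" by (rule card_poly_roots_bound[OF g0])
  finally show False using g(2) by simp
qed

section \<open>Real radicals over cyclotomic fields\<close>

lemma ratp_simps [simp]:
  "ratp 1 = 1" "ratp (monom c n) = monom (of_rat c) n" "ratp [:c:] = [:of_rat c:]"
  by (rule poly_eqI; simp add: coeff_pCons coeff_1 split: nat.splits)+

lemma of_real_of_rat_complex: "complex_of_real (of_rat c) = of_rat c"
  by (cases c) (simp add: of_rat_rat)

lemma cnj_poly_ratp: "cnj (poly (ratp p) y) = poly (ratp p) (cnj y)"
proof -
  have "cnj (of_rat c) = of_rat c" for c
    by (metis of_real_of_rat_complex complex_cnj_complex_of_real)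
  hence "map_poly cnj (ratp p) = ratp p" by (intro poly_eqI) (simp add: coeff_map_poly)
  thus ?thesis by (metis poly_cnj)
qed

lemma csubfield_poly:
  assumes "subfield K complex_ring" "\<forall>i. coeff p i \<in> K" "x \<in> K" shows "poly p x \<in> K"
  unfolding poly_altdef by (intro csubfield_intros[OF assms(1)]) (use assms in auto)

text \<open>Complex conjugation inverts x, so it maps a rational polynomial in x to another element
  of the same field. This closure keeps products z * cnj z inside the field.\<close>

lemma simple_extension_cnj:
  assumes "x ^ n = 1" "n > 0" "z \<in> CR.simple_extension \<rat> x"
  shows "cnj z \<in> CR.simple_extension \<rat> x"
proof -
  note F = simple_extension_root_of_unity[OF assms(1,2)]
  obtain p where p: "z = poly (ratp p) x" using simple_extension_poly[OF assms(3)] .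
  have "norm x = 1" using assms(1,2) norm_power[of x n] power_eq_1_iff by auto
  hence "cnj x * x = 1" by (metis complex_norm_square mult.commute of_real_1 power_one)
  hence "cnj x = inverse x" by (metis inverse_unique inverse_inverse_eq)
  hence cx: "cnj x \<in> CR.simple_extension \<rat> x" using csubfield_inverse[OF F] by simp
  have "cnj z = poly (ratp p) (cnj x)" by (simp add: p cnj_poly_ratp)
  thus ?thesis using csubfield_poly[OF F(1) _ cx, of "ratp p"] csubfield_of_rat[OF F(1)] by simp
qed

text \<open>A real radical in a cyclotomic field has only real conjugates, hence at most two of them.\<close>

lemma real_radical_in_cyclotomic:
  assumes x: "x ^ n = 1" "n > 0" and b: "complex_of_real b \<in> CR.simple_extension \<rat> x" "b > 0"
    and c: "complex_of_real b ^ s = of_rat c" "s > 0"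
  shows "complex_of_real b ^ 2 \<in> \<rat>"
proof -
  obtain p where p: "of_real b = poly (ratp p) x" using simple_extension_poly[OF b(1)] .
  have "algebraic_int x"
    by (rule algebraic_int_root[of 1 "monom 1 n"])
      (use x in \<open>auto simp: poly_monom degree_monom_eq\<close>)
  then obtain f where f: "lead_coeff f = 1" "poly (intp f) x = 0"
    "\<And>g. poly (ratp g) x = 0 \<Longrightarrow> of_int_poly f dvd g"
    using algebraic_int_minpoly by blast
  have conj: "poly (ratp g) w = 0" if g: "poly (ratp g) x = 0" and w: "poly (intp f) w = 0" for g w
  proof -
    obtain k :: "rat poly" where "g = of_int_poly f * k" using f(3)[OF g] by blast
    thus ?thesis using w by (simp add: ratp_hom)
  qed
  have f0: "intp f \<noteq> 0" using f(1) by auto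
  \<comment> \<open>The minimal polynomial divides X^n - 1, so every conjugate of x is an n-th root
    of unity and no root is multiple.\<close>
  obtain h :: "rat poly" where h: "monom 1 n - 1 = of_int_poly f * h"
    using f(3)[of "monom 1 n - 1"] x by (auto simp: ratp_hom poly_monom)
  hence h': "monom 1 n - 1 = intp f * ratp h"
    by (metis of_rat_1 ratp_simps(1,2) ratp_hom(2,3) ratp_of_int_poly)
  have wn: "w ^ n = 1" if "poly (intp f) w = 0" for w
    using arg_cong[OF h', of "\<lambda>p. poly p w"] that by (simp add: poly_monom)
  have "rsquarefree (intp f)"
    unfolding rsquarefree_roots
  proof (intro allI notI)
    fix w assume w: "poly (intp f) w = 0 \<and> poly (pderiv (intp f)) w = 0"
    have "poly (pderiv (monom 1 n - 1)) w = 0"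
      unfolding h' pderiv_mult using w by simp
    hence "w ^ (n - 1) = 0" using x(2) by (simp add: pderiv_diff pderiv_monom poly_monom)
    hence "w = 0" by auto
    thus False using wn[of w] w x(2) by (simp add: power_0_left)
  qed
  hence card: "card {w. poly (intp f) w = 0} = degree f"
    using rsquarefree_card_degree[OF f0] by simp
  have sq: "poly (ratp (p ^ 2)) w = of_real b ^ 2" if w: "poly (intp f) w = 0" for w
  proof -
    \<comment> \<open>On n-th roots of unity conjugation is the power map with exponent n - 1. This
      turns the fact that p(x) is real into a rational polynomial relation in x, which every
      conjugate w inherits.\<close>
    have cw: "cnj y = y ^ (n - 1)" if "y ^ n = 1" for y :: complex
    proof -
      have "norm y = 1" using that x(2) norm_power[of y n] power_eq_1_iff by auto
      hence "y * cnj y = 1" by (metis complex_norm_square of_real_1 power_one)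
      moreover have "y * y ^ (n - 1) = 1" using that x(2) by (metis power_minus_mult mult.commute)
      ultimately show ?thesis by (metis inverse_unique)
    qed
    let ?g = "p - pcompose p (monom 1 (n - 1))"
    have g: "poly (ratp ?g) y = poly (ratp p) y - cnj (poly (ratp p) y)" if "y ^ n = 1" for y
      by (simp add: ratp_hom of_rat_hom.map_poly_pcompose poly_pcompose poly_monom cnj_poly_ratp cw[OF that]
       )
    have "poly (ratp ?g) x = 0" unfolding g[OF x(1)] p[symmetric] by simp
    hence "poly (ratp ?g) w = 0" using conj w by blast
    hence "poly (ratp p) w = cnj (poly (ratp p) w)" unfolding g[OF wn[OF w]] by simp
    then obtain r where r: "poly (ratp p) w = of_real r" by (metis Reals_cases Reals_cnj_iff)
    have pw: "ratp (p ^ k) = ratp p ^ k" for k by (induction k) (simp_all add: ratp_hom)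
    \<comment> \<open>The relation p(x)^s = c passes to w as well, so the real number p(w) has
      absolute value b.\<close>
    have "poly (ratp (p ^ s - [:c:])) x = 0"
      by (simp add: ratp_hom pw poly_power p[symmetric] c(1))
    hence "poly (ratp (p ^ s - [:c:])) w = 0" using conj w by blast
    hence "complex_of_real r ^ s = of_real b ^ s"
      by (simp add: ratp_hom pw poly_power r c(1))
    hence "r ^ s = b ^ s" by (metis of_real_eq_iff of_real_power)
    hence "\<bar>r\<bar> ^ s = b ^ s" using b(2) by (metis power_abs abs_of_pos zero_less_power)
    hence "\<bar>r\<bar> = b" using b(2) c(2) power_eq_imp_eq_base by fastforce
    hence "r ^ 2 = b ^ 2" by (metis power2_abs)
    thus ?thesis unfolding pw poly_power r by (metis of_real_power)
  qed
  \<comment> \<open>r has smaller degree than f but takes the value b^2 at all roots of f, so it is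
    constant, and its coefficient is rational.\<close>
  define r where "r = p ^ 2 mod of_int_poly f"
  have rp: "ratp (p ^ 2) = intp f * ratp (p ^ 2 div of_int_poly f) + ratp r"
    unfolding r_def by (metis mult_div_mod_eq ratp_hom(1,2) ratp_of_int_poly)
  have rw: "poly (ratp r - [:of_real b ^ 2:]) w = 0" if "poly (intp f) w = 0" for w
    using sq[OF that] that unfolding rp by simp
  have "degree f > 0"
  proof (rule ccontr)
    assume "\<not> degree f > 0"
    then obtain c where c: "f = [:c:]" by (metis degree_eq_zeroE neq0_conv)
    with f(1) have "c = 1" by simp
    thus False using f(2) c by simp
  qed
  have "degree r < degree f"
    using degree_mod_less[of "of_int_poly f" "p ^ 2"] f0 \<open>degree f > 0\<close> by (fastforce simp: r_def)
  hence deg: "degree (ratp r - [:of_real b ^ 2:]) < degree f"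
    using \<open>degree f > 0\<close> by (intro degree_diff_less) auto
  have "ratp r - [:of_real b ^ 2:] = 0"
  proof (rule ccontr)
    assume nz: "ratp r - [:of_real b ^ 2:] \<noteq> 0"
    have "degree f \<le> card {w. poly (ratp r - [:of_real b ^ 2:]) w = 0}"
      unfolding card[symmetric] by (intro card_mono poly_roots_finite nz) (use rw in auto)
    also have "\<dots> \<le> degree (ratp r - [:of_real b ^ 2:])" by (rule card_poly_roots_bound[OF nz])
    finally show False using deg by simp
  qed
  hence "coeff (ratp r) 0 = of_real b ^ 2" by simp
  thus ?thesis by (simp flip: \<open>coeff (ratp r) 0 = of_real b ^ 2\<close>)
qed

text \<open>Long division by a monic g only adds and multiplies coefficients, so the remainder stays
  over K. Subfields are sets here, hence complex polynomials with coefficients constrained to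
  K.\<close>

lemma monic_division_over_subfield:
  assumes K: "subfield K complex_ring" and g: "lead_coeff g = 1" "\<forall>i. coeff g i \<in> K"
  shows "\<forall>i. coeff f i \<in> K \<Longrightarrow>
    \<exists>q r. f = g * q + r \<and> (\<forall>i. coeff r i \<in> K) \<and> (r = 0 \<or> degree r < degree g)"
proof (induction "degree f" arbitrary: f rule: less_induct)
  case less
  show ?case
  proof (cases "f = 0 \<or> degree f < degree g")
    case True
    thus ?thesis using less.prems by (intro exI[of _ 0] exI[of _ f]) auto
  next
    case False
    define m where "m = monom (lead_coeff f) (degree f - degree g)"
    define f' where "f' = f - g * m"
    have g0: "g \<noteq> 0" using g(1) by auto
    have m0: "m \<noteq> 0" using False by (simp add: m_def)
    have dm: "degree (g * m) = degree f"
      using False g0 m0 by (simp add: degree_mult_eq m_def degree_monom_eq)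
    have cf: "\<forall>i. coeff f' i \<in> K"
      using less.prems g(2)
      by (auto simp: f'_def coeff_mult m_def intro!: csubfield_intros[OF K])
    have lc: "coeff (g * m) (degree f) = lead_coeff f"
      using lead_coeff_mult[of g m] dm g(1) False by (simp add: m_def degree_monom_eq)
    show ?thesis
    proof (cases "f' = 0")
      case True
      thus ?thesis using csubfield_zero[OF K] by (intro exI[of _ m] exI[of _ 0]) (auto simp: f'_def)
    next
      case f': False
      have "degree f' \<le> degree f" unfolding f'_def
        by (rule degree_diff_le) (use dm in auto)
      moreover have "degree f' \<noteq> degree f"
        using f' lc by (metis coeff_diff diff_self f'_def leading_coeff_0_iff)
      ultimately have "degree f' < degree f" by simp
      from less.hyps[OF this cf] obtain q r where
        "f' = g * q + r" "\<forall>i. coeff r i \<in> K" "r = 0 \<or> degree r < degree g" by blast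
      thus ?thesis by (intro exI[of _ "m + q"] exI[of _ r]) (auto simp: f'_def algebra_simps)
    qed
  qed
qed

text \<open>The constant coefficient of the minimal polynomial of a radical \<open>t\<close> of degree \<open>d\<close> has
  absolute value \<open>t ^ d\<close>.\<close>

lemma min_degree_radical:
  assumes K: "subfield K complex_ring" "\<And>z. z \<in> K \<Longrightarrow> cnj z \<in> K"
    and t: "t > 0" "complex_of_real t ^ n \<in> K" "n > 0"
    and p: "p \<noteq> 0" "\<forall>i. coeff p i \<in> K" "poly p (of_real t) = 0"
  obtains d where "d > 0" "d \<le> degree p" "complex_of_real t ^ (2 * d) \<in> K"
proof -
  define P where "P = (\<lambda>g. g \<noteq> 0 \<and> (\<forall>i. coeff g i \<in> K) \<and> poly g (of_real t) = 0)"
  have "P p" using p by (simp add: P_def)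
  then obtain g0 where g0: "P g0" "\<And>g. P g \<Longrightarrow> degree g0 \<le> degree g"
    using ex_has_least_nat[of P p degree] by blast
  define g where "g = smult (inverse (lead_coeff g0)) g0"
  have g: "lead_coeff g = 1" "degree g = degree g0" "poly g (of_real t) = 0" "\<forall>i. coeff g i \<in> K"
    using g0(1) by (auto simp: g_def P_def intro!: csubfield_intros[OF K(1)])
  \<comment> \<open>Minimality of g makes it a divisor of X^n - t^n, which puts all its roots on the
    circle of radius t.\<close>
  let ?h = "monom 1 n - [:complex_of_real t ^ n:]"
  have "\<forall>i. coeff ?h i \<in> K"
    using t(2) by (auto simp: coeff_pCons split: nat.splits intro!: csubfield_intros[OF K(1)])
  then obtain q r where qr: "?h = g * q + r" "\<forall>i. coeff r i \<in> K" "r = 0 \<or> degree r < degree g"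
    using monic_division_over_subfield[OF K(1) g(1,4)] by blast
  have "poly r (of_real t) = poly (?h - g * q) (of_real t)" unfolding qr(1) by simp
  also have "\<dots> = 0" by (simp add: g(3) poly_monom)
  finally have r0: "poly r (of_real t) = 0" .
  have "r = 0"
  proof (rule ccontr)
    assume "r \<noteq> 0"
    hence "degree g0 \<le> degree r" using r0 qr(2) by (intro g0(2)) (simp add: P_def)
    thus False using qr(3) g(2) \<open>r \<noteq> 0\<close> by simp
  qed
  obtain root where rt: "smult (lead_coeff g) (\<Prod>i<degree g. [:- root i, 1:]) = g"
    using complex_poly_decompose' by blast
  define D where "D = degree g"
  have rt': "g = (\<Prod>i<D. [:- root i, 1:])" using rt g(1) by (simp add: D_def)
  have pg: "poly g z = (\<Prod>i<D. z - root i)" for z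
    by (subst rt') (simp add: poly_prod)
  have nr: "norm (root i) = t" if "i < D" for i
  proof -
    have "poly g (root i) = 0"
      unfolding pg using that by (auto intro!: prod_zero)
    hence "poly ?h (root i) = 0" unfolding qr(1) \<open>r = 0\<close> by simp
    hence "root i ^ n = of_real t ^ n" by (simp add: poly_monom)
    hence "norm (root i) ^ n = t ^ n" using t(1) by (metis norm_power norm_of_real abs_of_pos)
    thus ?thesis using t(1,3) power_eq_imp_eq_base[of "norm (root i)" n t] by simp
  qed
  have "norm (poly g 0) = (\<Prod>i<D. norm (root i))" unfolding pg by (simp flip: prod_norm)
  also have "\<dots> = t ^ degree g" using nr by (simp add: D_def)
  finally have n: "norm (coeff g 0) = t ^ degree g" by (simp add: poly_0_coeff_0)
  \<comment> \<open>The constant coefficient may be non-real; multiplying by its conjugate, which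
    lies in K too, removes the phase at the cost of the factor 2 in the exponent.\<close>
  have "complex_of_real t ^ (2 * degree g) = coeff g 0 * cnj (coeff g 0)"
    unfolding complex_norm_square[symmetric] n by (simp add: power_mult[symmetric] mult.commute)
  moreover have "coeff g 0 * cnj (coeff g 0) \<in> K" using K g(4) by (intro csubfield_mult[OF K(1)]) auto
  ultimately have "complex_of_real t ^ (2 * degree g) \<in> K" by simp
  moreover have "degree g > 0"
  proof (rule ccontr)
    assume "\<not> degree g > 0"
    then obtain c where c: "g = [:c:]" by (metis degree_eq_zeroE neq0_conv)
    with g(1,3) show False by simp
  qed
  ultimately show ?thesis using that[of "degree g"] g0(2)[OF \<open>P p\<close>] g(2) by simp
qed

text \<open>In lowest terms g = a / b with a > b > 0, so a has a prime factor q, and q does not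
  divide b. Comparing q-adic valuations in c^n = g^d shows that n divides d * v_q(a); thus e =
  v_q(a) works for all n and d.\<close>

lemma rat_power_exponent_bound:
  fixes g :: rat
  assumes g: "g > 1"
  obtains e :: nat where "e > 0"
    "\<And>c n d. c ^ n = g ^ d \<Longrightarrow> c > 0 \<Longrightarrow> d > 0 \<Longrightarrow> n \<le> e * d"
proof -
  obtain a b where ab: "quotient_of g = (a, b)" by (metis surj_pair)
  have b: "b > 0" "algebraic_semidom_class.coprime a b" "g = of_int a / of_int b"
    using quotient_of_denom_pos[OF ab] quotient_of_coprime[OF ab] quotient_of_div[OF ab] by auto
  have a: "a > b" using g b by (simp add: field_simps)
  then obtain q where q: "prime q" "q dvd a" using b(1) prime_divisor_exists[of a] by auto
  have qb: "multiplicity q b = 0"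
  proof (rule not_dvd_imp_multiplicity_0)
    show "\<not> q dvd b"
      using q b(2) algebraic_semidom_class.coprime_common_divisor[of a b q] not_prime_unit by blast
  qed
  have qe: "prime_elem q" using q(1) by (rule prime_imp_prime_elem)
  have mq: "multiplicity q a > 0"
    using multiplicity_eq_zero_iff[of a q] q a b(1) not_prime_unit[of q] by fastforce
  show ?thesis
  proof
    show "multiplicity q a > 0" by (rule mq)
    fix c :: rat and n d assume c: "c ^ n = g ^ d" "c > 0" "d > 0"
    obtain u w where uw: "quotient_of c = (u, w)" by (metis surj_pair)
    have w: "w > 0" "c = of_int u / of_int w"
      using quotient_of_denom_pos[OF uw] quotient_of_div[OF uw] by auto
    have u: "u > 0" using c(2) w by (simp add: zero_less_divide_iff)
    have "(of_int (u ^ n * b ^ d) :: rat) = of_int (a ^ d * w ^ n)"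
      using c(1) w b(1) unfolding b(3) w(2) by (simp add: power_divide field_simps)
    hence e: "u ^ n * b ^ d = a ^ d * w ^ n" by (simp only: of_int_eq_iff)
    have "multiplicity q (u ^ n * b ^ d) = n * multiplicity q u"
      using u b(1) qe by (simp add: prime_elem_multiplicity_mult_distrib
        prime_elem_multiplicity_power_distrib qb)
    moreover have "multiplicity q (a ^ d * w ^ n) = d * multiplicity q a + n * multiplicity q w"
      using a b(1) w qe by (simp add: prime_elem_multiplicity_mult_distrib
        prime_elem_multiplicity_power_distrib)
    ultimately have eq: "n * multiplicity q u = d * multiplicity q a + n * multiplicity q w"
      using e by simp
    hence "n dvd d * multiplicity q a" by (metis dvd_add_left_iff dvd_triv_left)
    moreover have "d * multiplicity q a > 0" using c(3) mq by simp
    ultimately show "n \<le> multiplicity q a * d" by (metis dvd_imp_le mult.commute)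
  qed
qed

text \<open>A relation of degree D for t over Q(x) puts t^(2d) into Q(x) for some d with 0 < d \<le>
  D. As a real radical this number has a rational square c = t^(4d), and c^n = g^(4d) bounds n. The
  two squarings are the source of the factor 4.\<close>

lemma radical_degree_over_cyclotomic:
  fixes g :: rat
  assumes g: "g > 1"
  obtains e :: nat where "e > 0"
    "\<And>x k n t p. x ^ k = 1 \<Longrightarrow> k > 0 \<Longrightarrow> n > 0 \<Longrightarrow> t > 0 \<Longrightarrow> complex_of_real t ^ n = of_rat g \<Longrightarrow>
      p \<noteq> 0 \<Longrightarrow> \<forall>i. coeff p i \<in> CR.simple_extension \<rat> x \<Longrightarrow> poly p (of_real t) = 0 \<Longrightarrow>
      n \<le> e * degree p"
proof -
  obtain e where e: "e > 0"
    "\<And>c n d. c ^ n = g ^ d \<Longrightarrow> c > 0 \<Longrightarrow> d > 0 \<Longrightarrow> n \<le> e * d"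
    using rat_power_exponent_bound[OF g] by metis
  show ?thesis
  proof
    show "4 * e > 0" using e(1) by simp
    fix x k n t p
    assume x: "x ^ k = 1" "k > 0" and n: "n > 0" and t: "t > 0" "complex_of_real t ^ n = of_rat g"
      and p: "p \<noteq> 0" "\<forall>i. coeff p i \<in> CR.simple_extension \<rat> x" "poly p (of_real t) = 0"
    note F = simple_extension_root_of_unity[OF x]
    obtain d where d: "d > 0" "d \<le> degree p" "complex_of_real t ^ (2 * d) \<in> CR.simple_extension \<rat> x"
      using min_degree_radical[OF F(1) simple_extension_cnj[OF x] t(1) _ n p] t(2) csubfield_of_rat[OF F(1)]
      by metis
    have tn: "complex_of_real (t ^ (2 * d)) ^ n = of_rat (g ^ (2 * d))"
      by (simp add: of_rat_power t(2)[symmetric] mult_ac flip: power_mult)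
    have "complex_of_real (t ^ (2 * d)) ^ 2 \<in> \<rat>"
      by (rule real_radical_in_cyclotomic[OF x _ _ tn n]) (use d(3) t(1) in auto)
    then obtain c where c: "complex_of_real (t ^ (2 * d)) ^ 2 = of_rat c" by (auto elim: Rats_cases)
    have "(of_rat (c ^ n) :: complex) = of_rat (g ^ (4 * d))"
    proof -
      have "(of_rat (c ^ n) :: complex) = (complex_of_real (t ^ (2 * d)) ^ n) ^ 2"
        by (simp add: of_rat_power c[symmetric] mult_ac flip: power_mult)
      also have "\<dots> = of_rat (g ^ (4 * d))"
        unfolding tn by (simp add: of_rat_power mult.commute flip: power_mult)
      finally show ?thesis .
    qed
    hence "c ^ n = g ^ (4 * d)" by simp
    moreover have "c > 0"
    proof -
      have "complex_of_real ((t ^ (2 * d)) ^ 2) = complex_of_real (of_rat c)" using c by (simp add: of_real_of_rat_complex)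
      hence "(t ^ (2 * d)) ^ 2 = of_rat c" by (simp only: of_real_eq_iff)
      hence "(of_rat c :: real) > 0" using t(1) by (metis zero_less_power)
      thus ?thesis by simp
    qed
    ultimately have "n \<le> e * (4 * d)" using e(2) d(1) by simp
    also have "\<dots> \<le> 4 * e * degree p" using d(2) by simp
    finally show "n \<le> 4 * e * degree p" .
  qed
qed

section \<open>Kummer fields and the series\<close>

lemma rat_star_simps [simp]:
  "carrier rat_star = {x. x \<noteq> 0}" "x \<otimes>\<^bsub>rat_star\<^esub> y = x * y" "\<one>\<^bsub>rat_star\<^esub> = 1"
proof -
  have "\<exists>y. y * x = 1" if "x \<noteq> 0" for x :: rat
    using that by (intro exI[of _ "inverse x"]) auto
  thus "carrier rat_star = {x. x \<noteq> 0}"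
    by (auto simp: units_of_def Units_def mult.commute)
qed (auto simp: units_of_def)

lemma group_rat_star: "group rat_star"
  by (rule monoid.units_group) (rule ring.axioms(2)[OF ring_from_type_algebra])

lemma inv_rat_star [simp]: "x \<noteq> 0 \<Longrightarrow> inv\<^bsub>rat_star\<^esub> x = inverse x"
  by (rule group.inv_equality[OF group_rat_star]) auto

context
  fixes G assumes G: "subgroup G rat_star"
begin

lemma rat_subgroup_one: "1 \<in> G"
  and rat_subgroup_mult: "x \<in> G \<Longrightarrow> y \<in> G \<Longrightarrow> x * y \<in> G"
  and rat_subgroup_nonzero: "x \<in> G \<Longrightarrow> x \<noteq> 0"
  using subgroup.one_closed[OF G] subgroup.m_closed[OF G] subgroup.subset[OF G] by auto

lemma rat_subgroup_inverse: "x \<in> G \<Longrightarrow> inverse x \<in> G"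
  using subgroup.m_inv_closed[OF G, of x] rat_subgroup_nonzero by simp

lemma rat_subgroup_power: "x \<in> G \<Longrightarrow> x ^ n \<in> G"
  by (induction n) (auto intro: rat_subgroup_one rat_subgroup_mult)

end

lemma complex_root_exists:
  assumes "n > 0" obtains z :: complex where "z ^ n = w"
proof
  show "rcis (root n (norm w)) (Arg w / n) ^ n = w"
    using assms by (simp add: DeMoivre2 rcis_cmod_Arg)
qed

lemma subfield_kummer: "subfield (kummer_field G n) complex_ring"
  unfolding kummer_field_def by (rule subfield_adjoin_rat)

lemma unity_root_in_kummer: "unity_root n \<in> kummer_field G n"
  unfolding kummer_field_def using adjoin_rat_incl by blast

lemma kummer_field_minimal:
  assumes "subfield E complex_ring" "unity_root n \<in> E"
    "\<And>x g. g \<in> G \<Longrightarrow> x ^ n = of_rat g \<Longrightarrow> x \<in> E"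
  shows "kummer_field G n \<subseteq> E"
  unfolding kummer_field_def using assms
  by (intro adjoin_rat_minimal) (auto simp: group_roots_def)

lemma unity_root_dvd_in_kummer:
  assumes "d dvd n" "n > 0" shows "unity_root d \<in> kummer_field G n"
  using unity_root_dvd_in[OF subfield_kummer unity_root_in_kummer] assms by blast

text \<open>A d-th root of g has itself an (n/d)-th root in the complex numbers, so it is a power of
  an n-th root of g.\<close>

lemma root_in_kummer:
  assumes "d dvd n" "n > 0" "x ^ d = of_rat g" "g \<in> G" shows "x \<in> kummer_field G n"
proof -
  obtain e where n: "n = d * e" using assms(1) by blast
  obtain y where y: "y ^ e = x" using complex_root_exists[of e x] assms(2) n by auto
  have "y ^ n = of_rat g" unfolding n assms(3)[symmetric] y[symmetric]
    by (simp add: mult.commute flip: power_mult)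
  hence "y \<in> kummer_field G n"
    unfolding kummer_field_def using adjoin_rat_incl assms(4) by (fastforce simp: group_roots_def)
  thus ?thesis unfolding y[symmetric] by (rule csubfield_power[OF subfield_kummer])
qed

lemma kummer_mono:
  assumes "d dvd n" "n > 0" shows "kummer_field G d \<subseteq> kummer_field G n"
  by (rule kummer_field_minimal[OF subfield_kummer])
    (use assms root_in_kummer unity_root_dvd_in_kummer in auto)

text \<open>One n-th root per generator and the root of unity suffice: products and inverses supply
  one n-th root of every group element, and the other n-th roots differ from it by roots of unity.
  Finite generation enters here.\<close>

lemma finite_dimension_kummer:
  assumes G: "finitely_generated_subgroup G" and n: "n > 0"
  shows "CR.finite_dimension \<rat> (kummer_field G n)"
proof -
  obtain S where S: "finite S" "S \<subseteq> carrier rat_star" "G = generate rat_star S"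
    using G unfolding finitely_generated_subgroup_def by blast
  obtain \<theta> :: "rat \<Rightarrow> complex" where \<theta>: "\<And>s. \<theta> s ^ n = of_rat s"
  proof -
    have "\<forall>s. \<exists>z :: complex. z ^ n = of_rat s" by (meson complex_root_exists[OF n])
    thus ?thesis using that by metis
  qed
  obtain E where E: "subfield E complex_ring" "\<rat> \<subseteq> E" "insert (unity_root n) (\<theta> ` S) \<subseteq> E"
    "CR.finite_dimension \<rat> E"
    by (rule finite_dimension_radicals[OF subfield_Rats, of "insert (unity_root n) (\<theta> ` S)" n])
      (use S(1) \<theta> n in auto)
  have ex: "\<exists>y\<in>E. y \<noteq> 0 \<and> y ^ n = of_rat g" if "g \<in> G" for g
    using that unfolding S(3)
  proof (induction rule: generate.induct)
    case one
    thus ?case using csubfield_one[OF E(1)] by (intro bexI[of _ 1]) auto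
  next
    case (incl h)
    thus ?case using E(3) \<theta>[of h] S(2) n by (intro bexI[of _ "\<theta> h"]) (auto simp: power_0_left)
  next
    case (inv h)
    hence h: "\<theta> h \<in> E" "h \<noteq> 0" using E(3) S(2) by auto
    hence "\<theta> h \<noteq> 0" using \<theta>[of h] n by (auto simp: power_0_left)
    with h show ?case using \<theta>[of h] n csubfield_inverse[OF E(1)]
      by (intro bexI[of _ "inverse (\<theta> h)"]) (auto simp: power_inverse of_rat_inverse)
  next
    case (eng h1 h2)
    then obtain y1 y2 where "y1 \<in> E" "y1 \<noteq> 0" "y1 ^ n = of_rat h1" "y2 \<in> E" "y2 \<noteq> 0" "y2 ^ n = of_rat h2"
      by blast
    thus ?case using csubfield_mult[OF E(1)]
      by (intro bexI[of _ "y1 * y2"]) (auto simp: power_mult_distrib of_rat_mult)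
  qed
  have "kummer_field G n \<subseteq> E"
  proof (rule kummer_field_minimal[OF E(1)])
    fix x :: complex and g assume g: "g \<in> G" "x ^ n = of_rat g"
    obtain y where y: "y \<in> E" "y \<noteq> 0" "y ^ n = of_rat g" using ex[OF g(1)] by blast
    obtain i where "x = y * unity_root n ^ i"
      using power_unity_roots[of x n y] g(2) y n by metis
    thus "x \<in> E" using y(1) E(3) csubfield_mult[OF E(1)] csubfield_power[OF E(1)] by auto
  qed (use E(3) in auto)
  thus ?thesis
    by (intro finite_dimension_subfield(1)[OF subfield_Rats subfield_kummer E(1) csubfield_Rats[OF subfield_kummer] _ E(4)])
qed

text \<open>The tower from Q over Q(zeta_k) to the Kummer field contributes at least phi(k) below
  and m * k / e above; e comes from g alone, so it serves all k and m.\<close>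

lemma kummer_degree_lower_bound:
  assumes fg: "finitely_generated_subgroup G" and g: "g \<in> G" "g > 1"
  obtains e :: nat where "e > 0"
    "\<And>k m. k > 0 \<Longrightarrow> m > 0 \<Longrightarrow> m * k * totient k \<le> e * field_degree (kummer_field G (m * k))"
proof -
  obtain e :: nat where e: "e > 0"
    "\<And>x k n t p. x ^ k = 1 \<Longrightarrow> k > 0 \<Longrightarrow> n > 0 \<Longrightarrow> t > 0 \<Longrightarrow> complex_of_real t ^ n = of_rat g \<Longrightarrow>
      p \<noteq> 0 \<Longrightarrow> \<forall>i. coeff p i \<in> CR.simple_extension \<rat> x \<Longrightarrow> poly p (of_real t) = 0 \<Longrightarrow>
      n \<le> e * degree p"
    using radical_degree_over_cyclotomic[OF g(2)] by metis
  show ?thesis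
  proof (rule that[OF e(1)])
    fix k m :: nat assume k: "k > 0" and m: "m > 0"
    define n where "n = m * k"
    have n: "n > 0" using k m by (simp add: n_def)
    define K where "K = kummer_field G n"
    have K: "subfield K complex_ring" unfolding K_def by (rule subfield_kummer)
    have fin: "CR.finite_dimension \<rat> K" unfolding K_def by (rule finite_dimension_kummer[OF fg n])
    define x where "x = unity_root k"
    have xk: "x ^ k = 1" using k by (simp add: x_def)
    define F where "F = CR.simple_extension \<rat> x"
    have F: "subfield F complex_ring" "x \<in> F"
      using simple_extension_root_of_unity[OF xk k] by (simp_all add: F_def)
    have xK: "x \<in> K" unfolding x_def K_def by (rule unity_root_dvd_in_kummer) (use n in \<open>auto simp: n_def\<close>)
    have FK: "F \<subseteq> K" unfolding F_def
      by (rule CR.simple_extension_subring_incl[OF subfieldE(1)[OF K] csubfield_Rats[OF K] xK])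
    define t where "t = root n (of_rat g)"
    have t: "t > 0" "complex_of_real t ^ n = of_rat g"
    proof -
      have "(of_rat g :: real) > 0" using g(2) by simp
      thus "t > 0" using n by (simp add: t_def)
      have "t ^ n = of_rat g" using n \<open>(of_rat g :: real) > 0\<close> by (simp add: t_def)
      thus "complex_of_real t ^ n = of_rat g" by (metis of_real_power of_real_of_rat_complex)
    qed
    have tK: "complex_of_real t \<in> K"
      unfolding K_def by (rule root_in_kummer[OF dvd_refl n t(2) g(1)])
    \<comment> \<open>N is n / e rounded up: for degrees below N, that is at most (n - 1) div e, the
      inequality n \<le> e * degree p fails.\<close>
    define N where "N = Suc ((n - 1) div e)"
    have "totient k \<le> CR.dim \<rat> F"
    proof (rule dim_ge_powers[OF subfield_Rats])
      show "CR.finite_dimension \<rat> F"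
        by (rule finite_dimension_subfield(1)[OF subfield_Rats F(1) K csubfield_Rats[OF F(1)] FK fin])
      show "x ^ i \<in> F" for i by (rule csubfield_power[OF F])
      fix p :: "complex poly" assume p: "\<forall>i. coeff p i \<in> \<rat>" "degree p < totient k" "poly p x = 0"
      obtain q where q: "p = ratp q"
      proof -
        have "\<forall>i. \<exists>c. coeff p i = of_rat c" using p(1) by (auto elim: Rats_cases)
        then obtain c where c: "\<And>i. coeff p i = of_rat (c i)" by metis
        have "p = ratp (Abs_poly c)"
        proof (rule poly_eqI)
          have "\<forall>\<^sub>\<infinity>i. c i = 0"
            using MOST_coeff_eq_0[of p] by (simp add: c)
          thus "coeff p i = coeff (ratp (Abs_poly c)) i" for i by (simp add: c coeff_Abs_poly coeff_inverse Abs_poly_inverse)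
        qed
        thus ?thesis by (rule that)
      qed
      have "q = 0" by (rule degree_cyclotomic_ge[OF k]) (use p q in \<open>auto simp: x_def\<close>)
      thus "p = 0" using q by simp
    qed
    moreover have "N \<le> CR.dim F K"
    proof (rule dim_ge_powers[OF F(1)])
      show "CR.finite_dimension F K"
        by (rule finite_dimension_subfield(2)[OF subfield_Rats F(1) K csubfield_Rats[OF F(1)] FK fin])
      show "complex_of_real t ^ i \<in> K" for i by (rule csubfield_power[OF K tK])
      fix p assume p: "\<forall>i. coeff p i \<in> F" "degree p < N" "poly p (complex_of_real t) = 0"
      show "p = 0"
      proof (rule ccontr)
        assume "p \<noteq> 0"
        hence "n \<le> e * degree p" using e(2)[OF xk k n t] p by (simp add: F_def)
        also have "\<dots> \<le> e * ((n - 1) div e)" using p(2) by (simp add: N_def)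
        also have "\<dots> \<le> n - 1" by simp
        finally show False using n by simp
      qed
    qed
    ultimately have "totient k * N \<le> CR.dim \<rat> K"
      by (rule dim_tower_ge[OF subfield_Rats F(1) K csubfield_Rats[OF F(1)] FK fin])
    moreover have "n \<le> e * N"
    proof -
      have "n - 1 < e * N" unfolding N_def using e(1) by (metis dividend_less_times_div mult_Suc_right)
      thus ?thesis by simp
    qed
    ultimately have le: "n \<le> e * N" "totient k * N \<le> CR.dim \<rat> K" by auto
    have "n * totient k \<le> e * N * totient k" by (rule mult_right_mono[OF le(1)]) simp
    also have "\<dots> = e * (totient k * N)" by simp
    also have "\<dots> \<le> e * CR.dim \<rat> K" by (rule mult_left_mono[OF le(2)]) simp
    finally have "n * totient k \<le> e * CR.dim \<rat> K" .
    thus "m * k * totient k \<le> e * field_degree (kummer_field G (m * k))"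
      by (simp add: field_degree_def K_def n_def)
  qed
qed

section \<open>Totient estimate and cancellation in the series\<close>

lemma totient_square_ge_odd:
  assumes "squarefree k" "odd k" shows "k \<le> totient k ^ 2"
  using assms
proof (induction k rule: less_induct)
  case (less k)
  show ?case
  proof (cases "k = 1")
    case False
    then obtain p where p: "prime p" "p dvd k" using prime_factor_nat by blast
    then obtain j where j: "k = p * j" by blast
    have cop: "algebraic_semidom_class.coprime p j"
      
    proof (rule prime_imp_coprime[OF p(1)])
      have "\<not> p ^ 2 dvd k" using less.prems(1) p(1) not_prime_unit unfolding squarefree_def by blast
      thus "\<not> p dvd j" using j by (auto simp: power2_eq_square)
    qed

    have p3: "p \<ge> 3" using prime_ge_2_nat[OF p(1)] less.prems(2) j by (cases "p = 2") auto
    have "squarefree j" using less.prems(1) j squarefree_mono[of j k] by simp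
    moreover have "j > 0" using less.prems(2) j by (cases j) auto
    ultimately have "j \<le> totient j ^ 2" using less p3 j by (intro less.IH) auto
    moreover have "p \<le> (p - 1) ^ 2"
    proof -
      obtain q where "p = q + 3" using p3 by (metis le_add_diff_inverse2)
      thus ?thesis by (simp add: power2_eq_square)
    qed
    ultimately have "p * j \<le> ((p - 1) * totient j) ^ 2" by (simp add: power_mult_distrib mult_le_mono)
    thus ?thesis using totient_mult_coprime[OF cop] totient_prime[OF p(1)] j by simp
  qed simp
qed

text \<open>For odd k the bound is multiplicative and rests on p \<le> (p - 1)^2, true from p = 3
  on. The prime 2 violates it, and since it divides a squarefree k at most once it costs just the
  factor 2.\<close>

lemma totient_square_ge:
  assumes "squarefree k" shows "k \<le> 2 * totient k ^ 2"
proof (cases "odd k")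
  case False
  then obtain j where j: "k = 2 * j" by blast
  have "\<not> 2 ^ 2 dvd k" using assms unfolding squarefree_def by (metis not_prime_unit two_is_prime_nat)
  hence "odd j" using j by auto
  thus ?thesis using totient_square_ge_odd[of j] assms j squarefree_mono[of j k] by (simp add: totient_double)
qed (use totient_square_ge_odd[OF assms] in simp)

text \<open>The terms at multiples of p, reindexed by k to p * k, are the negatives of the remaining
  terms or zero. Absolute convergence allows the series to be split this way.\<close>

lemma suminf_cancel_multiples:
  fixes a :: "nat \<Rightarrow> real"
  assumes p: "p > 0" and sum: "summable (\<lambda>i. norm (a (Suc i)))"
    and neg: "\<And>k. k > 0 \<Longrightarrow> \<not> p dvd k \<Longrightarrow> a (p * k) = - a k"
    and zero: "\<And>k. k > 0 \<Longrightarrow> p dvd k \<Longrightarrow> a (p * k) = 0"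
  shows "suminf (\<lambda>i. a (Suc i)) = 0"
proof -
  \<comment> \<open>The sequence is extended by 0 at index 0, so that multiplication by p acts on
    the indices without a shift.\<close>
  define b where "b = (\<lambda>k. if k = 0 then 0 else a k)"
  define b1 where "b1 = (\<lambda>k. if p dvd k then 0 else b k)"
  define b2 where "b2 = (\<lambda>k. if p dvd k then b k else 0)"
  have "summable (\<lambda>i. norm (b (Suc i)))" using sum by (simp add: b_def)
  hence sb: "summable (\<lambda>i. norm (b i))" by (subst (asm) summable_Suc_iff)
  have s1: "summable b1" and s2: "summable b2"
    by (rule summable_comparison_test'[OF sb]; simp add: b1_def b2_def)+
  have "suminf b2 = suminf (\<lambda>k. b2 (p * k))"
    by (rule suminf_mono_reindex[symmetric])
      (use p in \<open>auto simp: strict_mono_def b2_def dvd_def\<close>)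
  also have "(\<lambda>k. b2 (p * k)) = (\<lambda>k. - b1 k)"
    using p neg zero by (auto simp: b1_def b2_def b_def fun_eq_iff)
  also have "suminf (\<lambda>k. - b1 k) = - suminf b1" by (rule suminf_minus[OF s1])
  finally have "suminf b1 + suminf b2 = 0" by simp
  moreover have "suminf b1 + suminf b2 = suminf (\<lambda>k. b1 k + b2 k)" by (rule suminf_add[OF s1 s2])
  moreover have "(\<lambda>k. b1 k + b2 k) = b" by (auto simp: b1_def b2_def)
  ultimately have "suminf b = 0" by simp
  moreover have "suminf b = suminf (\<lambda>i. b (Suc i)) + b 0"
    using suminf_split_head[OF summable_norm_cancel[OF sb]] by simp
  ultimately show ?thesis by (simp add: b_def)
qed

lemma moebius_mu_prime_mult:
  assumes p: "prime p" and k: "k > 0"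
  shows "moebius_mu (p * k) = (if p dvd k then 0 else - moebius_mu k)"
proof (cases "p dvd k")
  case True
  hence "p ^ 2 dvd p * k" by (auto simp: power2_eq_square)
  hence "\<not> squarefree (p * k)" using p unfolding squarefree_def by auto
  thus ?thesis using True by (simp add: moebius_mu_def)
next
  case False
  hence cop: "algebraic_semidom_class.coprime p k" using p prime_imp_coprime by blast
  have "squarefree (p * k) \<longleftrightarrow> squarefree k"
    using squarefree_mult_coprime[OF cop] squarefree_prime[OF p] squarefree_mono[of k "p * k"] by auto
  moreover have "prime_factors (p * k) = insert p (prime_factors k)"
    using p k by (auto simp: prime_factors_product prime_prime_factors)
  moreover have "p \<notin> prime_factors k" using False by auto
  ultimately show ?thesis using False by (simp add: moebius_mu_def)
qed

lemma rho_eq_0I: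
  assumes fg: "finitely_generated_subgroup G" and g: "g \<in> G" "g > 1" and m: "m > 0"
    and p: "prime p"
    and eq: "\<And>k. k > 0 \<Longrightarrow> \<not> p dvd k \<Longrightarrow> kummer_field G (m * (p * k)) = kummer_field G (m * k)"
  shows "rho G m = 0"
proof -
  obtain e :: nat where e: "e > 0"
    "\<And>k m. k > 0 \<Longrightarrow> m > 0 \<Longrightarrow> m * k * totient k \<le> e * field_degree (kummer_field G (m * k))"
    using kummer_degree_lower_bound[OF fg g] by metis
  define D where "D = (\<lambda>k. field_degree (kummer_field G (m * k)))"
  define a where "a = (\<lambda>k. real_of_int (moebius_mu k) / real (D k))"
  \<comment> \<open>For squarefree k, k * sqrt k \<le> sqrt 2 * k * phi(k) \<le> sqrt 2 * e * D k;
    for other k the Moebius function vanishes.\<close>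
  have bound: "norm (a k) \<le> e * sqrt 2 * (real k powr (- 3 / 2))" if k: "k > 0" for k
  proof (cases "squarefree k")
    case True
    have "real k \<le> real (2 * totient k ^ 2)" using totient_square_ge[OF True] by (simp only: of_nat_le_iff)
    hence "sqrt (real k) \<le> sqrt (2 * real (totient k) ^ 2)" by simp
    hence tot: "sqrt (real k) \<le> sqrt 2 * real (totient k)" by (simp add: real_sqrt_mult)
    have "k * totient k \<le> m * k * totient k" using m by simp
    also have "\<dots> \<le> e * D k" unfolding D_def by (rule e(2)[OF k m])
    finally have ktD: "k * totient k \<le> e * D k" .
    hence "real (k * totient k) \<le> real (e * D k)" by (simp only: of_nat_le_iff)
    hence "sqrt 2 * (real k * real (totient k)) \<le> sqrt 2 * (real e * real (D k))" by simp
    moreover have "real k * sqrt (real k) \<le> real k * (sqrt 2 * real (totient k))"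
      by (intro mult_left_mono tot) simp
    moreover have "real k * (sqrt 2 * real (totient k)) = sqrt 2 * (real k * real (totient k))" by simp
    ultimately have M: "real k * sqrt (real k) \<le> sqrt 2 * (real e * real (D k))" by linarith
    have Dk: "D k > 0"
    proof (rule ccontr)
      assume "\<not> D k > 0"
      thus False using ktD k by simp
    qed
    have pw: "real k powr (- 3 / 2) = 1 / (real k * sqrt (real k))"
    proof -
      have "real k powr (3 / 2) = real k powr 1 * real k powr (1 / 2)" unfolding powr_add[symmetric] by simp
      also have "\<dots> = real k * sqrt (real k)" using k by (simp add: powr_half_sqrt)
      finally show ?thesis using k by (simp add: powr_minus_divide)
    qed
    have "norm (a k) = \<bar>real_of_int (moebius_mu k)\<bar> / real (D k)" by (simp add: a_def)
    also have "\<dots> \<le> 1 / real (D k)" by (intro divide_right_mono) (simp_all add: moebius_mu_def)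
    also have "\<dots> \<le> e * sqrt 2 * (1 / (real k * sqrt (real k)))"
      using M Dk k by (simp add: field_simps)
    finally show ?thesis unfolding pw .
  next
    case False
    thus ?thesis by (simp add: a_def moebius_mu_def)
  qed
  have "summable (\<lambda>k. e * sqrt 2 * (real k powr (- 3 / 2)))"
    by (intro summable_mult) (simp add: summable_real_powr_iff)
  hence "summable (\<lambda>i. e * sqrt 2 * (real (Suc i) powr (- 3 / 2)))"
    by (subst summable_Suc_iff)
  hence "summable (\<lambda>i. norm (a (Suc i)))"
    by (rule summable_comparison_test') (use bound in \<open>auto simp del: of_nat_Suc\<close>)
  hence "suminf (\<lambda>i. a (Suc i)) = 0"
  proof (rule suminf_cancel_multiples[OF prime_gt_0_nat[OF p]])
    fix k assume k: "k > 0" "\<not> p dvd k"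
    thus "a (p * k) = - a k"
      using moebius_mu_prime_mult[OF p, of k] eq[of k] by (simp add: a_def D_def)
  next
    fix k assume k: "k > 0" "p dvd k"
    thus "a (p * k) = 0" using moebius_mu_prime_mult[OF p, of k] by (simp add: a_def)
  qed
  thus ?thesis by (simp add: rho_def a_def D_def)
qed

section \<open>Discriminants of quadratic fields\<close>

lemma det_2x2:
  fixes A :: "'a :: comm_ring_1 mat"
  assumes "A \<in> carrier_mat 2 2"
  shows "det A = A $$ (0,0) * A $$ (1,1) - A $$ (0,1) * A $$ (1,0)"
proof -
  have s: "{0..<2::nat} = {0, 1}" by auto
  have p: "{p. p permutes {0..<2::nat}} = {id, Transposition.transpose 0 1}"
    unfolding s permutes_doubleton_iff by auto
  have "Transposition.transpose 0 1 \<noteq> (id :: nat \<Rightarrow> nat)" by (metis id_apply transpose_apply_first zero_neq_one)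
  thus ?thesis
    unfolding det_def'[OF assms] p unfolding s
    by (simp add: sign_swap_id sign_id)
qed

section \<open>Embeddings, traces and change of integral basis\<close>

context
  fixes K \<sigma> assumes K: "subfield K complex_ring" and \<sigma>: "\<sigma> \<in> field_embeddings K"
begin

lemma embedding_add: "x \<in> K \<Longrightarrow> y \<in> K \<Longrightarrow> \<sigma> (x + y) = \<sigma> x + \<sigma> y"
  and embedding_mult: "x \<in> K \<Longrightarrow> y \<in> K \<Longrightarrow> \<sigma> (x * y) = \<sigma> x * \<sigma> y"
  and embedding_one: "\<sigma> 1 = 1"
  using \<sigma> by (auto simp: field_embeddings_def Ring.ring_hom_def)

lemma embedding_zero: "\<sigma> 0 = 0"
  using embedding_add[of 0 0] csubfield_zero[OF K] by simp

lemma embedding_uminus: "x \<in> K \<Longrightarrow> \<sigma> (- x) = - \<sigma> x"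
  using embedding_add[of x "- x"] csubfield_uminus[OF K] embedding_zero by (simp add: eq_neg_iff_add_eq_0 add.commute)

lemma embedding_of_nat: "\<sigma> (of_nat n) = of_nat n"
  by (induction n) (simp_all add: embedding_zero embedding_one embedding_add csubfield_one[OF K] csubfield_of_nat[OF K])

lemma embedding_of_int: "\<sigma> (of_int n) = of_int n"
  by (cases n) (simp_all add: embedding_of_nat embedding_uminus csubfield_of_nat[OF K] csubfield_one[OF K]
    csubfield_add[OF K] embedding_add embedding_one del: of_nat_Suc flip: of_nat_Suc)

lemma embedding_of_rat: "\<sigma> (of_rat q) = of_rat q"
proof (cases q)
  case (Fract a b)
  have "of_int b * of_rat q = (of_int a :: complex)"
    using Fract by (simp add: of_rat_rat)
  hence "\<sigma> (of_int b * of_rat q) = of_int a" using embedding_of_int by simp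
  hence "of_int b * \<sigma> (of_rat q) = of_int a"
    by (simp add: embedding_mult embedding_of_int csubfield_of_int[OF K] csubfield_of_rat[OF K])
  thus ?thesis using Fract by (simp add: of_rat_rat field_simps)
qed

end

lemma field_trace_add:
  assumes "subfield K complex_ring" "x \<in> K" "y \<in> K"
  shows "field_trace K (x + y) = field_trace K x + field_trace K y"
  unfolding field_trace_def sum.distrib[symmetric]
  by (rule sum.cong) (simp_all add: embedding_add[OF assms(1)] assms)

lemma field_trace_of_int_mult:
  assumes "subfield K complex_ring" "x \<in> K"
  shows "field_trace K (of_int c * x) = of_int c * field_trace K x"
  unfolding field_trace_def sum_distrib_left
  by (rule sum.cong)
    (simp_all add: embedding_mult[OF assms(1)] embedding_of_int[OF assms(1)] assms csubfield_of_int[OF assms(1)])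

lemma field_trace_sum:
  assumes K: "subfield K complex_ring" and "\<And>i. i \<in> I \<Longrightarrow> x i \<in> K" "finite I"
  shows "field_trace K (\<Sum>i\<in>I. x i) = (\<Sum>i\<in>I. field_trace K (x i))"
  using assms(3,2)
proof (induction rule: finite_induct)
  case empty
  show ?case by (simp add: field_trace_def embedding_zero[OF K])
next
  case (insert i I)
  thus ?case by (simp add: field_trace_add[OF K] csubfield_sum[OF K])
qed

lemma integral_basis_coords_unique:
  assumes "subfield K complex_ring" "is_integral_basis K ws"
    and eq: "(\<Sum>i<length ws. of_int (c i) * ws ! i) = (\<Sum>i<length ws. of_int (d i) * ws ! i)"
    and x: "(\<Sum>i<length ws. of_int (c i) * ws ! i) \<in> ring_of_integers K"
    and i: "i < length ws"
  shows "c i = d i"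
proof -
  let ?n = "length ws"
  have "\<exists>!cs. length cs = ?n \<and> (\<Sum>i<?n. of_int (c i) * ws ! i) = (\<Sum>i<?n. of_int (cs ! i) * ws ! i)"
    using assms(2) x unfolding is_integral_basis_def by blast
  moreover have "length (map c [0..<?n]) = ?n \<and>
    (\<Sum>i<?n. of_int (c i) * ws ! i) = (\<Sum>i<?n. of_int (map c [0..<?n] ! i) * ws ! i)" by simp
  moreover have "length (map d [0..<?n]) = ?n \<and>
    (\<Sum>i<?n. of_int (c i) * ws ! i) = (\<Sum>i<?n. of_int (map d [0..<?n] ! i) * ws ! i)" by (simp add: eq)
  ultimately have "map c [0..<?n] = map d [0..<?n]" by blast
  thus ?thesis using i by (metis add_0 diff_zero nth_map_upt)
qed

lemma integral_basis_change:
  assumes "is_integral_basis K ws" "is_integral_basis K vs"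
  obtains A :: "nat \<Rightarrow> nat \<Rightarrow> int" where
    "\<And>i. i < length ws \<Longrightarrow> ws ! i = (\<Sum>k<length vs. of_int (A i k) * vs ! k)"
proof -
  have "\<exists>cs :: int list. ws ! i = (\<Sum>k<length vs. of_int (cs ! k) * vs ! k)" if "i < length ws" for i
    using assms that unfolding is_integral_basis_def by (metis nth_mem subsetD)
  then obtain cs :: "nat \<Rightarrow> int list" where
    "\<And>i. i < length ws \<Longrightarrow> ws ! i = (\<Sum>k<length vs. of_int (cs i ! k) * vs ! k)" by metis
  thus ?thesis by (rule that)
qed

lemma integral_basis_change_inverse:
  assumes K: "subfield K complex_ring" and ws: "is_integral_basis K ws"
    and A: "\<And>i. i < length ws \<Longrightarrow> ws ! i = (\<Sum>k<length vs. of_int (A i k) * vs ! k)"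
    and B: "\<And>k. k < length vs \<Longrightarrow> vs ! k = (\<Sum>j<length ws. of_int (B k j) * ws ! j)"
    and ij: "i < length ws" "j < length ws"
  shows "(\<Sum>k<length vs. A i k * B k j) = (if i = j then 1 else 0)"
proof -
  let ?c = "\<lambda>j. \<Sum>k<length vs. A i k * B k j" and ?d = "\<lambda>j. if i = j then 1 else (0 :: int)"
  have d: "(\<Sum>j<length ws. of_int (?d j) * ws ! j) = ws ! i"
    using ij(1) by (simp add: if_distrib[of of_int] if_distrib[of "\<lambda>x. x * _"] sum.delta cong: if_cong)
  have "ws ! i = (\<Sum>k<length vs. of_int (A i k) * (\<Sum>j<length ws. of_int (B k j) * ws ! j))"
    using A[OF ij(1)] B by simp
  also have "\<dots> = (\<Sum>k<length vs. \<Sum>j<length ws. of_int (A i k) * of_int (B k j) * ws ! j)"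
    by (simp add: sum_distrib_left mult.assoc)
  also have "\<dots> = (\<Sum>j<length ws. of_int (?c j) * ws ! j)"
    by (subst sum.swap) (simp add: sum_distrib_right)
  finally have c: "(\<Sum>j<length ws. of_int (?c j) * ws ! j) = ws ! i" ..
  have "ws ! i \<in> ring_of_integers K" using ws ij(1) unfolding is_integral_basis_def by auto
  thus ?thesis
    by (intro integral_basis_coords_unique[OF K ws, of ?c ?d j]) (use c d ij in simp_all)
qed

definition gram :: "complex set \<Rightarrow> complex list \<Rightarrow> complex mat" where
  "gram K ws = Matrix.mat (length ws) (length ws) (\<lambda>(i, j). field_trace K (ws ! i * ws ! j))"

text \<open>\<open>field_disc\<close> is a definite description, so it has a value only if all
  integral bases give the same determinant. The transition matrix A has an integral inverse, so its
  determinant is 1 or -1, and the Gram matrix M changes to A M A^T.\<close>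

lemma integral_basis_gram_det_unique:
  assumes K: "subfield K complex_ring" and ws: "is_integral_basis K ws" and vs: "is_integral_basis K vs"
  shows "det (gram K ws) = det (gram K vs)"
proof -
  obtain A where A: "\<And>i. i < length ws \<Longrightarrow> ws ! i = (\<Sum>k<length vs. of_int (A i k) * vs ! k)"
    using integral_basis_change[OF ws vs] by metis
  obtain B where B: "\<And>i. i < length vs \<Longrightarrow> vs ! i = (\<Sum>k<length ws. of_int (B i k) * ws ! k)"
    using integral_basis_change[OF vs ws] by metis
  note AB = integral_basis_change_inverse[OF K ws A B]
  note BA = integral_basis_change_inverse[OF K vs B A]
  \<comment> \<open>Both bases have the same length: AB and BA are identity matrices with equal
    trace.\<close>
  have "int (length ws) = (\<Sum>i<length ws. \<Sum>k<length vs. A i k * B k i)" using AB by simp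
  also have "\<dots> = (\<Sum>k<length vs. \<Sum>i<length ws. B k i * A i k)"
    by (subst sum.swap) (simp add: mult.commute)
  also have "\<dots> = int (length vs)" using BA by simp
  finally have len: "length vs = length ws" by simp
  define n where "n = length ws"
  define MA MB :: "complex mat" where
    "MA = Matrix.mat n n (\<lambda>(i, k). of_int (A i k))" and "MB = Matrix.mat n n (\<lambda>(i, k). of_int (B i k))"
  \<comment> \<open>The determinant is taken over the integers first, where a unit is 1 or -1, and
    then mapped to the complex numbers.\<close>
  define iA where "iA = Matrix.mat n n (\<lambda>(i, k). A i k)"
  define iB where "iB = Matrix.mat n n (\<lambda>(i, k). B i k)"
  have "iA * iB = 1\<^sub>m n"
    by (rule eq_matI) (use AB in \<open>auto simp: iA_def iB_def scalar_prod_def n_def len atLeast0LessThan\<close>)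
  hence "det (iA * iB) = 1" by simp
  moreover have "det (iA * iB) = det iA * det iB" by (rule det_mult) (auto simp: iA_def iB_def)
  ultimately have "det iA = 1 \<or> det iA = -1" using zmult_eq_1_iff by metis
  moreover have "MA = map_mat of_int iA" by (rule eq_matI) (auto simp: MA_def iA_def)
  hence "det MA = of_int (det iA)" by simp
  ultimately have "det MA * det MA = 1" by auto
  have inK: "vs ! i \<in> K" if "i < length vs" for i
    using vs nth_mem[OF that] unfolding is_integral_basis_def ring_of_integers_def by blast
  have "gram K ws = MA * (gram K vs * transpose_mat MA)"
  proof (rule eq_matI)
    fix i j assume "i < dim_row (MA * (gram K vs * transpose_mat MA))" "j < dim_col (MA * (gram K vs * transpose_mat MA))"
    hence ij: "i < n" "j < n" by (simp_all add: MA_def)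
    have "gram K ws $$ (i, j) = field_trace K (ws ! i * ws ! j)" using ij by (simp add: gram_def n_def)
    also have "ws ! i * ws ! j = (\<Sum>k<n. \<Sum>l<n. of_int (A i k * A j l) * (vs ! k * vs ! l))"
      using ij A by (simp add: n_def len sum_product mult_ac)
    also have "field_trace K \<dots> = (\<Sum>k<n. \<Sum>l<n. of_int (A i k * A j l) * field_trace K (vs ! k * vs ! l))"
    proof -
      have v: "vs ! k * vs ! l \<in> K" "of_int c * (vs ! k * vs ! l) \<in> K" if "k < n" "l < n" for k l c
        using inK that by (auto simp: n_def len intro!: csubfield_mult[OF K] csubfield_of_int[OF K])
      have "field_trace K (\<Sum>k<n. \<Sum>l<n. of_int (A i k * A j l) * (vs ! k * vs ! l))
        = (\<Sum>k<n. field_trace K (\<Sum>l<n. of_int (A i k * A j l) * (vs ! k * vs ! l)))"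
        by (intro field_trace_sum[OF K] csubfield_sum[OF K] v(2)) auto
      also have "\<dots> = (\<Sum>k<n. \<Sum>l<n. field_trace K (of_int (A i k * A j l) * (vs ! k * vs ! l)))"
        by (intro sum.cong refl field_trace_sum[OF K] v(2)) auto
      also have "\<dots> = (\<Sum>k<n. \<Sum>l<n. of_int (A i k * A j l) * field_trace K (vs ! k * vs ! l))"
        by (intro sum.cong refl field_trace_of_int_mult[OF K] v(1)) auto
      finally show ?thesis .
    qed
    also have "\<dots> = (MA * (gram K vs * transpose_mat MA)) $$ (i, j)"
      using ij by (simp add: MA_def gram_def n_def len scalar_prod_def atLeast0LessThan sum_distrib_left mult_ac)
    finally show "gram K ws $$ (i, j) = (MA * (gram K vs * transpose_mat MA)) $$ (i, j)" .
  qed (auto simp: MA_def gram_def n_def)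
  also have "det \<dots> = det MA * (det (gram K vs) * det (transpose_mat MA))"
  proof -
    have c: "MA \<in> carrier_mat n n" "gram K vs \<in> carrier_mat n n" "transpose_mat MA \<in> carrier_mat n n"
      by (auto simp: MA_def gram_def n_def len)
    show ?thesis unfolding det_mult[OF c(1) mult_carrier_mat[OF c(2,3)]] det_mult[OF c(2,3)] ..
  qed
  also have "det (transpose_mat MA) = det MA" by (rule det_transpose[of _ n]) (simp add: MA_def)
  finally show ?thesis using \<open>det MA * det MA = 1\<close> by (simp add: algebra_simps)
qed

lemma field_disc_eqI:
  assumes K: "subfield K complex_ring" and ws: "is_integral_basis K ws" and d: "det (gram K ws) = of_int D"
  shows "field_disc K = D"
  unfolding field_disc_def gram_def[symmetric]
proof (rule the_equality)
  fix E assume "\<exists>ws. is_integral_basis K ws \<and> of_int E = det (gram K ws)"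
  then obtain vs where "is_integral_basis K vs" "of_int E = det (gram K vs)" by blast
  hence "of_int E = (of_int D :: complex)" using integral_basis_gram_det_unique[OF K ws] d by simp
  thus "E = D" by simp
qed (use ws d in metis)

text \<open>If u = a / b in lowest terms, then b^2 divides a^2 * s and hence the squarefree
  s.\<close>

lemma rat_square_times_squarefree:
  fixes u :: rat
  assumes "squarefree s" "u ^ 2 * of_int s \<in> \<int>" shows "u \<in> \<int>"
proof -
  obtain a b where ab: "quotient_of u = (a, b)" by (metis surj_pair)
  have b: "b > 0" "algebraic_semidom_class.coprime a b" "u = of_int a / of_int b"
    using quotient_of_denom_pos[OF ab] quotient_of_coprime[OF ab] quotient_of_div[OF ab] by auto
  obtain c where "u ^ 2 * of_int s = of_int c" using assms(2) by (auto elim: Ints_cases)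
  hence "(of_int (a ^ 2 * s) :: rat) = of_int (b ^ 2 * c)"
    using b(1) unfolding b(3) by (simp add: power_divide field_simps)
  hence "a ^ 2 * s = b ^ 2 * c" by (simp only: of_int_eq_iff)
  hence "b ^ 2 dvd a ^ 2 * s" by simp
  moreover have "algebraic_semidom_class.coprime (b ^ 2) (a ^ 2)"
    using b(2) by (simp add: algebraic_semidom_class.coprime_commute)
  ultimately have "b ^ 2 dvd s" by (simp add: semiring_gcd_class.coprime_dvd_mult_right_iff)
  hence "is_unit b" using squarefreeD[OF assms(1)] by simp
  hence "b = 1" using b(1) by simp
  thus ?thesis using b(3) by simp
qed

lemma sqrt_squarefree_irrational:
  assumes "squarefree s" "s \<noteq> 1" "r ^ 2 = (of_int s :: complex)" shows "r \<notin> \<rat>"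
proof
  assume "r \<in> \<rat>"
  then obtain c where c: "r = of_rat c" by (auto elim: Rats_cases)
  have "(of_rat (c ^ 2) :: complex) = of_rat (of_int s)" using assms(3) c by (simp add: of_rat_power)
  hence cs: "c ^ 2 = of_int s" by (simp only: of_rat_eq_iff)
  have s0: "s \<noteq> 0" using assms(1) by auto
  have "c ^ 2 * of_int s \<in> \<int>" unfolding cs by simp
  hence "c \<in> \<int>" using rat_square_times_squarefree assms(1) by blast
  then obtain a where "c = of_int a" by (auto elim: Ints_cases)
  hence as: "a ^ 2 = s" using cs by (metis of_int_eq_iff of_int_power)
  hence "is_unit a" using squarefreeD[OF assms(1), of a] by simp
  hence "s = 1" using as by (auto simp: abs_if power2_eq_square split: if_splits)
  thus False using assms(2) by simp
qed

section \<open>Quadratic fields in coordinates\<close>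

definition quad_field :: "complex \<Rightarrow> complex set" where
  "quad_field r = {of_rat a + of_rat b * r | a b. True}"

lemma quad_fieldI: "of_rat a + of_rat b * r \<in> quad_field r"
  unfolding quad_field_def by blast

lemma subfield_quad_field:
  assumes "r ^ 2 = of_rat s" shows "subfield (quad_field r) complex_ring"
proof (rule subfield_complexI)
  have r2: "r * r = of_rat s" using assms by (simp add: power2_eq_square)
  show "1 \<in> quad_field r" using quad_fieldI[of 1 0 r] by simp
  fix x assume "x \<in> quad_field r"
  then obtain a b where x: "x = of_rat a + of_rat b * r" unfolding quad_field_def by blast
  show "- x \<in> quad_field r" using quad_fieldI[of "- a" "- b" r] by (simp add: x of_rat_minus)
  {
    assume x0: "x \<noteq> 0"
    define N where "N = a ^ 2 - b ^ 2 * s"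
    have N: "x * (of_rat a - of_rat b * r) = of_rat N"
      unfolding x N_def using r2
      by (simp add: of_rat_diff of_rat_mult of_rat_power power2_eq_square algebra_simps)
    show "inverse x \<in> quad_field r"
    proof (cases "N = 0")
      case False
      have "inverse x = (of_rat a - of_rat b * r) / of_rat N"
        using N x0 False by (simp add: field_simps)
      also have "\<dots> = of_rat (a / N) + of_rat (- b / N) * r"
        by (simp add: of_rat_divide of_rat_minus diff_divide_distrib)
      finally show ?thesis using quad_fieldI by metis
    next
      \<comment> \<open>The norm of a nonzero x can vanish when r is rational; then a - b r is zero
        and x equals 2 a.\<close>
      case True
      hence e: "of_rat a = of_rat b * r" using N x0 by simp
      hence "x = of_rat (2 * a)" by (simp add: x of_rat_mult)
      hence "inverse x = of_rat (inverse (2 * a)) + of_rat 0 * r"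
        by (simp only: of_rat_inverse of_rat_0 mult_zero_left add_0_right)
      thus ?thesis using quad_fieldI by metis
    qed
  }
  fix y assume "y \<in> quad_field r"
  then obtain c d where y: "y = of_rat c + of_rat d * r" unfolding quad_field_def by blast
  have "x + y = of_rat (a + c) + of_rat (b + d) * r" by (simp add: x y of_rat_add algebra_simps)
  thus "x + y \<in> quad_field r" using quad_fieldI by metis
  have "x * y = of_rat (a * c + b * d * s) + of_rat (a * d + b * c) * r"
    unfolding x y using r2 by (simp add: of_rat_add of_rat_mult algebra_simps)
  thus "x * y \<in> quad_field r" using quad_fieldI by metis
qed

lemma adjoin_rat_sqrt:
  assumes "r ^ 2 = of_rat s" "q \<noteq> 0" shows "adjoin_rat {of_rat q * r} = quad_field r"
proof
  show "adjoin_rat {of_rat q * r} \<subseteq> quad_field r"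
    using quad_fieldI[of 0 q r] by (intro adjoin_rat_minimal subfield_quad_field[OF assms(1)]) auto
  let ?K = "adjoin_rat {of_rat q * r}"
  have K: "subfield ?K complex_ring" by (rule subfield_adjoin_rat)
  have "of_rat q * r \<in> ?K" using adjoin_rat_incl by blast
  hence "of_rat q * r / of_rat q \<in> ?K" by (intro csubfield_divide[OF K] csubfield_of_rat[OF K])
  hence "r \<in> ?K" using assms(2) by simp
  thus "quad_field r \<subseteq> ?K" unfolding quad_field_def by (auto intro!: csubfield_intros[OF K])
qed

lemma field_disc_Rats: "field_disc \<rat> = 1"
proof (rule field_disc_eqI[OF subfield_Rats, of "[1]"])
  show "is_integral_basis \<rat> [1]"
    unfolding is_integral_basis_def
  proof (intro conjI ballI)
    show "set [1] \<subseteq> ring_of_integers \<rat>" by (auto simp: ring_of_integers_def)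
    fix x assume "x \<in> ring_of_integers \<rat>"
    hence "x \<in> \<int>" by (auto simp: ring_of_integers_def intro: rational_algebraic_int_is_int)
    then obtain a where a: "x = of_int a" by (auto elim: Ints_cases)
    show "\<exists>!cs :: int list. length cs = length [1 :: complex] \<and>
      x = (\<Sum>i<length [1 :: complex]. of_int (cs ! i) * [1] ! i)"
      by (rule ex1I[of _ "[a]"]) (auto simp: a length_Suc_conv)
  qed
  have "field_embeddings \<rat> = {restrict id \<rat>}"
  proof -
    have "\<sigma> = restrict id \<rat>" if "\<sigma> \<in> field_embeddings \<rat>" for \<sigma>
    proof (rule extensionalityI[of _ \<rat>])
      show "\<sigma> \<in> extensional \<rat>" using that by (simp add: field_embeddings_def)
      fix x :: complex assume "x \<in> \<rat>"
      thus "\<sigma> x = restrict id \<rat> x"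
        using embedding_of_rat[OF subfield_Rats that] by (auto elim: Rats_cases)
    qed auto
    moreover have "restrict id \<rat> \<in> field_embeddings \<rat>"
      by (auto simp: field_embeddings_def Ring.ring_hom_def)
    ultimately show ?thesis by blast
  qed
  hence "field_trace \<rat> 1 = 1" by (simp add: field_trace_def)
  thus "det (gram \<rat> [1]) = of_int 1"
    by (subst det_single) (auto simp: gram_def)
qed

context
  fixes s :: int and r :: complex
  assumes sqf: "squarefree s" and s1: "s \<noteq> 1" and r: "r ^ 2 = of_int s"
begin

lemma quad_coords_unique:
  assumes "of_rat a + of_rat b * r = of_rat c + of_rat d * r" shows "a = c \<and> b = d"
proof -
  have "b = d"
  proof (rule ccontr)
    assume bd: "b \<noteq> d"
    hence "(of_rat b :: complex) - of_rat d \<noteq> 0" by simp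
    hence "r = (of_rat c - of_rat a) / (of_rat b - of_rat d)" using assms by (simp add: field_simps)
    also have "\<dots> \<in> \<rat>" by (intro Rats_divide Rats_diff Rats_of_rat)
    finally show False using sqrt_squarefree_irrational[OF sqf s1 r] by simp
  qed
  thus ?thesis using assms by simp
qed

lemma subfield_quad: "subfield (quad_field r) complex_ring"
  by (rule subfield_quad_field[of r "of_int s"]) (simp add: r)

text \<open>The nontrivial automorphism. Uniqueness of coordinates makes the description well
  defined, and the restriction makes it extensional, as \<open>field_embeddings\<close>
  demands.\<close>

definition quad_conj :: "complex \<Rightarrow> complex" where
  "quad_conj = restrict (\<lambda>x. THE y. \<exists>a b. x = of_rat a + of_rat b * r \<and> y = of_rat a - of_rat b * r) (quad_field r)"

lemma quad_conj_eq: "quad_conj (of_rat a + of_rat b * r) = of_rat a - of_rat b * r"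
  unfolding quad_conj_def restrict_def
  by (auto simp: quad_fieldI dest!: quad_coords_unique intro!: the_equality)

text \<open>An embedding fixes the rationals and sends r to a square root of s, so the choice
  between r and -r determines it.\<close>

lemma quad_embeddings: "field_embeddings (quad_field r) = {restrict id (quad_field r), quad_conj}"
proof (rule Set.set_eqI, rule iffI)
  fix \<sigma> assume \<sigma>: "\<sigma> \<in> field_embeddings (quad_field r)"
  note K = subfield_quad
  have rK: "r \<in> quad_field r" using quad_fieldI[of 0 1 r] by simp
  have "\<sigma> r ^ 2 = \<sigma> (r ^ 2)" using embedding_mult[OF K \<sigma> rK rK] by (simp add: power2_eq_square)
  also have "\<dots> = r ^ 2" using embedding_of_int[OF K \<sigma>] by (simp add: r)
  finally have disj: "\<sigma> r = r \<or> \<sigma> r = - r" by (simp add: power2_eq_iff)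
  have \<sigma>x: "\<sigma> (of_rat a + of_rat b * r) = of_rat a + of_rat b * \<sigma> r" for a b
    using rK by (simp add: embedding_add[OF K \<sigma>] embedding_mult[OF K \<sigma>] embedding_of_rat[OF K \<sigma>]
        csubfield_of_rat[OF K] csubfield_mult[OF K])
  from disj show "\<sigma> \<in> {restrict id (quad_field r), quad_conj}"
  proof
    assume "\<sigma> r = r"
    have "\<sigma> = restrict id (quad_field r)"
      by (rule extensionalityI[of _ "quad_field r"])
        (use \<sigma> \<sigma>x \<open>\<sigma> r = r\<close> in \<open>auto simp: field_embeddings_def quad_field_def\<close>)
    thus ?thesis by simp
  next
    assume "\<sigma> r = - r"
    have "\<sigma> = quad_conj"
    proof (rule extensionalityI[of _ "quad_field r"])
      show "\<sigma> \<in> extensional (quad_field r)" using \<sigma> by (simp add: field_embeddings_def)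
      show "quad_conj \<in> extensional (quad_field r)" by (simp add: quad_conj_def)
      fix x assume "x \<in> quad_field r"
      then obtain a b where "x = of_rat a + of_rat b * r" unfolding quad_field_def by blast
      thus "\<sigma> x = quad_conj x" using \<sigma>x \<open>\<sigma> r = - r\<close> quad_conj_eq by simp
    qed
    thus ?thesis by simp
  qed
next
  fix \<sigma> assume "\<sigma> \<in> {restrict id (quad_field r), quad_conj}"
  moreover have "restrict id (quad_field r) \<in> field_embeddings (quad_field r)"
    using csubfield_intros[OF subfield_quad] by (auto simp: field_embeddings_def Ring.ring_hom_def)
  moreover have "quad_conj \<in> field_embeddings (quad_field r)"
  proof -
    have r2: "r * r = of_int s" using r by (simp add: power2_eq_square)
    have "quad_conj (x + y) = quad_conj x + quad_conj y \<and> quad_conj (x * y) = quad_conj x * quad_conj y"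
      if xq: "x \<in> quad_field r" and yq: "y \<in> quad_field r" for x y
    proof -
      obtain a b where x: "x = of_rat a + of_rat b * r" using xq unfolding quad_field_def by blast
      obtain c d where y: "y = of_rat c + of_rat d * r" using yq unfolding quad_field_def by blast
      have 1: "x + y = of_rat (a + c) + of_rat (b + d) * r" by (simp add: x y of_rat_add algebra_simps)
      have 2: "x * y = of_rat (a * c + b * d * of_int s) + of_rat (a * d + b * c) * r"
        unfolding x y using r2 by (simp add: of_rat_add of_rat_mult algebra_simps)
      show ?thesis
        unfolding 1 2 quad_conj_eq unfolding x y quad_conj_eq using r2
        by (simp add: of_rat_add of_rat_mult algebra_simps)
    qed
    moreover have "quad_conj 1 = 1" using quad_conj_eq[of 1 0] by simp
    ultimately show ?thesis
      by (auto simp: field_embeddings_def Ring.ring_hom_def quad_conj_def)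
  qed
  ultimately show "\<sigma> \<in> field_embeddings (quad_field r)" by blast
qed

lemma quad_trace: "field_trace (quad_field r) (of_rat a + of_rat b * r) = 2 * of_rat a"
proof -
  have r0: "r \<noteq> 0" using sqf r by auto
  have "restrict id (quad_field r) r \<noteq> quad_conj r"
    using quad_conj_eq[of 0 1] quad_fieldI[of 0 1 r] r0 by simp
  hence ne: "restrict id (quad_field r) \<noteq> quad_conj" by metis
  show ?thesis
    unfolding field_trace_def quad_embeddings using ne by (simp add: quad_conj_eq quad_fieldI)
qed

text \<open>For nonzero b the element is irrational, so its integral minimal polynomial has degree
  at least 2 and must be X^2 - 2 a X + (a^2 - b^2 s): trace and norm are integers.\<close>

lemma quad_algebraic_int_coords:
  assumes "algebraic_int (of_rat a + of_rat b * r)"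
  shows "2 * a \<in> \<int> \<and> a ^ 2 - b ^ 2 * of_int s \<in> \<int>"
proof (cases "b = 0")
  case True
  hence "algebraic_int (of_rat a :: complex)" using assms by simp
  hence "(of_rat a :: complex) \<in> \<int>" by (rule rational_algebraic_int_is_int) simp
  then obtain c where "(of_rat a :: complex) = of_int c" by (auto elim: Ints_cases)
  hence "a = of_int c" by (metis of_rat_eq_iff of_rat_of_int_eq)
  thus ?thesis using True by simp
next
  case False
  define x where "x = of_rat a + of_rat b * r"
  obtain f where f: "lead_coeff f = 1" "poly (intp f) x = 0"
    "\<And>g. poly (ratp g) x = 0 \<Longrightarrow> of_int_poly f dvd g"
    using algebraic_int_minpoly assms unfolding x_def by blast
  define g where "g = [:a ^ 2 - b ^ 2 * of_int s, - 2 * a, 1:]"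
  have r2: "r * r = of_int s" using r by (simp add: power2_eq_square)
  have "ratp g = [:of_rat (a ^ 2 - b ^ 2 * of_int s), of_rat (- 2 * a), 1:]"
    by (rule poly_eqI) (simp add: g_def coeff_pCons split: nat.splits)
  hence "poly (ratp g) x = 0"
    unfolding x_def using r2
    by (simp add: of_rat_diff of_rat_mult of_rat_power of_rat_minus power2_eq_square algebra_simps)
  hence dvd: "of_int_poly f dvd g" by (rule f(3))
  have xQ: "x \<notin> \<rat>"
  proof
    assume "x \<in> \<rat>"
    then obtain c where "x = of_rat c" by (auto elim: Rats_cases)
    hence "of_rat a + of_rat b * r = of_rat c + of_rat 0 * r" by (simp add: x_def)
    thus False using quad_coords_unique False by blast
  qed
  have "degree f \<ge> 2"
  proof (rule ccontr)
    assume "\<not> degree f \<ge> 2"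
    hence uv: "f = [:coeff f 0, coeff f 1:]" (is "f = [:?u, ?v:]")
      by (intro poly_eqI) (auto simp: coeff_pCons coeff_eq_0 split: nat.splits)
    define u v where "u = ?u" and "v = ?v"
    note uv = uv[folded u_def v_def]
    have "v = 1 \<or> v = 0 \<and> u = 1" using f(1) uv by (auto split: if_splits)
    thus False
    proof
      assume "v = 1"
      hence "x = of_int (- u)" using f(2) uv by (simp add: add_eq_0_iff)
      thus False using xQ by (metis Rats_of_int)
    qed (use f(2) uv in simp)
  qed
  obtain h where h: "g = of_int_poly f * h" using dvd by blast
  have g0: "g \<noteq> 0" "degree g = 2" "lead_coeff g = 1" by (simp_all add: g_def)
  hence h0: "h \<noteq> 0" "f \<noteq> 0" using h by auto
  have "degree g = degree f + degree h"
    unfolding h using h0 by (subst degree_mult_eq) auto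
  hence "degree h = 0" using g0 \<open>degree f \<ge> 2\<close> by simp
  moreover have "lead_coeff h = 1" using g0(3) f(1) unfolding h lead_coeff_mult by simp
  ultimately have "h = 1" by (metis degree_eq_zeroE lead_coeff_pCons(2) pCons_one coeff_pCons_0 degree_pCons_0)
  hence g: "g = of_int_poly f" using h by simp
  have c: "coeff g i \<in> \<int>" for i unfolding g by simp
  have "- (2 * a) \<in> \<int>" using c[of 1] by (simp add: g_def)
  moreover have "a ^ 2 - b ^ 2 * of_int s \<in> \<int>" using c[of 0] by (simp add: g_def)
  ultimately show ?thesis using Ints_minus by fastforce
qed

text \<open>With trace t and norm n, (2 b)^2 s = t^2 - 4 n is an integer, and squarefreeness of s
  makes 2 b an integer too.\<close>

lemma quad_int_coords:
  assumes "algebraic_int (of_rat a + of_rat b * r)"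
  obtains t u :: int where "2 * a = of_int t" "2 * b = of_int u" "4 dvd t ^ 2 - u ^ 2 * s"
proof -
  obtain t n where t: "2 * a = of_int t" and n: "a ^ 2 - b ^ 2 * of_int s = of_int n"
    using quad_algebraic_int_coords[OF assms] by (auto elim!: Ints_cases)
  have e: "(2 * b) ^ 2 * of_int s = of_int (t ^ 2 - 4 * n)"
    using n by (simp add: t[symmetric] power_mult_distrib)
  hence "(2 * b) ^ 2 * of_int s \<in> \<int>" by simp
  hence "2 * b \<in> \<int>" by (rule rat_square_times_squarefree[OF sqf])
  then obtain u where u: "2 * b = of_int u" by (auto elim: Ints_cases)
  have "(of_int (u ^ 2 * s) :: rat) = of_int (t ^ 2 - 4 * n)" using e unfolding u by simp
  hence "u ^ 2 * s = t ^ 2 - 4 * n" by (simp only: of_int_eq_iff)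
  hence "4 dvd t ^ 2 - u ^ 2 * s" by simp
  thus ?thesis by (rule that[OF t u])
qed

lemma quad_basisI:
  assumes w: "w = of_rat c + of_rat d * r" "algebraic_int w" "d \<noteq> 0"
    and ex: "\<And>a b. algebraic_int (of_rat a + of_rat b * r) \<Longrightarrow>
      \<exists>x y :: int. a = of_int x + of_int y * c \<and> b = of_int y * d"
  shows "is_integral_basis (quad_field r) [1, w]"
  unfolding is_integral_basis_def
proof (intro conjI ballI)
  show "set [1, w] \<subseteq> ring_of_integers (quad_field r)"
    using w(2) csubfield_one[OF subfield_quad] by (auto simp: ring_of_integers_def w(1) quad_fieldI)
  fix z assume "z \<in> ring_of_integers (quad_field r)"
  then obtain a b where z: "z = of_rat a + of_rat b * r" "algebraic_int (of_rat a + of_rat b * r)"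
    unfolding ring_of_integers_def quad_field_def by blast
  obtain x y :: int where xy: "a = of_int x + of_int y * c" "b = of_int y * d" using ex[OF z(2)] by blast
  have comb: "of_int x' + of_int y' * w = of_rat (of_int x' + of_int y' * c) + of_rat (of_int y' * d) * r" for x' y'
    by (simp add: w(1) of_rat_add of_rat_mult algebra_simps)
  have zxy: "z = of_int x + of_int y * w" unfolding comb z(1) xy ..
  show "\<exists>!cs :: int list. length cs = length [1, w] \<and> z = (\<Sum>i<length [1, w]. of_int (cs ! i) * [1, w] ! i)"
  proof (rule ex1I[of _ "[x, y]"])
    show "length [x, y] = length [1, w] \<and> z = (\<Sum>i<length [1, w]. of_int ([x, y] ! i) * [1, w] ! i)"
      by (simp add: zxy numeral_2_eq_2)
    fix cs :: "int list"
    assume cs: "length cs = length [1, w] \<and> z = (\<Sum>i<length [1, w]. of_int (cs ! i) * [1, w] ! i)"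
    then obtain x' y' where cs': "cs = [x', y']" by (auto simp: length_Suc_conv)
    have "z = of_int x' + of_int y' * w" using cs by (simp add: cs' numeral_2_eq_2)
    hence "of_rat (of_int x' + of_int y' * c) + of_rat (of_int y' * d) * r
         = of_rat (of_int x + of_int y * c) + of_rat (of_int y * d) * r"
      unfolding comb[symmetric] zxy[symmetric] ..
    hence "of_int x' + of_int y' * c = of_int x + of_int y * c \<and> of_int y' * d = of_int y * d"
      by (rule quad_coords_unique)
    hence "y' = y" "x' = x" using w(3) by auto
    thus "cs = [x, y]" by (simp add: cs')
  qed
qed

text \<open>The rational part c of w drops out of the determinant; d = 1/2 and d = 1 give the two
  possible discriminants s and 4 s.\<close>

lemma gram_det_quad:
  assumes w: "w = of_rat c + of_rat d * r"
  shows "det (gram (quad_field r) [1, w]) = of_rat (4 * d ^ 2 * of_int s)"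
proof -
  have r2: "r * r = of_int s" using r by (simp add: power2_eq_square)
  have t1: "field_trace (quad_field r) 1 = 2" using quad_trace[of 1 0] by simp
  have tw: "field_trace (quad_field r) w = 2 * of_rat c" using quad_trace w by simp
  have "w * w = of_rat (c ^ 2 + d ^ 2 * of_int s) + of_rat (2 * c * d) * r"
    unfolding w using r2 by (simp add: of_rat_add of_rat_mult of_rat_power power2_eq_square algebra_simps)
  hence tww: "field_trace (quad_field r) (w * w) = 2 * of_rat (c ^ 2 + d ^ 2 * of_int s)"
    using quad_trace by simp
  show ?thesis
    by (subst det_2x2)
      (auto simp: gram_def t1 tw tww of_rat_add of_rat_mult of_rat_power power2_eq_square algebra_simps)
qed

text \<open>The congruence of t^2 and u^2 s modulo 4 decides the basis: for s = 1 modulo 4 it makes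
  t - u even, otherwise it makes both t and u even.\<close>

lemma field_disc_quad: "field_disc (quad_field r) = (if s mod 4 = 1 then s else 4 * s)"
proof (cases "s mod 4 = 1")
  case True
  define w where "w = of_rat (1/2) + of_rat (1/2) * r"
  obtain k where k: "s = 4 * k + 1" using True by (metis mult_div_mod_eq)
  have "4 * (w * w) = (1 + r) * (1 + r)" by (simp add: w_def of_rat_divide field_simps)
  also have "\<dots> = 1 + 2 * r + of_int s" using r by (simp add: power2_eq_square algebra_simps)
  also have "\<dots> = 4 * (w + of_int k)" by (simp add: k w_def of_rat_divide field_simps)
  finally have ww: "w * w = w + of_int k" by (subst (asm) mult_left_cancel) auto
  have "poly (intp [:- k, - 1, 1:]) w = 0" using ww by (simp add: algebra_simps)
  hence w: "algebraic_int w" unfolding algebraic_int_altdef_ipoly by (intro exI[of _ "[:- k, - 1, 1:]"]) auto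
  have "is_integral_basis (quad_field r) [1, w]"
  proof (rule quad_basisI[OF w_def w])
    fix a b assume "algebraic_int (of_rat a + of_rat b * r)"
    then obtain t u :: int where tu: "2 * a = of_int t" "2 * b = of_int u" "4 dvd t ^ 2 - u ^ 2 * s"
      by (rule quad_int_coords)
    have "even (t ^ 2 - u ^ 2 * s)" using tu(3) by (meson dvd_trans even_numeral)
    hence "even (t - u)" using k by auto
    then obtain x where x: "t = u + 2 * x" by (metis add.commute diff_add_cancel dvdE)
    show "\<exists>x y :: int. a = of_int x + of_int y * (1/2) \<and> b = of_int y * (1/2)"
    proof (intro exI conjI)
      have "2 * a = 2 * (of_int x + of_int u * (1/2))" unfolding tu(1) x by simp
      thus "a = of_int x + of_int u * (1/2)" by simp
      show "b = of_int u * (1/2)" using tu(2) by simp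
    qed
  qed simp
  moreover have "det (gram (quad_field r) [1, w]) = of_int s"
    unfolding gram_det_quad[OF w_def] by (simp add: power2_eq_square)
  ultimately show ?thesis using field_disc_eqI[OF subfield_quad] True by simp
next
  case False
  have w0: "r = of_rat 0 + of_rat 1 * r" by simp
  have "poly (intp [:- s, 0, 1:]) r = 0" using r by (simp add: power2_eq_square)
  hence w: "algebraic_int r" unfolding algebraic_int_altdef_ipoly by (intro exI[of _ "[:- s, 0, 1:]"]) auto
  have s4: "s mod 4 = 2 \<or> s mod 4 = 3"
  proof -
    have "\<not> 2 ^ 2 dvd s" using squarefreeD[OF sqf, of 2] by auto
    hence "s mod 4 \<noteq> 0" by auto
    moreover have "0 \<le> s mod 4" "s mod 4 < 4" by auto
    ultimately show ?thesis using False by linarith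
  qed
  have "is_integral_basis (quad_field r) [1, r]"
  proof (rule quad_basisI[OF w0 w])
    fix a b assume "algebraic_int (of_rat a + of_rat b * r)"
    then obtain t u :: int where tu: "2 * a = of_int t" "2 * b = of_int u" "4 dvd t ^ 2 - u ^ 2 * s"
      by (rule quad_int_coords)
    have "even t \<and> even u"
    proof -
      have sq: "v ^ 2 mod 4 = (if even v then 0 else 1)" for v :: int
      proof (cases "even v")
        case True
        then obtain z where "v = 2 * z" by blast
        thus ?thesis by (simp add: power2_eq_square)
      next
        case False
        then obtain z where "v = 2 * z + 1" by (rule oddE)
        hence "v ^ 2 = 4 * (z ^ 2 + z) + 1" by (simp add: power2_eq_square algebra_simps)
        moreover have "(4 * (z ^ 2 + z) + 1) mod 4 = 1" by (subst mod_mult_self4) simp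
        ultimately show ?thesis using False by simp
      qed
      have "(t ^ 2 mod 4 - (u ^ 2 mod 4) * (s mod 4)) mod 4 = (t ^ 2 - u ^ 2 * s) mod 4"
        by (intro mod_diff_cong mod_mult_cong mod_mod_trivial)
      also have "\<dots> = 0" using tu(3) by (rule dvd_imp_mod_0)
      finally have "(t ^ 2 mod 4 - (u ^ 2 mod 4) * (s mod 4)) mod 4 = 0" .
      thus ?thesis using s4 unfolding sq by (auto split: if_splits)
    qed
    then obtain x y where "t = 2 * x" "u = 2 * y" by blast
    thus "\<exists>x y :: int. a = of_int x + of_int y * 0 \<and> b = of_int y * 1"
      using tu(1,2) by (intro exI[of _ x] exI[of _ y]) simp
  qed simp
  moreover have "det (gram (quad_field r) [1, r]) = of_int (4 * s)"
    unfolding gram_det_quad[OF w0] by (simp add: of_rat_mult)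
  ultimately show ?thesis using field_disc_eqI[OF subfield_quad] False by simp
qed

end

theorem disc_sqrt_squarefree_mult_square:
  assumes "squarefree s" "q \<noteq> 0"
  shows "disc_sqrt (of_int s * q ^ 2) = (if s mod 4 = 1 then s else 4 * s)"
proof -
  define z where "z = csqrt (of_rat (of_int s * q ^ 2))"
  define r where "r = z / of_rat q"
  have "z ^ 2 = of_int s * of_rat q ^ 2" by (simp add: z_def of_rat_mult of_rat_power)
  hence r: "r ^ 2 = of_int s" using assms(2) by (simp add: r_def power_divide)
  have "z = of_rat q * r" using assms(2) by (simp add: r_def)
  hence d: "disc_sqrt (of_int s * q ^ 2) = field_disc (quad_field r)"
    using adjoin_rat_sqrt[of r "of_int s" q] assms(2) r by (simp add: disc_sqrt_def z_def)
  show ?thesis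
  \<comment> \<open>For s = 1 the root r is rational and the field collapses to the rationals, whose
    discriminant 1 fits the formula.\<close>
  proof (cases "s = 1")
    case True
    hence "r = 1 \<or> r = - 1" using r by (simp add: power2_eq_1_iff)
    hence "r \<in> \<rat>" by auto
    hence "quad_field r \<subseteq> \<rat>" by (auto simp: quad_field_def)
    moreover have "\<rat> \<subseteq> quad_field r" using csubfield_Rats[OF subfield_quad_field[of r "of_int s"]] r by simp
    ultimately have "quad_field r = \<rat>" by blast
    thus ?thesis using d field_disc_Rats True by simp
  next
    case False
    thus ?thesis using field_disc_quad[OF assms(1) False r] d by simp
  qed
qed

section \<open>Cosets modulo powers\<close>

definition pcoset :: "nat \<Rightarrow> rat \<Rightarrow> rat set" where
  "pcoset d g = (\<lambda>h. h * g) ` rat_powers d"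

lemma rat_powers_eq: "rat_powers d = {x ^ d | x. x \<noteq> 0}"
  unfolding rat_powers_def by auto

lemma r_coset_rat_powers: "rat_powers d #>\<^bsub>rat_star\<^esub> g = pcoset d g"
  unfolding r_coset_def pcoset_def by auto

lemma pcoset_self: "g \<in> pcoset d g"
  unfolding pcoset_def rat_powers_eq by (force intro: image_eqI[of _ _ 1] exI[of _ 1])

lemma pcoset_eqD: "pcoset d g = pcoset d h \<Longrightarrow> \<exists>c. c \<noteq> 0 \<and> g = c ^ d * h"
  using pcoset_self[of g d] unfolding pcoset_def rat_powers_eq by auto

lemma pcoset_mult_power: "c \<noteq> 0 \<Longrightarrow> pcoset d (g * c ^ d) = pcoset d g"
proof (intro equalityI subsetI)
  fix x assume c: "c \<noteq> 0" and "x \<in> pcoset d (g * c ^ d)"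
  then obtain y where "y \<noteq> 0" "x = y ^ d * (g * c ^ d)" unfolding pcoset_def rat_powers_eq by auto
  hence "x = (y * c) ^ d * g" "y * c \<noteq> 0" using c by (auto simp: power_mult_distrib)
  thus "x \<in> pcoset d g" unfolding pcoset_def rat_powers_eq by blast
next
  fix x assume c: "c \<noteq> 0" and "x \<in> pcoset d g"
  then obtain y where "y \<noteq> 0" "x = y ^ d * g" unfolding pcoset_def rat_powers_eq by auto
  hence "x = (y / c) ^ d * (g * c ^ d)" "y / c \<noteq> 0" using c by (auto simp: power_divide)
  thus "x \<in> pcoset d (g * c ^ d)" unfolding pcoset_def rat_powers_eq by blast
qed

lemma pcoset_1: "pcoset d 1 = rat_powers d"
  by (simp add: pcoset_def)

lemma mod_powers_one: "\<one>\<^bsub>mod_powers G d\<^esub> = rat_powers d"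
  by (simp add: mod_powers_def FactGroup_def)

lemma mod_powers_carrier:
  assumes G: "subgroup G rat_star"
  shows "carrier (mod_powers G d) = pcoset d ` G"
proof -
  have "carrier (mod_powers G d) = pcoset d ` (G <#>\<^bsub>rat_star\<^esub> rat_powers d)"
    by (auto simp: mod_powers_def FactGroup_def RCOSETS_def r_coset_def pcoset_def)
  also have "G <#>\<^bsub>rat_star\<^esub> rat_powers d = {g * c ^ d | g c. g \<in> G \<and> c \<noteq> 0}"
    by (auto simp: set_mult_def rat_powers_eq)
  also have "pcoset d ` \<dots> = pcoset d ` G"
  proof (intro equalityI subsetI)
    fix \<gamma> assume "\<gamma> \<in> pcoset d ` G"
    then obtain g where g: "g \<in> G" "\<gamma> = pcoset d (g * 1 ^ d)" by auto
    show "\<gamma> \<in> pcoset d ` {g * c ^ d | g c. g \<in> G \<and> c \<noteq> 0}"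
      by (rule image_eqI[where f = "pcoset d", OF g(2)])
        (unfold mem_Collect_eq, rule exI[of _ g], rule exI[of _ 1], simp add: g(1))
  qed (auto simp: pcoset_mult_power)
  finally show ?thesis .
qed

lemma two_torsion_mod_powers:
  assumes G: "subgroup G rat_star" and \<gamma>: "\<gamma> \<in> two_torsion (mod_powers G d)"
  obtains g where "g \<in> G" "\<gamma> = pcoset d g" "g ^ 2 \<in> rat_powers d"
proof -
  obtain g where g: "g \<in> G" "\<gamma> = pcoset d g"
    using \<gamma> mod_powers_carrier[OF G] unfolding two_torsion_def by auto
  have "\<gamma> \<otimes>\<^bsub>mod_powers G d\<^esub> \<gamma> = rat_powers d"
    using \<gamma> unfolding two_torsion_def mod_powers_one by simp
  moreover have "g * g \<in> \<gamma> \<otimes>\<^bsub>mod_powers G d\<^esub> \<gamma>"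
    using pcoset_self[of g d] unfolding g(2)
    by (auto simp: mod_powers_def FactGroup_def set_mult_def)
  ultimately have "g ^ 2 \<in> rat_powers d" by (simp add: power2_eq_square)
  thus ?thesis by (rule that[OF g])
qed

text \<open>Up to the square b^2, the fraction a / b is the integer a b, whose squarefree part
  serves as s.\<close>

lemma rat_squarefree_decomposition:
  fixes x :: rat assumes "x \<noteq> 0"
  obtains s q where "squarefree s" "q \<noteq> 0" "x = of_int s * q ^ 2"
proof -
  obtain a b where ab: "quotient_of x = (a, b)" by (metis surj_pair)
  have b: "b > 0" "x = of_int a / of_int b"
    using quotient_of_denom_pos[OF ab] quotient_of_div[OF ab] by auto
  define c where "c = square_part (a * b)"
  have c: "a * b = squarefree_part (a * b) * c ^ 2"
    unfolding c_def by (rule squarefree_decompose)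
  have c0: "c \<noteq> 0" using c b assms by auto
  have "x = of_int (a * b) / of_int b ^ 2" using b by (simp add: power2_eq_square)
  also have "\<dots> = of_int (squarefree_part (a * b)) * (of_int c / of_int b) ^ 2"
    by (subst c) (simp add: power_divide)
  finally show ?thesis using c0 b by (intro that[of "squarefree_part (a * b)" "of_int c / of_int b"]) auto
qed

lemma squarefree_int_iff: "squarefree (int n) \<longleftrightarrow> squarefree n"
proof
  assume n: "squarefree (int n)"
  show "squarefree n"
  proof (rule squarefreeI)
    fix y assume "y ^ 2 dvd n"
    hence "int (y ^ 2) dvd int n" by (simp only: of_nat_dvd_iff)
    hence "int y ^ 2 dvd int n" by simp
    hence "int y dvd 1" by (rule squarefreeD[OF n])
    thus "y dvd 1" by simp
  qed
next
  assume n: "squarefree n"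
  show "squarefree (int n)"
  proof (rule squarefreeI)
    fix y assume "y ^ 2 dvd int n"
    hence "int (nat \<bar>y\<bar> ^ 2) dvd int n" by simp
    hence "nat \<bar>y\<bar> ^ 2 dvd n" by (simp only: of_nat_dvd_iff)
    hence "nat \<bar>y\<bar> dvd 1" by (rule squarefreeD[OF n])
    thus "y dvd 1" by auto
  qed
qed

lemma rat_pos_squarefree_decomposition:
  fixes x :: rat assumes "x > 0"
  obtains n :: nat and q where "squarefree n" "q \<noteq> 0" "x = of_nat n * q ^ 2"
proof -
  obtain s q where s: "squarefree s" "q \<noteq> 0" "x = of_int s * q ^ 2"
    using rat_squarefree_decomposition[of x] assms by auto
  have "s > 0"
  proof (rule ccontr)
    assume "\<not> s > 0"
    hence "(of_int s :: rat) * q ^ 2 \<le> 0" by (intro mult_nonpos_nonneg) auto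
    thus False using assms s(3) by simp
  qed
  hence "squarefree (nat s)" using s(1) squarefree_int_iff[of "nat s"] by simp
  thus ?thesis using that[of "nat s" q] s \<open>s > 0\<close> by simp
qed

text \<open>From g^2 = r^(2h) follows |g| = |r|^h, and |r| = n q^2 then produces the form of gamma'
  that enters the definition of delta, with gamma_0 = n.\<close>

lemma square_in_rat_powers_decomposition:
  assumes d: "d = 2 * h" "h > 0" and g: "g ^ 2 \<in> rat_powers d"
  obtains \<epsilon> :: int and n :: nat and q where "\<epsilon> = 1 \<or> \<epsilon> = -1" "squarefree n" "q \<noteq> 0"
    "g = of_int (\<epsilon> * int n ^ h) * q ^ d"
proof -
  obtain r where r: "r \<noteq> 0" "g ^ 2 = r ^ d" using g unfolding rat_powers_eq by auto
  obtain n :: nat and q where nq: "squarefree n" "q \<noteq> 0" "\<bar>r\<bar> = of_nat n * q ^ 2"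
    using rat_pos_squarefree_decomposition[of "\<bar>r\<bar>"] r(1) by auto
  have "g ^ 2 = (r ^ h) ^ 2" unfolding r(2) d by (simp add: mult.commute flip: power_mult)
  hence "\<bar>g\<bar> = \<bar>r\<bar> ^ h" by (metis power2_eq_iff abs_minus_cancel power_abs)
  also have "\<dots> = of_nat n ^ h * q ^ d" unfolding nq(3) d by (simp add: power_mult_distrib power_mult)
  finally have "g = of_nat n ^ h * q ^ d \<or> g = - (of_nat n ^ h * q ^ d)" by linarith
  thus ?thesis
  proof
    assume "g = of_nat n ^ h * q ^ d"
    thus ?thesis using that[of 1 n q] nq by simp
  next
    assume "g = - (of_nat n ^ h * q ^ d)"
    thus ?thesis using that[of "-1" n q] nq by simp
  qed
qed

lemma power_free_dvd_unit:
  assumes "power_free d n" "b ^ d dvd n" "b \<noteq> 0" shows "is_unit (b :: int)"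
proof (rule ccontr)
  assume "\<not> is_unit b"
  then obtain p where "prime p" "p dvd b" using prime_divisor_exists assms(3) by blast
  thus False using assms(1,2) unfolding power_free_def by (meson dvd_trans dvd_power_same)
qed

text \<open>Write c = a / b in lowest terms. Then a^d divides n1 and b^d divides n2, so a and b are
  units, c is 1 or -1, and even d removes the sign. This is the uniqueness behind
  \<open>coset_rep\<close>.\<close>

lemma power_free_associated:
  fixes n1 n2 :: int and c :: rat
  assumes pf: "power_free d n1" "power_free d n2" and c: "of_int n1 = c ^ d * of_int n2" "c \<noteq> 0" "even d"
  shows "n1 = n2"
proof -
  obtain a b where ab: "quotient_of c = (a, b)" by (metis surj_pair)
  have b: "b > 0" "algebraic_semidom_class.coprime a b" "c = of_int a / of_int b"
    using quotient_of_denom_pos[OF ab] quotient_of_coprime[OF ab] quotient_of_div[OF ab] by auto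
  have a0: "a \<noteq> 0" using c(2) b(3) by auto
  have "(of_int (n1 * b ^ d) :: rat) = of_int (a ^ d * n2)"
    using c(1) b(1) unfolding b(3) by (simp add: power_divide field_simps)
  hence e: "n1 * b ^ d = a ^ d * n2" by (simp only: of_int_eq_iff)
  have cop: "algebraic_semidom_class.coprime (a ^ d) (b ^ d)" using b(2) by simp
  have "a ^ d dvd n1 * b ^ d" unfolding e by simp
  moreover have "b ^ d dvd a ^ d * n2" unfolding e[symmetric] by simp
  ultimately have "a ^ d dvd n1" "b ^ d dvd n2"
    using cop by (simp_all add: semiring_gcd_class.coprime_dvd_mult_left_iff
        semiring_gcd_class.coprime_dvd_mult_right_iff algebraic_semidom_class.coprime_commute)
  hence "is_unit a" "is_unit b"
    using power_free_dvd_unit[OF pf(1), of a] power_free_dvd_unit[OF pf(2), of b] a0 b(1) by simp_all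
  hence "b = 1" "a = 1 \<or> a = -1" using b(1) by auto
  hence "c ^ d = 1" using b(3) c(3) by auto
  thus ?thesis using c(1) by simp
qed

lemma power_free_squarefree_power:
  assumes "squarefree n" "\<epsilon> = 1 \<or> \<epsilon> = -1" "h > 0"
  shows "power_free (2 * h) (\<epsilon> * int n ^ h)"
  unfolding power_free_def
proof (intro allI impI notI)
  fix p :: int assume p: "prime p" and "p ^ (2 * h) dvd \<epsilon> * int n ^ h"
  hence "(p ^ 2) ^ h dvd int n ^ h" using assms(2) by (auto simp: power_mult)
  hence "p ^ 2 dvd int n" using assms(3) by simp
  hence "is_unit p" using assms(1) squarefreeD[of "int n" p] by (simp add: squarefree_int_iff)
  thus False using p not_prime_unit by blast
qed

lemma squarefree_nat_pos: "squarefree n \<Longrightarrow> (n :: nat) > 0"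
  by (cases n) auto

text \<open>The discriminant of \<open>\<rat>(\<surd>u)\<close> for squarefree \<open>u\<close>, including \<open>u = 1\<close>.\<close>

abbreviation sqrt_disc :: "int \<Rightarrow> int" where
  "sqrt_disc u \<equiv> if u mod 4 = 1 then u else 4 * u"

section \<open>Invariants of the 2-torsion cosets\<close>

context
  fixes d h n :: nat and \<epsilon> :: int and q :: rat and \<gamma> :: "rat set"
  assumes d: "d = 2 * h" "h > 0" and n: "squarefree n" and \<epsilon>: "\<epsilon> = 1 \<or> \<epsilon> = -1" and q: "q \<noteq> 0"
    and \<gamma>: "\<gamma> = pcoset d (of_int (\<epsilon> * int n ^ h) * q ^ d)"
begin

lemma coset_subset_rat_pos_iff: "\<gamma> \<subseteq> rat_pos \<longleftrightarrow> \<epsilon> = 1"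
proof
  have qd: "q ^ d > 0" using d q by (simp add: power_mult)
  assume "\<gamma> \<subseteq> rat_pos"
  hence "of_int (\<epsilon> * int n ^ h) * q ^ d > 0" using pcoset_self \<gamma> by blast
  hence "of_int (\<epsilon> * int n ^ h) > (0 :: rat)" using qd by (simp only: zero_less_mult_pos2)
  hence "\<epsilon> * int n ^ h > 0" by (simp only: of_int_0_less_iff)
  thus "\<epsilon> = 1" using \<epsilon> by auto
next
  assume "\<epsilon> = 1"
  thus "\<gamma> \<subseteq> rat_pos" using d squarefree_nat_pos[OF n] q unfolding \<gamma> pcoset_def rat_powers_eq by (auto simp: power_mult)
qed

lemma coset_rep_eq: "coset_rep d \<gamma> = \<epsilon> * int n ^ h"
proof -
  have g': "\<gamma> = pcoset d (of_int (\<epsilon> * int n ^ h))" unfolding \<gamma> by (rule pcoset_mult_power[OF q])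
  have pf: "power_free d (\<epsilon> * int n ^ h)"
    unfolding d(1) by (rule power_free_squarefree_power[OF n \<epsilon> d(2)])
  show ?thesis
    unfolding coset_rep_def r_coset_rat_powers
  proof (rule the_equality)
    show "power_free d (\<epsilon> * int n ^ h) \<and> \<gamma> = pcoset d (of_int (\<epsilon> * int n ^ h)) \<and>
      (if odd d \<or> \<gamma> \<subseteq> rat_pos then \<epsilon> * int n ^ h > 0 else \<epsilon> * int n ^ h < 0)"
    proof (intro conjI pf g')
      show "if odd d \<or> \<gamma> \<subseteq> rat_pos then \<epsilon> * int n ^ h > 0 else \<epsilon> * int n ^ h < 0"
        unfolding coset_subset_rat_pos_iff using \<epsilon> squarefree_nat_pos[OF n] d(1) by auto
    qed
    fix k assume "power_free d k \<and> \<gamma> = pcoset d (of_int k) \<and>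
      (if odd d \<or> \<gamma> \<subseteq> rat_pos then k > 0 else k < 0)"
    hence k: "power_free d k" "pcoset d (of_int k) = pcoset d (of_int (\<epsilon> * int n ^ h))" using g' by auto
    obtain c :: rat where c: "c \<noteq> 0" "of_int k = c ^ d * of_int (\<epsilon> * int n ^ h)" using pcoset_eqD[OF k(2)] by blast
    show "k = \<epsilon> * int n ^ h" by (rule power_free_associated[OF k(1) pf c(2,1)]) (simp add: d(1))
  qed
qed

lemma coset_root_eq: "coset_root d \<gamma> = n"
proof -
  have a: "\<bar>coset_rep d \<gamma>\<bar> = int n ^ (d div 2)" unfolding coset_rep_eq using \<epsilon> d by (auto simp: abs_mult)
  show ?thesis
    unfolding coset_root_def a
  proof (rule the_equality)
    fix k assume "squarefree k \<and> int n ^ (d div 2) = int k ^ (d div 2)"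
    hence "int n ^ h = int k ^ h" using d by simp
    thus "k = n" using power_eq_iff_eq_base[OF d(2), of "int n" "int k"] by simp
  qed (use n in simp)
qed

text \<open>The separate clause for the trivial coset agrees with the formula: uniqueness of
  power-free representatives forces n = 1 there, and \<open>sqrt_disc 1\<close> is 1.\<close>

lemma coset_delta_eq: "coset_delta d \<gamma> = sqrt_disc (int n)"
proof (cases "\<gamma> = rat_powers d")
  case False
  have "squarefree (int n)"
    using n by (simp add: squarefree_int_iff)
  thus ?thesis
    using disc_sqrt_squarefree_mult_square[of "int n" 1] False
    by (simp add: coset_delta_def coset_root_eq)
next
  case True
  have "pcoset d (of_int (\<epsilon> * int n ^ h)) = pcoset d (of_int (1 * int 1 ^ h))"
    using True pcoset_mult_power[OF q, of d "of_int (\<epsilon> * int n ^ h)"] unfolding \<gamma> by (simp add: pcoset_1)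
  from pcoset_eqD[OF this] obtain c :: rat where
    c: "c \<noteq> 0" "of_int (\<epsilon> * int n ^ h) = c ^ d * of_int (1 * int 1 ^ h)" by (elim exE conjE)
  have pf: "power_free d (\<epsilon> * int n ^ h)" "power_free d (1 * int 1 ^ h)"
    unfolding d(1) by (rule power_free_squarefree_power[OF _ _ d(2)]; use n \<epsilon> in simp)+
  have "\<epsilon> * int n ^ h = 1 * int 1 ^ h"
    by (rule power_free_associated[OF pf c(2,1)]) (simp add: d(1))
  hence "int n ^ h = 1 \<or> int n ^ h = - 1" using \<epsilon> by auto
  moreover have "int n ^ h > 0" using squarefree_nat_pos[OF n] by simp
  ultimately have "int n ^ h = 1 ^ h" by simp
  hence "int n = 1" by (subst (asm) power_eq_iff_eq_base[OF d(2)]) auto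
  thus ?thesis using True by (simp add: coset_delta_def)
qed

end

text \<open>Converts membership into arithmetic data. As v_2(m) = a + 1, half of m_2 is 2^a; the
  sign decides whether the valuation of the discriminant is bounded or prescribed.\<close>

lemma Gamma_tildeE:
  assumes G: "subgroup G rat_star" and \<gamma>: "\<gamma> \<in> Gamma_tilde G m" and m: "multiplicity 2 m = Suc a"
  obtains g \<epsilon> n q where "g \<in> G" "\<gamma> = pcoset (two_part m) g" "\<epsilon> = 1 \<or> \<epsilon> = -1" "squarefree n" "q \<noteq> 0"
    "g = of_int (\<epsilon> * int n ^ (2 ^ a)) * q ^ two_part m"
    "coset_delta (two_part m) \<gamma> = sqrt_disc (int n)"
    "\<epsilon> = 1 \<longrightarrow> multiplicity 2 (sqrt_disc (int n)) \<le> Suc a"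
    "\<epsilon> = -1 \<longrightarrow> multiplicity 2 (sqrt_disc (int n)) = Suc (Suc a)"
proof -
  have d: "two_part m = 2 * 2 ^ a" "(2 :: nat) ^ a > 0" using m by (simp_all add: two_part_def)
  have "\<gamma> \<in> two_torsion (mod_powers G (two_part m))" using \<gamma> unfolding Gamma_tilde_def by blast
  then obtain g where g: "g \<in> G" "\<gamma> = pcoset (two_part m) g" "g ^ 2 \<in> rat_powers (two_part m)"
    using two_torsion_mod_powers[OF G] by blast
  obtain \<epsilon> :: int and n q where e: "\<epsilon> = 1 \<or> \<epsilon> = -1" "squarefree n" "q \<noteq> 0"
    "g = of_int (\<epsilon> * int n ^ (2 ^ a)) * q ^ two_part m"
    using square_in_rat_powers_decomposition[OF d g(3)] by metis
  note \<gamma>' = g(2)[unfolded e(4)]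
  note delta = coset_delta_eq[OF d e(2,1,3) \<gamma>']
  note pos = coset_subset_rat_pos_iff[OF d e(2,1,3) \<gamma>']
  show ?thesis
    by (rule that[OF g(1,2) e delta]) (use \<gamma> pos delta m in \<open>auto simp: Gamma_tilde_def split: if_splits\<close>)
qed

section \<open>Coinciding Kummer fields\<close>

lemma unity_root_4: "unity_root 4 = \<i>"
  by (simp add: unity_root_conv_cis)

text \<open>A Bezout relation a u = b v + 1 writes x as a quotient of powers of x^a and x^b.\<close>

lemma csubfield_coprime_powers:
  assumes K: "subfield K complex_ring" and x: "x ^ a \<in> K" "x ^ b \<in> K" "x \<noteq> 0"
    and ab: "algebraic_semidom_class.coprime a b" "a > 0"
  shows "x \<in> K"
proof -
  obtain u v where uv: "a * u = b * v + 1"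
  proof -
    have "gcd a b = 1" using ab(1) by (simp add: semiring_gcd_class.coprime_imp_gcd_eq_1)
    thus ?thesis using bezout_nat[of a b] ab(2) that by auto
  qed
  have "x ^ (a * u) = x ^ (b * v) * x" unfolding uv by simp
  hence "x = (x ^ a) ^ u / (x ^ b) ^ v" using x(3) by (simp add: power_mult field_simps)
  also have "\<dots> \<in> K" by (rule csubfield_divide[OF K csubfield_power[OF K x(1)] csubfield_power[OF K x(2)]])
  finally show ?thesis .
qed

lemma csubfield_cancel:
  assumes "subfield K complex_ring" "x * y \<in> K" "y \<in> K" "y \<noteq> 0" shows "x \<in> K"
  using csubfield_divide[OF assms(1-3)] assms(4) by simp

lemma squarefree_int_cases:
  fixes u :: int assumes "squarefree u"
  obtains "u mod 4 = 1" | "u mod 4 = 3" | t where "u = 2 * t" "odd t"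
proof (cases "odd u")
  case True
  hence "u mod 4 = 1 \<or> u mod 4 = 3" by presburger
  thus ?thesis using that by blast
next
  case False
  then obtain t where t: "u = 2 * t" by blast
  have "\<not> 2 ^ 2 dvd u" using squarefreeD[OF assms, of 2] by auto
  hence "odd t" using t by auto
  thus ?thesis using t that by blast
qed

text \<open>One of t and -t is 1 modulo 4, and i absorbs the sign.\<close>

lemma sqrt_odd_in:
  assumes K: "subfield K complex_ring" "unity_root N \<in> K" "\<i> \<in> K" and N: "N > 0"
    and t: "odd t" "t dvd int N" and x: "x ^ 2 = of_int t"
  shows "x \<in> K"
proof (cases "t mod 4 = 1")
  case True
  thus ?thesis using sqrt_mod4_in[OF K(1,2) N t(2)] x by blast
next
  case False
  hence "(- t) mod 4 = 1" using t(1) by presburger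
  moreover have "(\<i> * x) ^ 2 = of_int (- t)" by (simp add: power_mult_distrib x)
  ultimately have "\<i> * x \<in> K" using sqrt_mod4_in[OF K(1,2) N, of "- t"] t(2) by simp
  thus ?thesis using csubfield_cancel[OF K(1), of x \<i>] K(3) by (simp add: mult.commute)
qed

text \<open>The discriminant tells which roots of unity are at hand: 4 u brings in i, and for u = 2
  t the divisor 8 brings in zeta_8 and with it the square root of 2.\<close>

lemma sqrt_in_cyclotomic_field:
  assumes K: "subfield K complex_ring" "unity_root N \<in> K" and N: "N > 0"
    and u: "squarefree u" "sqrt_disc u dvd int N" and x: "x ^ 2 = of_int u"
  shows "x \<in> K"
proof -
  have i: "\<i> \<in> K" if "4 dvd N"
    using unity_root_dvd_in[OF K that N] by (simp add: unity_root_4)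
  from u(1) show ?thesis
  proof (cases rule: squarefree_int_cases)
    case 1
    thus ?thesis using sqrt_mod4_in[OF K N] u(2) x by simp
  next
    case 2
    hence "odd u" by presburger
    have "4 * u dvd int N" using 2 u(2) by simp
    hence "int 4 dvd int N" and uN: "u dvd int N" by (auto elim: dvd_mult_left dvd_mult_right)
    hence "4 dvd N" by (simp only: of_nat_dvd_iff)
    thus ?thesis by (rule sqrt_odd_in[OF K i N \<open>odd u\<close> uN x])
  next
    case (3 t)
    hence "u mod 4 \<noteq> 1" by presburger
    hence "8 * t dvd int N" using u(2) 3 by simp
    hence "int 8 dvd int N" and t: "t dvd int N" by (auto elim: dvd_mult_left dvd_mult_right)
    hence N8: "8 dvd N" by (simp only: of_nat_dvd_iff)
    hence "4 dvd N" by presburger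
    note i = i[OF this]
    define z where "z = unity_root 8"
    have zK: "z \<in> K" unfolding z_def by (rule unity_root_dvd_in[OF K N8 N])
    have z2: "z ^ 2 = \<i>" using unity_root_dvd[of 4 8] by (simp add: z_def unity_root_4)
    have z0: "z \<noteq> 0" by (simp add: z_def)
    \<comment> \<open>A square root of 2, because (zeta_8 + 1/zeta_8)^2 = i + 2 - i.\<close>
    define s where "s = z + inverse z"
    have "s ^ 2 = z ^ 2 + 2 + inverse (z ^ 2)" using z0 by (simp add: s_def power2_sum power_inverse)
    hence s2: "s ^ 2 = 2" by (simp add: z2)
    have s0: "s \<noteq> 0" using s2 by auto
    have "(x / s) ^ 2 = of_int t" using x 3 by (simp add: power_divide s2)
    hence "x / s \<in> K" using sqrt_odd_in[OF K i N 3(2) t] by blast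
    moreover have "s \<in> K" unfolding s_def by (intro csubfield_add[OF K(1)] csubfield_inverse[OF K(1)] zK)
    ultimately have "x / s * s \<in> K" by (rule csubfield_mult[OF K(1)])
    thus ?thesis using s0 by simp
  qed
qed

lemma multiplicity_2_sqrt_disc:
  assumes "squarefree u"
  shows "multiplicity 2 (sqrt_disc u) = (if u mod 4 = 1 then 0 else if odd u then 2 else 3)"
  using assms
proof (cases rule: squarefree_int_cases)
  case 1
  hence "odd u" by presburger
  thus ?thesis using 1 by (simp add: not_dvd_imp_multiplicity_0)
next
  case 2
  hence "odd u" by presburger
  hence "multiplicity 2 (4 * u) = 2" by (intro multiplicity_decomposeI[of _ 2 2 u]) auto
  thus ?thesis using 2 \<open>odd u\<close> by simp
next
  case (3 t)
  hence "u mod 4 \<noteq> 1" by presburger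
  moreover have "multiplicity 2 (4 * u) = 3"
    using 3 by (intro multiplicity_decomposeI[of _ 2 3 t]) auto
  ultimately show ?thesis using 3 by simp
qed

text \<open>The hypotheses on delta leave a spare factor 2; the valuation bound from
  \<open>Gamma_tilde\<close> removes it, since the odd part of b divides m / 2^k anyway.\<close>

lemma dvd_of_dvd_double:
  fixes b :: int
  assumes b: "b dvd 2 * int m" "b \<noteq> 0" and m: "multiplicity 2 m = k" "multiplicity 2 b \<le> k" "m > 0"
  shows "b dvd int m"
proof -
  obtain t where t: "b = 2 ^ multiplicity 2 b * t" "\<not> 2 dvd t"
    using multiplicity_decompose'[of b 2] b(2) by auto
  obtain j where j: "m = 2 ^ k * j" using multiplicity_dvd[of 2 m] m(1) by auto
  have "t dvd 2 * int m" using b(1) t(1) by (metis dvd_mult_right)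
  also have "2 * int m = 2 ^ Suc k * int j" by (simp add: j)
  finally have "t dvd 2 ^ Suc k * int j" .
  moreover have "algebraic_semidom_class.coprime t (2 ^ Suc k)" using t(2) by simp
  ultimately have "t dvd int j" by (simp add: semiring_gcd_class.coprime_dvd_mult_right_iff)
  hence "2 ^ multiplicity 2 b * t dvd 2 ^ k * int j" using m(2) by (intro mult_dvd_mono le_imp_power_dvd)
  thus ?thesis using t(1) by (simp add: j)
qed

section \<open>The three cases of the theorem\<close>

lemma subgroup_has_gt_one:
  assumes G: "subgroup G rat_star" and h: "h \<in> G" "\<bar>h\<bar> \<noteq> 1"
  obtains g where "g \<in> G" "g > 1"
proof -
  have h0: "h \<noteq> 0" using rat_subgroup_nonzero[OF G h(1)] .
  have ne: "h ^ 2 \<noteq> 1" using h(2) by (auto simp: power2_eq_1_iff)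
  have pos: "h ^ 2 > 0" using h0 by simp
  show ?thesis
  proof (cases "h ^ 2 > 1")
    case True
    thus ?thesis using that[of "h ^ 2"] rat_subgroup_power[OF G h(1)] by blast
  next
    case False
    hence "h ^ 2 < 1" using ne by linarith
    hence "inverse (h ^ 2) > 1" using pos by (simp add: one_less_inverse)
    thus ?thesis using that rat_subgroup_inverse[OF G rat_subgroup_power[OF G h(1)]] by blast
  qed
qed

lemma rho_eq_0_odd:
  assumes fg: "finitely_generated_subgroup G" and nontrivial: "G \<noteq> {1}"
    and m: "odd m" and disc: "\<And>g. g \<in> G \<Longrightarrow> disc_sqrt g dvd int m"
  shows "rho G m = 0"
proof -
  have G: "subgroup G rat_star" using fg by (simp add: finitely_generated_subgroup_def)
  have m0: "m > 0" using m by (simp add: odd_pos)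
  obtain h where h: "h \<in> G" "h \<noteq> 1" using nontrivial rat_subgroup_one[OF G] by blast
  \<comment> \<open>Q(i) has discriminant -4, which cannot divide an odd m. So h differs from 1 and
    -1, and some element exceeds 1, as the convergence argument requires.\<close>
  have "h \<noteq> -1"
  proof
    assume "h = -1"
    hence "disc_sqrt (of_int (-1) * 1 ^ 2) dvd int m" using disc[OF h(1)] by simp
    hence "- 4 dvd int m" by (subst (asm) disc_sqrt_squarefree_mult_square) auto
    hence "even (int m)" by (meson dvd_trans even_numeral dvd_minus_iff minus_dvd_iff)
    thus False using m by simp
  qed
  hence "\<bar>h\<bar> \<noteq> 1" using h(2) by linarith
  then obtain g where g: "g \<in> G" "g > 1" using subgroup_has_gt_one[OF G h(1)] by blast
  show ?thesis
  proof (rule rho_eq_0I[OF fg g m0 two_is_prime_nat])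
    fix k :: nat assume k: "k > 0" "\<not> 2 dvd k"
    define N where "N = m * k"
    have N: "odd N" "N > 0" using m k m0 by (auto simp: N_def)
    have c2: "algebraic_semidom_class.coprime 2 N" using N(1) by simp
    define K where "K = kummer_field G N"
    have K: "subfield K complex_ring" "unity_root N \<in> K"
      unfolding K_def by (rule subfield_kummer unity_root_in_kummer)+
    have "kummer_field G (2 * N) \<subseteq> K"
    proof (rule kummer_field_minimal[OF K(1)])
      have e: "unity_root (2 * N) ^ 2 = unity_root N" "unity_root (2 * N) ^ N = - 1"
        using unity_root_dvd[of N "2 * N"] N by (simp_all add: unity_root_power)
      show "unity_root (2 * N) \<in> K"
        by (rule csubfield_coprime_powers[OF K(1) _ _ _ c2])
          (simp_all add: e K(2) csubfield_uminus[OF K(1)] csubfield_one[OF K(1)])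
      fix x :: complex and g assume g: "g \<in> G" "x ^ (2 * N) = of_rat g"
      have g0: "g \<noteq> 0" using rat_subgroup_nonzero[OF G g(1)] .
      have x0: "x \<noteq> 0" using g g0 N by (auto simp: power_0_left)
      have "(x ^ 2) ^ N = of_rat g" using g(2) by (simp add: power_mult)
      hence x2: "x ^ 2 \<in> K" unfolding K_def using root_in_kummer[OF dvd_refl N(2) _ g(1)] by blast
      obtain s q where sq: "squarefree s" "q \<noteq> 0" "g = of_int s * q ^ 2"
        using rat_squarefree_decomposition[OF g0] by blast
      \<comment> \<open>x^N is a square root of g; dividing by q leaves a square root of the
        squarefree part s, whose discriminant divides m and hence N.\<close>
      have "(x ^ N / of_rat q) ^ 2 = of_rat g / of_rat q ^ 2"
        using g(2) by (simp add: power_divide mult.commute flip: power_mult)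
      also have "\<dots> = of_int s" using sq(2,3) by (simp add: of_rat_mult of_rat_power)
      finally have e: "(x ^ N / of_rat q) ^ 2 = of_int s" .
      have "sqrt_disc s dvd int m"
        using disc[OF g(1)] disc_sqrt_squarefree_mult_square[OF sq(1,2)] sq(3) by simp
      hence "sqrt_disc s dvd int N" unfolding N_def of_nat_mult by (rule dvd_mult2)
      hence "x ^ N / of_rat q \<in> K" using sqrt_in_cyclotomic_field[OF K N(2) sq(1) _ e] by blast
      hence "x ^ N / of_rat q * of_rat q \<in> K" by (intro csubfield_mult[OF K(1)] csubfield_of_rat[OF K(1)])
      hence xN: "x ^ N \<in> K" using sq(2) by simp
      show "x \<in> K" by (rule csubfield_coprime_powers[OF K(1) x2 xN x0 c2]) simp
    qed
    moreover have "K \<subseteq> kummer_field G (2 * N)" unfolding K_def by (rule kummer_mono) (use N in auto)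
    ultimately show "kummer_field G (m * (2 * k)) = kummer_field G (m * k)"
      by (auto simp: K_def N_def mult.left_commute)
  qed
qed

text \<open>Since (2 w + 1)^2 = -3 for a primitive cube root of unity w, it is recovered rationally
  from any square root of -3.\<close>

lemma unity_root_3_in:
  assumes K: "subfield K complex_ring" and y: "y \<in> K" "y ^ 2 = - 3"
  shows "unity_root 3 \<in> K"
proof -
  define w where "w = unity_root 3"
  have w3: "w ^ 3 = 1" by (simp add: w_def)
  have w1: "w \<noteq> 1" using unity_root_power_eq_1_iff[of 3 1] by (simp add: w_def)
  have "(w - 1) * (w ^ 2 + w + 1) = 0" using w3 by (simp add: algebra_simps power2_eq_square power3_eq_cube)
  hence "w ^ 2 + w + 1 = 0" using w1 by simp
  hence ww: "w ^ 2 + w = - 1" by (simp add: add_eq_0_iff add.commute)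
  have "(2 * w + 1) ^ 2 = 4 * (w ^ 2 + w) + 1" by (simp add: power2_eq_square algebra_simps)
  also have "\<dots> = y ^ 2" unfolding ww y(2) by simp
  finally have "2 * w + 1 \<in> K" using csubfield_sqrt_unique[OF K y(1)] by blast
  hence "(2 * w + 1 - 1) / 2 \<in> K" by (intro csubfield_divide[OF K] csubfield_diff[OF K] csubfield_one[OF K] csubfield_numeral[OF K])
  thus ?thesis by (simp add: w_def)
qed

lemma sqrt_minus_3_witness:
  fixes x z :: complex
  assumes "x ^ 2 = of_int a" "z ^ 2 = of_int b" "a * b = - 3 * k ^ 2" "k \<noteq> 0"
  shows "(x * z / of_int k) ^ 2 = - 3"
proof -
  have "(x * z) ^ 2 = of_int (- 3 * k ^ 2)"
    unfolding power_mult_distrib assms(1,2) of_int_mult[symmetric] assms(3) ..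
  thus ?thesis using assms(4) by (simp add: power_divide)
qed

text \<open>
  With \<open>n = 3k\<close>, a square root of \<open>\<plusminus>n\<close> in the field, times a cyclotomic square root of \<open>\<mp>k\<close>, is a
  rational multiple of \<open>\<surd>-3\<close>. A negative \<open>\<gamma>\<close> occurs only when \<open>m\<^bsub>2\<^esub>\<close> is 2 or 4; in the latter case \<open>n = 2 \<cdot> 3t\<close>
  and \<open>((1 + \<i>) x)\<^sup>4 = - n\<^sup>2\<close> when \<open>x\<^sup>2 = 3t\<close>.
\<close>

lemma unity_root_3_in_kummer:
  assumes G: "subgroup G rat_star" and m: "m > 0" "2 dvd m" and \<gamma>: "\<gamma> \<in> Gamma_tilde G m"
    and \<delta>: "3 dvd coset_delta (two_part m) \<gamma>" "coset_delta (two_part m) \<gamma> dvd 6 * int m"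
  shows "unity_root 3 \<in> kummer_field G m"
proof -
  define K where "K = kummer_field G m"
  have K: "subfield K complex_ring" "unity_root m \<in> K"
    unfolding K_def by (rule subfield_kummer unity_root_in_kummer)+
  have "multiplicity 2 m > 0" using m by (simp add: prime_multiplicity_gt_zero_iff)
  then obtain a where a: "multiplicity 2 m = Suc a" by (auto simp: gr0_conv_Suc)
  obtain g \<epsilon> n q where g: "g \<in> G" "\<gamma> = pcoset (two_part m) g" "\<epsilon> = 1 \<or> \<epsilon> = -1" "squarefree n" "q \<noteq> 0"
    "g = of_int (\<epsilon> * int n ^ (2 ^ a)) * q ^ two_part m"
    "coset_delta (two_part m) \<gamma> = sqrt_disc (int n)"
    "\<epsilon> = 1 \<longrightarrow> multiplicity 2 (sqrt_disc (int n)) \<le> Suc a"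
    "\<epsilon> = -1 \<longrightarrow> multiplicity 2 (sqrt_disc (int n)) = Suc (Suc a)"
    using Gamma_tildeE[OF G \<gamma> a] by blast
  have sqf: "squarefree (int n)" using g(4) by (simp add: squarefree_int_iff)
  have d3: "3 dvd sqrt_disc (int n)" and d6: "sqrt_disc (int n) dvd 6 * int m" using \<delta> unfolding g(7) by auto
  have "3 dvd int n \<or> 3 dvd 4 * int n" using d3 by (simp split: if_splits)
  hence "3 dvd int n" by presburger
  then obtain k where k: "int n = 3 * k" by blast
  have k0: "k \<noteq> 0" using sqf k by auto
  have sqk: "squarefree k" using sqf k squarefree_mono[of k "int n"] by simp
  have dm: "two_part m dvd m" unfolding two_part_def by (rule multiplicity_dvd)
  \<comment> \<open>The integer representative may replace g, as the two differ by the m_2-th power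
    of the rational q.\<close>
  have root: "x \<in> K" if "x ^ two_part m = of_int (\<epsilon> * int n ^ (2 ^ a))" for x :: complex
  proof -
    have "(x * of_rat q) ^ two_part m = of_rat g"
      unfolding g(6) power_mult_distrib that by (simp add: of_rat_mult of_rat_power)
    hence "x * of_rat q \<in> K" unfolding K_def using root_in_kummer[OF dm m(1) _ g(1)] by blast
    thus ?thesis by (rule csubfield_cancel[OF K(1) _ csubfield_of_rat[OF K(1)]]) (use g(5) in simp)
  qed
  have dd: "two_part m = 2 * 2 ^ a" using a by (simp add: two_part_def)
  have "\<exists>y\<in>K. y ^ 2 = - 3"
  proof (cases "\<epsilon> = 1")
    case True
    define x z where "x = csqrt (of_int (int n))" and "z = csqrt (of_int (- k))"
    have x2: "x ^ 2 = of_int (int n)" and z2: "z ^ 2 = of_int (- k)" unfolding x_def z_def by (rule power2_csqrt)+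
    have "x ^ two_part m = (x ^ 2) ^ (2 ^ a)" unfolding dd by (rule power_mult)
    hence xK: "x \<in> K" by (intro root) (simp add: True x2)
    \<comment> \<open>n is -3 times -k, and -3 is 1 modulo 4, so n and -k fall into the same case of
      \<open>sqrt_disc\<close>.\<close>
    have disc: "sqrt_disc (int n) = - 3 * sqrt_disc (- k)"
    proof -
      have "int n mod 4 = 1 \<longleftrightarrow> (- k) mod 4 = 1" unfolding k by presburger
      thus ?thesis using k by simp
    qed
    have "sqrt_disc (- k) dvd int m"
    proof (rule dvd_of_dvd_double[OF _ _ a])
      have "3 * sqrt_disc (- k) dvd 3 * (2 * int m)" using d6 unfolding disc by simp
      thus "sqrt_disc (- k) dvd 2 * int m" by (subst (asm) dvd_mult_cancel_left) auto
      show "sqrt_disc (- k) \<noteq> 0" using k0 by auto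
      have "int n mod 4 = 1 \<longleftrightarrow> (- k) mod 4 = 1" unfolding k by presburger
      moreover have "odd (int n) \<longleftrightarrow> odd (- k)" unfolding k by simp
      moreover have sqk': "squarefree (- k)" using sqk by simp
      ultimately have "multiplicity 2 (sqrt_disc (- k)) = multiplicity 2 (sqrt_disc (int n))"
        unfolding multiplicity_2_sqrt_disc[OF sqf] multiplicity_2_sqrt_disc[OF sqk'] by simp
      also have "\<dots> \<le> Suc a" using g(8) True by blast
      finally show "multiplicity 2 (sqrt_disc (- k)) \<le> Suc a" .
    qed (use m in auto)
    hence zK: "z \<in> K" using sqrt_in_cyclotomic_field[OF K m(1) _ _ z2] sqk by simp
    have "(x * z / of_int k) ^ 2 = - 3"
      by (rule sqrt_minus_3_witness[OF x2 z2 _ k0]) (simp add: k power2_eq_square)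
    moreover have "x * z / of_int k \<in> K"
      by (rule csubfield_divide[OF K(1) csubfield_mult[OF K(1) xK zK] csubfield_of_int[OF K(1)]])
    ultimately show ?thesis by blast
  next
    case False
    hence \<epsilon>: "\<epsilon> = -1" using g(3) by simp
    \<comment> \<open>The left side is at least 2, so only two combinations survive: a = 0 with odd
      n, and a = 1 with even n.\<close>
    have mult: "Suc (Suc a) = (if int n mod 4 = 1 then 0 else if odd (int n) then 2 else 3)"
      using g(9) \<epsilon> multiplicity_2_sqrt_disc[OF sqf] by simp
    show ?thesis
    proof (cases "odd (int n)")
      case True
      hence a0: "a = 0" and n4: "int n mod 4 \<noteq> 1" using mult by (auto split: if_splits)
      have k4: "k mod 4 = 1" using n4 True unfolding k by presburger
      define x z where "x = csqrt (of_int (- int n))" and "z = csqrt (of_int k)"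
      have x2: "x ^ 2 = of_int (- int n)" and z2: "z ^ 2 = of_int k" unfolding x_def z_def by (rule power2_csqrt)+
      have xK: "x \<in> K" by (intro root) (simp add: \<epsilon> dd a0 x2)
      have "12 * k dvd 6 * int m" using d6 n4 k by simp
      hence "6 * (2 * k) dvd 6 * int m" by simp
      hence "2 * k dvd int m" by (subst (asm) dvd_mult_cancel_left) auto
      hence "k dvd int m" by (rule dvd_mult_right)
      hence zK: "z \<in> K" using sqrt_mod4_in[OF K m(1) _ k4 z2] by blast
      have "(x * z / of_int k) ^ 2 = - 3"
        by (rule sqrt_minus_3_witness[OF x2 z2 _ k0]) (simp add: k power2_eq_square)
      moreover have "x * z / of_int k \<in> K"
        by (rule csubfield_divide[OF K(1) csubfield_mult[OF K(1) xK zK] csubfield_of_int[OF K(1)]])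
      ultimately show ?thesis by blast
    next
      case False
      hence a1: "a = 1" and n4: "int n mod 4 \<noteq> 1" using mult by (auto split: if_splits)
      have "even k" using False unfolding k by simp
      then obtain t where t: "k = 2 * t" by blast
      have nt: "int n = 2 * (3 * t)" using k t by simp
      have todd: "odd t"
        using sqf
      proof (cases rule: squarefree_int_cases)
        case (3 s)
        hence "s = 3 * t" using nt by simp
        thus ?thesis using 3 by simp
      qed (use False in presburger)+
      \<comment> \<open>Cancelling 6 shows that 4 t divides m. This yields i in the field, so square
        roots of odd divisors of m are available with either sign.\<close>
      have "24 * t dvd 6 * int m" using d6 n4 nt by simp
      hence "6 * (4 * t) dvd 6 * int m" by simp
      hence t4: "4 * t dvd int m" by (subst (asm) dvd_mult_cancel_left) auto
      hence tm: "t dvd int m" by (rule dvd_mult_right)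
      have "int 4 dvd int m" using t4 by (auto elim: dvd_mult_left)
      hence "4 dvd m" by (simp only: of_nat_dvd_iff)
      hence iK: "\<i> \<in> K" using unity_root_dvd_in[OF K _ m(1), of 4] by (simp add: unity_root_4)
      define x z where "x = csqrt (of_int (3 * t))" and "z = csqrt (of_int (- t))"
      have x2: "x ^ 2 = of_int (3 * t)" and z2: "z ^ 2 = of_int (- t)" unfolding x_def z_def by (rule power2_csqrt)+
      have i2: "(1 + \<i>) ^ 2 = 2 * \<i>" by (simp add: power2_eq_square algebra_simps)
      have "((1 + \<i>) * x) ^ 4 = (((1 + \<i>) ^ 2) * x ^ 2) ^ 2"
        by (simp add: power_mult_distrib flip: power_mult)
      also have "\<dots> = of_int (- (int n ^ 2))" unfolding i2 x2 nt by (simp add: power_mult_distrib)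
      finally have "(1 + \<i>) * x \<in> K" by (intro root) (simp add: \<epsilon> dd a1)
      hence "x * (1 + \<i>) \<in> K" by (simp add: mult.commute)
      hence xK: "x \<in> K"
        by (rule csubfield_cancel[OF K(1)]) (use iK in \<open>auto intro!: csubfield_add[OF K(1)] csubfield_one[OF K(1)] simp: complex_eq_iff\<close>)
      have zK: "z \<in> K" by (rule sqrt_odd_in[OF K iK m(1) _ _ z2]) (use todd tm in auto)
      have t0: "t \<noteq> 0" using todd by auto
      have "(x * z / of_int t) ^ 2 = - 3"
        by (rule sqrt_minus_3_witness[OF x2 z2 _ t0]) (simp add: power2_eq_square)
      moreover have "x * z / of_int t \<in> K"
        by (rule csubfield_divide[OF K(1) csubfield_mult[OF K(1) xK zK] csubfield_of_int[OF K(1)]])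
      ultimately show ?thesis by blast
    qed
  qed
  thus ?thesis using unity_root_3_in[OF K(1)] unfolding K_def by blast
qed

text \<open>Triviality of Gamma(3) makes every element of the group a rational cube, so its cube
  roots are rational multiples of powers of zeta_3, and the coset in \<open>Gamma_tilde\<close>
  produces zeta_3.\<close>

lemma rho_eq_0_cubes:
  assumes fg: "finitely_generated_subgroup G" and m: "m > 0" "2 dvd m" "\<not> 3 dvd m"
    and triv: "carrier (mod_powers G 3) = {\<one>\<^bsub>mod_powers G 3\<^esub>}" and \<gamma>: "\<gamma> \<in> Gamma_tilde G m"
    and \<delta>: "3 dvd coset_delta (two_part m) \<gamma>" "coset_delta (two_part m) \<gamma> dvd 6 * int m"
  shows "rho G m = 0"
proof -
  have G: "subgroup G rat_star" using fg by (simp add: finitely_generated_subgroup_def)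
  have "multiplicity 2 m > 0" using m by (simp add: prime_multiplicity_gt_zero_iff)
  then obtain a where a: "multiplicity 2 m = Suc a" by (auto simp: gr0_conv_Suc)
  have d: "two_part m = 2 * 2 ^ a" "(2 :: nat) ^ a > 0" using a by (simp_all add: two_part_def)
  obtain h where h: "h \<in> G" "\<gamma> = pcoset (two_part m) h"
    using Gamma_tildeE[OF G \<gamma> a] by blast
  \<comment> \<open>For h = 1 or h = -1 the squarefree root is 1, hence delta = 1, which 3 does not
    divide.\<close>
  have "\<bar>h\<bar> \<noteq> 1"
  proof
    assume "\<bar>h\<bar> = 1"
    then obtain \<epsilon> :: int where \<epsilon>: "\<epsilon> = 1 \<or> \<epsilon> = -1" "h = of_int \<epsilon>" by (metis abs_eq_iff' of_int_1 of_int_minus)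
    have "\<gamma> = pcoset (two_part m) (of_int (\<epsilon> * int 1 ^ (2 ^ a)) * 1 ^ two_part m)" using h(2) \<epsilon>(2) by simp
    hence "coset_delta (two_part m) \<gamma> = sqrt_disc (int 1)"
      by (intro coset_delta_eq[OF d _ \<epsilon>(1), of 1 1]) auto
    thus False using \<delta>(1) by simp
  qed
  then obtain g where g: "g \<in> G" "g > 1" using subgroup_has_gt_one[OF G h(1)] by blast
  have cube: "\<exists>c. g = c ^ 3" if "g \<in> G" for g
  proof -
    have "pcoset 3 g \<in> carrier (mod_powers G 3)" using that by (simp add: mod_powers_carrier[OF G])
    hence "pcoset 3 g = rat_powers 3" using triv by (simp add: mod_powers_one)
    thus ?thesis using pcoset_self[of g 3] by (auto simp: rat_powers_eq)
  qed
  show ?thesis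
  proof (rule rho_eq_0I[OF fg g m(1), of 3])
    show "prime (3 :: nat)" by simp
    fix k :: nat assume k: "k > 0" "\<not> 3 dvd k"
    define N where "N = m * k"
    have N0: "N > 0" using m k by (simp add: N_def)
    have "\<not> 3 dvd N" unfolding N_def using m(3) k(2) prime_dvd_mult_iff[of "3 :: nat" m k] by simp
    hence c3: "algebraic_semidom_class.coprime 3 N" by (intro prime_imp_coprime) auto
    define K where "K = kummer_field G N"
    have K: "subfield K complex_ring" "unity_root N \<in> K"
      unfolding K_def by (rule subfield_kummer unity_root_in_kummer)+
    have "kummer_field G m \<subseteq> K" unfolding K_def by (rule kummer_mono) (use N0 in \<open>auto simp: N_def\<close>)
    hence z3: "unity_root 3 \<in> K" using unity_root_3_in_kummer[OF G m(1,2) \<gamma> \<delta>] by blast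
    have "kummer_field G (3 * N) \<subseteq> K"
    proof (rule kummer_field_minimal[OF K(1)])
      have e: "unity_root (3 * N) ^ 3 = unity_root N" "unity_root (3 * N) ^ N = unity_root 3"
        using unity_root_dvd[of N "3 * N"] unity_root_dvd[of 3 "3 * N"] N0 by simp_all
      show "unity_root (3 * N) \<in> K"
        by (rule csubfield_coprime_powers[OF K(1) _ _ _ c3]) (simp_all add: e K(2) z3)
      fix x :: complex and g assume g: "g \<in> G" "x ^ (3 * N) = of_rat g"
      have g0: "g \<noteq> 0" using rat_subgroup_nonzero[OF G g(1)] .
      have x0: "x \<noteq> 0" using g g0 N0 by (auto simp: power_0_left)
      have "(x ^ 3) ^ N = of_rat g" using g(2) by (simp add: power_mult)
      hence x3: "x ^ 3 \<in> K" unfolding K_def using root_in_kummer[OF dvd_refl N0 _ g(1)] by blast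
      obtain c where c: "g = c ^ 3" using cube[OF g(1)] by blast
      hence c0: "c \<noteq> 0" using g0 by auto
      have "(x ^ N) ^ 3 = of_rat c ^ 3" using g(2) c by (simp add: of_rat_power mult.commute flip: power_mult)
      then obtain i where "x ^ N = of_rat c * unity_root 3 ^ i"
        using power_unity_roots[of "x ^ N" 3 "of_rat c"] c0 by auto
      hence xN: "x ^ N \<in> K" using csubfield_mult[OF K(1) csubfield_of_rat[OF K(1)] csubfield_power[OF K(1) z3]] by simp
      show "x \<in> K" by (rule csubfield_coprime_powers[OF K(1) x3 xN x0 c3]) simp
    qed
    moreover have "K \<subseteq> kummer_field G (3 * N)" unfolding K_def by (rule kummer_mono) (use N0 in auto)
    ultimately show "kummer_field G (m * (3 * k)) = kummer_field G (m * k)"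
      by (auto simp: K_def N_def mult.left_commute)
  qed
qed

text \<open>The equality of \<open>Gamma_tilde\<close> with Gamma(4) writes each element as plus or
  minus n^2 q^4, so positive elements are squares. Order 2 of Gamma(2) then supplies an element
  -r^2, which puts i into the field; with i the fourth roots of all elements follow.\<close>

lemma rho_eq_0_twice_odd:
  assumes fg: "finitely_generated_subgroup G" and m: "2 dvd m" "\<not> 4 dvd m"
    and ord: "Coset.order (mod_powers G 2) = 2"
    and tilde: "Gamma_tilde G (2 * m) = carrier (mod_powers G 4)"
    and \<delta>: "\<And>\<gamma>. \<gamma> \<in> Gamma_tilde G (2 * m) \<Longrightarrow> coset_delta (two_part (2 * m)) \<gamma> dvd 4 * int m"
  shows "rho G m = 0"
proof -
  have G: "subgroup G rat_star" using fg by (simp add: finitely_generated_subgroup_def)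
  obtain j where j: "m = 2 * j" "odd j" using m by auto
  have m0: "m > 0" using j by (auto simp: odd_pos)
  have mult: "multiplicity 2 (2 * m) = Suc 1"
    using j by (intro multiplicity_decomposeI[of _ 2 "Suc 1" j]) auto
  have tp: "two_part (2 * m) = 4" unfolding two_part_def mult by simp
  have struct: "\<exists>\<epsilon> n q. (\<epsilon> = 1 \<or> \<epsilon> = -1) \<and> squarefree (int n) \<and> q \<noteq> 0 \<and> g = of_int (\<epsilon> * int n ^ 2) * q ^ 4 \<and>
      sqrt_disc (int n) dvd 4 * int m \<and> (\<epsilon> = 1 \<longrightarrow> multiplicity 2 (sqrt_disc (int n)) \<le> 2) \<and>
      (\<epsilon> = -1 \<longrightarrow> multiplicity 2 (sqrt_disc (int n)) = 3)" if "g \<in> G" for g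
  proof -
    define \<gamma> where "\<gamma> = pcoset 4 g"
    have \<gamma>: "\<gamma> \<in> Gamma_tilde G (2 * m)" unfolding tilde \<gamma>_def using that by (simp add: mod_powers_carrier[OF G])
    obtain h \<epsilon> n q where h: "h \<in> G" "\<gamma> = pcoset (two_part (2 * m)) h" "\<epsilon> = 1 \<or> \<epsilon> = -1" "squarefree n" "q \<noteq> 0"
      "h = of_int (\<epsilon> * int n ^ (2 ^ 1)) * q ^ two_part (2 * m)"
      "coset_delta (two_part (2 * m)) \<gamma> = sqrt_disc (int n)"
      "\<epsilon> = 1 \<longrightarrow> multiplicity 2 (sqrt_disc (int n)) \<le> Suc 1"
      "\<epsilon> = -1 \<longrightarrow> multiplicity 2 (sqrt_disc (int n)) = Suc (Suc 1)"
      using Gamma_tildeE[OF G \<gamma> mult] by blast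
    have "pcoset 4 g = pcoset 4 h" using h(2) unfolding tp \<gamma>_def .
    from pcoset_eqD[OF this] obtain c :: rat where c: "c \<noteq> 0" "g = c ^ 4 * h" by (elim exE conjE)
    have "g = of_int (\<epsilon> * int n ^ 2) * (c * q) ^ 4" unfolding c(2) h(6) tp by (simp add: power_mult_distrib)
    moreover have "sqrt_disc (int n) dvd 4 * int m" using \<delta>[OF \<gamma>] unfolding h(7) .
    ultimately show ?thesis using h(3-5,8,9) c(1)
      by (intro exI[of _ \<epsilon>] exI[of _ n] exI[of _ "c * q"]) (auto simp: squarefree_int_iff numeral_2_eq_2 numeral_3_eq_3)
  qed
  have "\<exists>g\<in>G. pcoset 2 g \<noteq> pcoset 2 1"
  proof (rule ccontr)
    assume "\<not> (\<exists>g\<in>G. pcoset 2 g \<noteq> pcoset 2 1)"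
    hence "carrier (mod_powers G 2) \<subseteq> {pcoset 2 1}" by (auto simp: mod_powers_carrier[OF G])
    hence "card (carrier (mod_powers G 2)) \<le> 1"
      using card_mono[of "{pcoset 2 1}"] by simp
    thus False using ord by (simp add: Coset.order_def)
  qed
  then obtain g0 where g0: "g0 \<in> G" "pcoset 2 g0 \<noteq> pcoset 2 1" by blast
  obtain \<epsilon>0 n0 q0 where s0: "\<epsilon>0 = 1 \<or> \<epsilon>0 = -1" "squarefree (int n0)" "q0 \<noteq> 0" "g0 = of_int (\<epsilon>0 * int n0 ^ 2) * q0 ^ 4"
    "\<epsilon>0 = -1 \<longrightarrow> multiplicity 2 (sqrt_disc (int n0)) = 3"
    using struct[OF g0(1)] by blast
  define r where "r = of_int (int n0) * q0 ^ 2"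
  have n00: "n0 \<noteq> 0"
  proof
    assume "n0 = 0"
    thus False using s0(2) by simp
  qed
  have r0: "r \<noteq> 0" using s0(3) n00 by (simp add: r_def)
  have g0r: "g0 = of_int \<epsilon>0 * r ^ 2" by (simp add: s0(4) r_def power_mult_distrib flip: power_mult)
  have \<epsilon>0: "\<epsilon>0 = -1"
  proof (rule ccontr)
    assume "\<epsilon>0 \<noteq> -1"
    hence "g0 = 1 * r ^ 2" using s0(1) g0r by simp
    thus False using g0(2) pcoset_mult_power[OF r0, of 2 1] by simp
  qed
  \<comment> \<open>Otherwise r is 1 or -1, so n0 = 1 with discriminant 1, but a negative element
    requires a discriminant of valuation 3.\<close>
  have "\<bar>g0\<bar> \<noteq> 1"
  proof
    assume 1: "\<bar>g0\<bar> = 1"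
    hence "r ^ 2 = 1" using g0r \<epsilon>0 by simp
    hence "\<bar>r\<bar> = 1" by (auto simp: power2_eq_1_iff)
    hence "q0 ^ 2 * of_int (int n0) = 1" by (simp add: r_def abs_mult mult.commute)
    hence "q0 ^ 2 * of_int (int n0) \<in> \<int>" by simp
    hence "q0 \<in> \<int>" by (rule rat_square_times_squarefree[OF s0(2)])
    then obtain z where "q0 = of_int z" by (auto elim: Ints_cases)
    hence "of_int (z ^ 2 * int n0) = (1 :: rat)" using \<open>q0 ^ 2 * of_int (int n0) = 1\<close> by simp
    hence "z ^ 2 * int n0 = 1" by (simp only: of_int_eq_1_iff)
    hence "int n0 dvd 1" by (metis dvd_triv_right)
    hence "int n0 = 1" by simp
    thus False using s0(5) \<epsilon>0 multiplicity_2_sqrt_disc[OF s0(2)] by simp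
  qed
  then obtain g1 where g1: "g1 \<in> G" "g1 > 1" using subgroup_has_gt_one[OF G g0(1)] by blast
  show ?thesis
  proof (rule rho_eq_0I[OF fg g1 m0 two_is_prime_nat])
    fix k :: nat assume k: "k > 0" "\<not> 2 dvd k"
    \<comment> \<open>l is the odd half of N, so 2N = 4l. As N is even, the coprime exponents are 4
      and l for zeta_2N, and 2 and l for the roots x, with x^l a fourth root.\<close>
    define l where "l = j * k"
    define N where "N = m * k"
    have Nl: "N = 2 * l" by (simp add: N_def l_def j)
    have l: "odd l" "l > 0" using j k by (auto simp: l_def odd_pos)
    have N0: "N > 0" using l Nl by simp
    have c2: "algebraic_semidom_class.coprime 2 l" using l(1) by simp
    have c4: "algebraic_semidom_class.coprime 4 l"
      using l(1) algebraic_semidom_class.coprime_commute coprime_power_left_iff[of 2 2 l] by simp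
    define K where "K = kummer_field G N"
    have K: "subfield K complex_ring" "unity_root N \<in> K"
      unfolding K_def by (rule subfield_kummer unity_root_in_kummer)+
    have iK: "\<i> \<in> K"
    proof -
      have "(\<i> * of_rat r) ^ 2 = of_rat g0"
        by (simp add: g0r \<epsilon>0 power_mult_distrib of_rat_mult of_rat_power of_rat_minus)
      hence "\<i> * of_rat r \<in> K" unfolding K_def using root_in_kummer[OF _ N0 _ g0(1), of 2] Nl by simp
      thus ?thesis by (rule csubfield_cancel[OF K(1) _ csubfield_of_rat[OF K(1)]]) (use r0 in simp)
    qed
    have zl: "unity_root l \<in> K" by (rule unity_root_dvd_in[OF K _ N0]) (simp add: Nl)
    have z2N: "unity_root (2 * N) \<in> K"
    proof -
      have e: "unity_root (2 * N) ^ 4 = unity_root l" "unity_root (2 * N) ^ l = \<i>"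
        using unity_root_dvd[of l "2 * N"] unity_root_dvd[of 4 "2 * N"] l by (simp_all add: Nl unity_root_4)
      show ?thesis by (rule csubfield_coprime_powers[OF K(1) _ _ _ c4]) (simp_all add: e zl iK)
    qed
    have fourth: "y \<in> K" if g: "g \<in> G" "y ^ 4 = of_rat g" for y :: complex and g
    proof -
      obtain \<epsilon> n q where s: "\<epsilon> = 1 \<or> \<epsilon> = -1" "squarefree (int n)" "q \<noteq> 0" "g = of_int (\<epsilon> * int n ^ 2) * q ^ 4"
        "sqrt_disc (int n) dvd 4 * int m" "\<epsilon> = 1 \<longrightarrow> multiplicity 2 (sqrt_disc (int n)) \<le> 2"
        "\<epsilon> = -1 \<longrightarrow> multiplicity 2 (sqrt_disc (int n)) = 3"
        using struct[OF g(1)] by blast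
      have n0: "n \<noteq> 0"
      proof
        assume "n = 0"
        thus False using s(2) by simp
      qed
      have "\<exists>x\<in>K. x ^ 4 = of_int (\<epsilon> * int n ^ 2)"
      proof (cases "\<epsilon> = 1")
        case True
        define x where "x = csqrt (of_int (int n))"
        have x2: "x ^ 2 = of_int (int n)" unfolding x_def by (rule power2_csqrt)
        \<comment> \<open>The divisor 4 m is twice 2 m, and the valuation bound removes the spare 2.
          Since zeta_2N already lies in K, the order 2N may be used for the square root of
          n.\<close>
        have "sqrt_disc (int n) dvd int (2 * m)"
          by (rule dvd_of_dvd_double[OF _ _ mult]) (use s(5,6) True n0 m0 in auto)
        hence "sqrt_disc (int n) dvd int (2 * N)" by (simp add: N_def mult.assoc[symmetric] dvd_mult2)
        hence "x \<in> K" using sqrt_in_cyclotomic_field[OF K(1) z2N _ s(2) _ x2] N0 by simp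
        moreover have "x ^ 4 = (x ^ 2) ^ 2" by (simp flip: power_mult)
        hence "x ^ 4 = of_int (\<epsilon> * int n ^ 2)" unfolding x2 by (simp add: True)
        ultimately show ?thesis by blast
      next
        case False
        hence \<epsilon>: "\<epsilon> = -1" using s(1) by simp
        have n4: "int n mod 4 \<noteq> 1" "even (int n)"
          using s(7) \<epsilon> multiplicity_2_sqrt_disc[OF s(2)] by (auto split: if_splits)
        obtain t where t: "int n = 2 * t" "odd t"
          using s(2)
        proof (cases rule: squarefree_int_cases)
          case (3 t)
          thus ?thesis using that by blast
        qed (use n4 in presburger)+
        have "8 * t dvd 4 * int m" using s(5) n4 t by simp
        hence "4 * (2 * t) dvd 4 * int m" by simp
        hence "2 * t dvd int m" by (subst (asm) dvd_mult_cancel_left) auto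
        hence "t dvd int m" by (rule dvd_mult_right)
        hence "t dvd int N" by (simp add: N_def dvd_mult2)
        define x where "x = csqrt (of_int t)"
        have x2: "x ^ 2 = of_int t" unfolding x_def by (rule power2_csqrt)
        have xK: "x \<in> K" by (rule sqrt_odd_in[OF K iK N0 t(2) \<open>t dvd int N\<close> x2])
        have i2: "(1 + \<i>) ^ 2 = 2 * \<i>" by (simp add: power2_eq_square algebra_simps)
        \<comment> \<open>(1 + i)^4 = -4, so (1 + i) sqrt t is a fourth root of -4 t^2 =
          -n^2.\<close>
        have "((1 + \<i>) * x) ^ 4 = (((1 + \<i>) ^ 2) * x ^ 2) ^ 2"
          by (simp add: power_mult_distrib flip: power_mult)
        also have "\<dots> = of_int (\<epsilon> * int n ^ 2)" unfolding i2 x2 t(1) by (simp add: power_mult_distrib \<epsilon>)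
        finally show ?thesis
          using xK iK by (intro bexI[of _ "(1 + \<i>) * x"] csubfield_mult[OF K(1)] csubfield_add[OF K(1)] csubfield_one[OF K(1)])
      qed
      then obtain x where x: "x \<in> K" "x ^ 4 = of_int (\<epsilon> * int n ^ 2)" by blast
      have "x \<noteq> 0" using x(2) s(1) n0 by (auto simp: power_0_left)
      moreover have "y ^ 4 = (x * of_rat q) ^ 4"
        unfolding g(2) s(4) power_mult_distrib x(2) by (simp add: of_rat_mult of_rat_power)
      ultimately obtain i where "y = x * of_rat q * unity_root 4 ^ i"
        using power_unity_roots[of y 4 "x * of_rat q"] s(3) by auto
      thus ?thesis
        using csubfield_mult[OF K(1) csubfield_mult[OF K(1) x(1) csubfield_of_rat[OF K(1)]] csubfield_power[OF K(1) iK]]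
        by (simp add: unity_root_4)
    qed
    have "kummer_field G (2 * N) \<subseteq> K"
    proof (rule kummer_field_minimal[OF K(1) z2N])
      fix x :: complex and g assume g: "g \<in> G" "x ^ (2 * N) = of_rat g"
      have x0: "x \<noteq> 0" using g rat_subgroup_nonzero[OF G g(1)] N0 by (auto simp: power_0_left)
      have "(x ^ 2) ^ N = of_rat g" using g(2) by (simp add: power_mult)
      hence x2: "x ^ 2 \<in> K" unfolding K_def using root_in_kummer[OF dvd_refl N0 _ g(1)] by blast
      have "(x ^ l) ^ 4 = of_rat g" unfolding g(2)[symmetric] Nl by (simp add: mult_ac flip: power_mult)
      hence xl: "x ^ l \<in> K" by (rule fourth[OF g(1)])
      show "x \<in> K" by (rule csubfield_coprime_powers[OF K(1) x2 xl x0 c2]) simp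
    qed
    moreover have "K \<subseteq> kummer_field G (2 * N)" unfolding K_def by (rule kummer_mono) (use N0 in auto)
    ultimately show "kummer_field G (m * (2 * k)) = kummer_field G (m * k)"
      by (auto simp: K_def N_def mult.left_commute)
  qed
qed

theorem theorem4:
  fixes \<Gamma> :: "rat set" and m :: nat
  assumes fg: "finitely_generated_subgroup \<Gamma>"
    and nontrivial: "\<Gamma> \<noteq> {1}"
    and m: "m > 0"
    and conditions:
      "(\<not> 2 dvd m \<and> (\<forall>g \<in> \<Gamma>. disc_sqrt g dvd int m))
       \<or> (2 dvd m \<and> \<not> 3 dvd m \<and> carrier (mod_powers \<Gamma> 3) = {\<one>\<^bsub>mod_powers \<Gamma> 3\<^esub>} \<and>
          (\<exists>\<gamma>\<^sub>1 \<in> Gamma_tilde \<Gamma> m.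
             3 dvd coset_delta (two_part m) \<gamma>\<^sub>1 \<and> coset_delta (two_part m) \<gamma>\<^sub>1 dvd 6 * int m))
       \<or> (2 dvd m \<and> \<not> 4 dvd m \<and> Coset.order (mod_powers \<Gamma> 2) = 2 \<and>
          Gamma_tilde \<Gamma> (2 * m) = carrier (mod_powers \<Gamma> 4) \<and>
          (\<forall>\<gamma> \<in> Gamma_tilde \<Gamma> (2 * m). coset_delta (two_part (2 * m)) \<gamma> dvd 4 * int m))"
  shows "rho \<Gamma> m = 0"
  using conditions
proof (elim disjE conjE bexE)
  assume "\<not> 2 dvd m" "\<forall>g \<in> \<Gamma>. disc_sqrt g dvd int m"
  thus ?thesis by (intro rho_eq_0_odd[OF fg nontrivial]) auto
next
  fix \<gamma> assume "2 dvd m" "\<not> 3 dvd m" "carrier (mod_powers \<Gamma> 3) = {\<one>\<^bsub>mod_powers \<Gamma> 3\<^esub>}"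
    "\<gamma> \<in> Gamma_tilde \<Gamma> m" "3 dvd coset_delta (two_part m) \<gamma>" "coset_delta (two_part m) \<gamma> dvd 6 * int m"
  thus ?thesis by (intro rho_eq_0_cubes[OF fg m])
next
  assume "2 dvd m" "\<not> 4 dvd m" "Coset.order (mod_powers \<Gamma> 2) = 2"
    "Gamma_tilde \<Gamma> (2 * m) = carrier (mod_powers \<Gamma> 4)"
    "\<forall>\<gamma> \<in> Gamma_tilde \<Gamma> (2 * m). coset_delta (two_part (2 * m)) \<gamma> dvd 4 * int m"
  thus ?thesis by (intro rho_eq_0_twice_odd[OF fg]) auto
qed

end
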